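(* The Jacobian $\mathcal O_X$-modules $\mathcal J_X^p$ of a reduced Cohen--Macaulay germ $X$ depend only on $X$ (up to isomorphism of $\mathcal O_X$-modules). That is: if $X\subseteq C\subseteq Y\cong(\mathbb C^n,0)$ and $X\subseteq C'\subseteq Y'\cong(\mathbb C^{n'},0)$ are two embeddings of $X$ with $C$, $C'$ reduced complete intersections of the same dimension as $X$, and $X$ of codimension at least $2$ in $Y$ and in $Y'$, then for every $p$ with $0\le p\le\min(n,n')$ the module $\mathcal J_X^p$ formed from $Y$, $C$ and the module $\mathcal J_X^p$ formed from $Y'$, $C'$ (and any choices of generators of the complete intersection ideals and of fundamental forms) are isomorphic as $\mathcal O_X$-modules.
   Context: For $Y\cong(\mathbb C^n,0)$, $\mathcal O_Y\cong\mathbb C\{x_1,\dots,x_n\}$, $\Omega_Y^q$ is the free $\mathcal O_Y$-module of holomorphic differential $q$-forms and $\Theta_Y^q=\bigwedge^q\operatorname{Der}_{\mathbb C}(\mathcal O_Y)=\operatorname{Hom}_{\mathcal O_Y}(\Omega_Y^q,\mathcal O_Y)$, with the perfect pairing $\langle-,-\rangle$ for which the standard coordinate bases are dual. Let $X\subseteq Y$ be a reduced Cohen--Macaulay germ of codimension $k\ge2$, contained in a reduced complete intersection $C\subseteq Y$ of codimension $k$ (such $C$ exists), and let $\underline h=(h_1,\dots,h_k)$ be a regular sequence generating the ideal of $C$; $d\underline h=dh_1\wedge\dots\wedge dh_k$. Let $X'=\overline{C\setminus X}$. The total rings of fractions satisfy $\mathcal Q_C=\mathcal Q_X\times\mathcal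 Q_{X'}$; let $\mathbf 1_X=(1,0)\in\mathcal Q_C$. A fundamental form of $X$ in $Y$ is an $\alpha_X\in\Omega_Y^k$ whose image in $\mathcal Q_C\otimes_{\mathcal O_Y}\Omega_Y^k$ equals that of $\mathbf 1_X\,d\underline h$; such a form exists. Contraction with $\alpha_X$ defines $$\alpha^X\colon\Theta_Y^q\to\mathcal O_X\otimes_{\mathcal O_Y}\Theta_Y^{q-k}=\operatorname{Hom}_{\mathcal O_Y}(\Omega_Y^{q-k},\mathcal O_X),\quad\delta\mapsto\bigl(\omega\mapsto\overline{\langle\delta,\alpha_X\wedge\omega\rangle}\bigr)$$ (with $\Omega_Y^{j}=\Theta_Y^j=0$ for $j<0$). For $p+q=n$, the $p$th Jacobian module of $X$ is the $\mathcal O_X$-module $\mathcal J_X^p:=\alpha^X(\Theta_Y^q)$. *)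

theory Defs
  imports
    "HOL-Analysis.Infinite_Sum"
    "HOL-Library.Poly_Mapping"
    "HOL-Library.Extended_Nat"
    "HOL-Algebra.Algebra"
    "HOL-Algebra.Algebraic_Closure_Type"
begin

section \<open>Power series and the local ring of complex affine space\<close>

text \<open>
  Formal power series over the complex numbers in the variables \<open>x\<^sub>i\<close>, \<open>i :: nat\<close>. A monomial
  is a finitely supported exponent vector. The number of variables is bounded only in the
  carrier of \<open>conv_ring n\<close> below.
\<close>

typedef mpser = "UNIV :: ((nat \<Rightarrow>\<^sub>0 nat) \<Rightarrow> complex) set"
  morphisms coef Mpser ..

setup_lifting type_definition_mpser

lemma mpser_eqI: "(\<And>m. coef f m = coef g m) \<Longrightarrow> f = g"
  by (simp add: coef_inject[symmetric] fun_eq_iff)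

lemma finite_monom_splittings: "finite {(a, b). a + b = (m :: nat \<Rightarrow>\<^sub>0 nat)}"
proof -
  let ?B = "{h. \<forall>i. (i \<in> Poly_Mapping.keys m \<longrightarrow>
                      h i \<in> {..Max (Poly_Mapping.lookup m ` Poly_Mapping.keys m)}) \<and>
                   (i \<notin> Poly_Mapping.keys m \<longrightarrow> h i = (0 :: nat))}"
  have fin: "finite ?B"
    by (rule finite_set_of_finite_funs) auto
  have "Poly_Mapping.lookup a \<in> ?B" if "a + b = m" for a b
  proof -
    have le: "Poly_Mapping.lookup a i \<le> Poly_Mapping.lookup m i" for i
      by (simp add: lookup_add flip: that)
    show ?thesis
    proof (intro CollectI conjI allI impI)
      fix i assume "i \<in> Poly_Mapping.keys m"
      then have "Poly_Mapping.lookup m i \<le> Max (Poly_Mapping.lookup m ` Poly_Mapping.keys m)"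
        by simp
      then show "Poly_Mapping.lookup a i \<in> {..Max (Poly_Mapping.lookup m ` Poly_Mapping.keys m)}"
        using le[of i] by simp
    next
      fix i assume "i \<notin> Poly_Mapping.keys m"
      then show "Poly_Mapping.lookup a i = 0"
        using le[of i] by (simp add: in_keys_iff)
    qed
  qed
  then have sub: "Poly_Mapping.lookup ` {a. \<exists>b. a + b = m} \<subseteq> ?B"
    by auto
  have "finite {a. \<exists>b. a + b = m}"
    by (rule finite_imageD[OF finite_subset[OF sub fin]])
       (simp add: inj_on_def poly_mapping.lookup_inject)
  moreover have "{(a, b). a + b = m} = (\<lambda>a. (a, m - a)) ` {a. \<exists>b. a + b = m}"
    by (auto simp: image_iff)
  ultimately show ?thesis
    by simp
qed

instantiation mpser :: comm_ring_1
begin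

lift_definition zero_mpser :: mpser is "\<lambda>_. 0" .
lift_definition one_mpser :: mpser is "\<lambda>m. if m = 0 then 1 else 0" .
lift_definition plus_mpser :: "mpser \<Rightarrow> mpser \<Rightarrow> mpser" is "\<lambda>f g m. f m + g m" .
lift_definition minus_mpser :: "mpser \<Rightarrow> mpser \<Rightarrow> mpser" is "\<lambda>f g m. f m - g m" .
lift_definition uminus_mpser :: "mpser \<Rightarrow> mpser" is "\<lambda>f m. - f m" .
lift_definition times_mpser :: "mpser \<Rightarrow> mpser \<Rightarrow> mpser" is
  "\<lambda>f g m. \<Sum>(a, b) | a + b = m. f a * g b" .

instance
proof
  fix f g h :: mpser
  have fin: "finite {(a, b). a + b = m}" for m :: "nat \<Rightarrow>\<^sub>0 nat"
    by (rule finite_monom_splittings)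
  show "f * g * h = f * (g * h)"
  proof (transfer, rule ext)
    fix f g h :: "(nat \<Rightarrow>\<^sub>0 nat) \<Rightarrow> complex" and m
    have "(\<Sum>(a, b) | a + b = m. (\<Sum>(c, d) | c + d = a. f c * g d) * h b) =
        (\<Sum>p\<in>{(a, b). a + b = m}. \<Sum>q\<in>{(a, b). a + b = fst p}. f (fst q) * g (snd q) * h (snd p))"
      by (simp add: sum_distrib_right case_prod_beta)
    also have "\<dots> = (\<Sum>(p, q)\<in>Sigma {(a, b). a + b = m} (\<lambda>p. {(a, b). a + b = fst p}).
        f (fst q) * g (snd q) * h (snd p))"
      by (rule sum.Sigma) (use fin in auto)
    also have "\<dots> = (\<Sum>(p, q)\<in>Sigma {(a, b). a + b = m} (\<lambda>p. {(a, b). a + b = snd p}).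
        f (fst p) * (g (fst q) * h (snd q)))"
      by (rule sum.reindex_bij_witness
            [where i = "\<lambda>((a, bc), (b, c)). ((a + b, c), (a, b))"
               and j = "\<lambda>((ab, c), (a, b)). ((a, b + c), (b, c))"])
         (auto simp: add.assoc mult.assoc)
    also have "\<dots> = (\<Sum>p\<in>{(a, b). a + b = m}. \<Sum>q\<in>{(a, b). a + b = snd p}.
        f (fst p) * (g (fst q) * h (snd q)))"
      by (rule sum.Sigma[symmetric]) (use fin in auto)
    also have "\<dots> = (\<Sum>(a, b) | a + b = m. f a * (\<Sum>(c, d) | c + d = b. g c * h d))"
      by (simp add: sum_distrib_left case_prod_beta)
    finally show "(\<Sum>(a, b) | a + b = m. (\<Sum>(c, d) | c + d = a. f c * g d) * h b) =
        (\<Sum>(a, b) | a + b = m. f a * (\<Sum>(c, d) | c + d = b. g c * h d))" .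
  qed
  show "f * g = g * f"
  proof (transfer, rule ext)
    fix f g :: "(nat \<Rightarrow>\<^sub>0 nat) \<Rightarrow> complex" and m
    show "(\<Sum>(a, b) | a + b = m. f a * g b) = (\<Sum>(a, b) | a + b = m. g a * f b)"
      by (rule sum.reindex_bij_witness[where i = prod.swap and j = prod.swap])
         (auto simp: add.commute mult.commute)
  qed
  show "1 * f = f"
  proof (transfer, rule ext)
    fix f :: "(nat \<Rightarrow>\<^sub>0 nat) \<Rightarrow> complex" and m
    have "(\<Sum>(a, b) | a + b = m. (if a = 0 then 1 else 0) * f b) = (\<Sum>(a :: nat \<Rightarrow>\<^sub>0 nat, b)\<in>{(0, m)}. f b)"
      by (rule sum.mono_neutral_cong_right) (use fin in \<open>auto split: if_splits\<close>)
    then show "(\<Sum>(a, b) | a + b = m. (if a = 0 then 1 else 0) * f b) = f m"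
      by simp
  qed
  show "(f + g) * h = f * h + g * h"
    by transfer (auto simp: distrib_right sum.distrib case_prod_beta)
  show "(0 :: mpser) \<noteq> 1"
  proof
    assume "(0 :: mpser) = 1"
    then have "coef 0 0 = coef 1 0"
      by simp
    then show False
      by (simp add: zero_mpser.rep_eq one_mpser.rep_eq)
  qed
qed (rule mpser_eqI, simp add: zero_mpser.rep_eq plus_mpser.rep_eq minus_mpser.rep_eq
       uminus_mpser.rep_eq)+

end

lift_definition scale_mpser :: "complex \<Rightarrow> mpser \<Rightarrow> mpser" is "\<lambda>c f m. c * f m" .

lift_definition pd :: "nat \<Rightarrow> mpser \<Rightarrow> mpser" is
  "\<lambda>i f m. of_nat (Poly_Mapping.lookup m i + 1) * f (m + Poly_Mapping.single i 1)" .

definition monom_deg :: "(nat \<Rightarrow>\<^sub>0 nat) \<Rightarrow> nat" where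
  "monom_deg m = (\<Sum>i\<in>Poly_Mapping.keys m. Poly_Mapping.lookup m i)"

definition convergent_mpser :: "mpser \<Rightarrow> bool" where
  "convergent_mpser f \<longleftrightarrow>
     (\<exists>r>0. (\<lambda>m. norm (coef f m) * r ^ monom_deg m) summable_on UNIV)"

text \<open>
  The complex algebra of convergent power series in \<open>x\<^sub>0, \<dots>, x\<^bsub>n-1\<^esub>\<close>, that is, the local
  ring of complex affine \<open>n\<close>-space at the origin.
\<close>

definition conv_ring :: "nat \<Rightarrow> (complex, mpser) module" where
  "conv_ring n =
     \<lparr>carrier = {f. (\<forall>m. coef f m \<noteq> 0 \<longrightarrow> Poly_Mapping.keys m \<subseteq> {..<n}) \<and> convergent_mpser f},
      monoid.mult = (*), monoid.one = 1, ring.zero = 0, ring.add = (+),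
      module.smult = scale_mpser\<rparr>"

section \<open>Notions from commutative algebra\<close>

definition reduced_ring :: "('a, 'm) ring_scheme \<Rightarrow> bool" where
  "reduced_ring R \<longleftrightarrow>
     cring R \<and> (\<forall>x\<in>carrier R. \<forall>m::nat. x [^]\<^bsub>R\<^esub> m = \<zero>\<^bsub>R\<^esub> \<longrightarrow> x = \<zero>\<^bsub>R\<^esub>)"

definition nonzerodivisors :: "('a, 'm) ring_scheme \<Rightarrow> 'a set" where
  "nonzerodivisors R =
     {s \<in> carrier R. \<forall>x\<in>carrier R. s \<otimes>\<^bsub>R\<^esub> x = \<zero>\<^bsub>R\<^esub> \<longrightarrow> x = \<zero>\<^bsub>R\<^esub>}"

definition regular_sequence :: "('a, 'm) ring_scheme \<Rightarrow> 'a list \<Rightarrow> bool" where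
  "regular_sequence R xs \<longleftrightarrow>
     set xs \<subseteq> carrier R \<and>
     (\<forall>i<length xs.
        let I = genideal R (set (take i xs))
        in I +>\<^bsub>R\<^esub> (xs ! i) \<in> nonzerodivisors (R Quot I)) \<and>
     genideal R (set xs) \<noteq> carrier R"

definition krull_dim :: "('a, 'm) ring_scheme \<Rightarrow> enat" where
  "krull_dim R =
     Sup {enat m | m. \<exists>P. (\<forall>i\<le>m. primeideal (P i) R) \<and> (\<forall>i<m. P i \<subset> P (Suc i))}"

definition depth :: "('a, 'm) ring_scheme \<Rightarrow> 'a set \<Rightarrow> enat" where
  "depth R I = Sup {enat (length xs) | xs. regular_sequence R xs \<and> set xs \<subseteq> I}"

text \<open>Cohen--Macaulay local rings: Noetherian, with a unique maximal ideal, of maximal depth.\<close>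

definition cohen_macaulay_local :: "('a, 'm) ring_scheme \<Rightarrow> bool" where
  "cohen_macaulay_local R \<longleftrightarrow>
     cring R \<and> noetherian_ring R \<and>
     (\<exists>M. (\<forall>I. maximalideal I R \<longleftrightarrow> I = M) \<and> depth R M = krull_dim R)"

text \<open>The fraction \<open>a/s\<close>, as the set of all pairs representing it.\<close>

definition fraction :: "('a, 'm) ring_scheme \<Rightarrow> 'a \<Rightarrow> 'a \<Rightarrow> ('a \<times> 'a) set" where
  "fraction R a s =
     {(b, t). b \<in> carrier R \<and> t \<in> nonzerodivisors R \<and> a \<otimes>\<^bsub>R\<^esub> t = b \<otimes>\<^bsub>R\<^esub> s}"

definition total_frac_ring :: "('a, 'm) ring_scheme \<Rightarrow> ('a \<times> 'a) set ring" where
  "total_frac_ring R =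
     \<lparr>carrier = {fraction R a s | a s. a \<in> carrier R \<and> s \<in> nonzerodivisors R},
      monoid.mult = (\<lambda>x y. \<Union>(a, s)\<in>x. \<Union>(b, t)\<in>y. fraction R (a \<otimes>\<^bsub>R\<^esub> b) (s \<otimes>\<^bsub>R\<^esub> t)),
      monoid.one = fraction R \<one>\<^bsub>R\<^esub> \<one>\<^bsub>R\<^esub>,
      ring.zero = fraction R \<zero>\<^bsub>R\<^esub> \<one>\<^bsub>R\<^esub>,
      ring.add = (\<lambda>x y. \<Union>(a, s)\<in>x. \<Union>(b, t)\<in>y.
               fraction R (a \<otimes>\<^bsub>R\<^esub> t \<oplus>\<^bsub>R\<^esub> b \<otimes>\<^bsub>R\<^esub> s) (s \<otimes>\<^bsub>R\<^esub> t))\<rparr>"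

text \<open>
  The extension of a ring homomorphism \<open>\<phi> : R \<rightarrow> S\<close> to total rings of fractions, as a relation:
  it sends \<open>a/s\<close> to \<open>\<phi>(a)/\<phi>(s)\<close> and is a map if \<open>\<phi>\<close> preserves nonzerodivisors, as it does when
  it restricts functions on a reduced germ to a union of irreducible components.
\<close>

definition frac_map ::
  "('a, 'm) ring_scheme \<Rightarrow> ('b, 'k) ring_scheme \<Rightarrow> ('a \<Rightarrow> 'b) \<Rightarrow>
   ('a \<times> 'a) set \<Rightarrow> ('b \<times> 'b) set \<Rightarrow> bool" where
  "frac_map R S \<phi> x y \<longleftrightarrow>
     (\<exists>a\<in>carrier R. \<exists>s\<in>nonzerodivisors R.
        \<phi> s \<in> nonzerodivisors S \<and> x = fraction R a s \<and> y = fraction S (\<phi> a) (\<phi> s))"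

text \<open>Module homomorphisms; they are extensional, so that equality of homomorphisms is equality.\<close>

definition mod_hom ::
  "('a, 'm) ring_scheme \<Rightarrow> ('a, 'b, 'k) module_scheme \<Rightarrow> ('a, 'c, 'l) module_scheme \<Rightarrow>
   ('b \<Rightarrow> 'c) set" where
  "mod_hom R M N =
     {\<phi> \<in> carrier M \<rightarrow>\<^sub>E carrier N.
        (\<forall>x\<in>carrier M. \<forall>y\<in>carrier M. \<phi> (x \<oplus>\<^bsub>M\<^esub> y) = \<phi> x \<oplus>\<^bsub>N\<^esub> \<phi> y) \<and>
        (\<forall>r\<in>carrier R. \<forall>x\<in>carrier M. \<phi> (r \<odot>\<^bsub>M\<^esub> x) = r \<odot>\<^bsub>N\<^esub> \<phi> x)}"

definition mod_isomorphic ::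
  "('a, 'm) ring_scheme \<Rightarrow> ('a, 'b, 'k) module_scheme \<Rightarrow> ('a, 'c, 'l) module_scheme \<Rightarrow> bool" where
  "mod_isomorphic R M N \<longleftrightarrow>
     (\<exists>\<phi>\<in>mod_hom R M N. bij_betw \<phi> (carrier M) (carrier N))"

definition self_module :: "('a, 'm) ring_scheme \<Rightarrow> ('a, 'a) module" where
  "self_module R =
     \<lparr>carrier = carrier R, monoid.mult = monoid.mult R, monoid.one = \<one>\<^bsub>R\<^esub>,
      ring.zero = \<zero>\<^bsub>R\<^esub>, ring.add = ring.add R, module.smult = monoid.mult R\<rparr>"

section \<open>Differential forms and multivector fields\<close>

text \<open>
  A form is given by its coefficients: \<open>\<omega>\<close> stands for the sum over finite \<open>J\<close> of \<open>\<omega> J dx\<^sub>J\<close>, where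
  \<open>dx\<^sub>J\<close> is the wedge product of the \<open>dx\<^sub>j\<close>, \<open>j \<in> J\<close>, in increasing order. Degrees are integers; in
  negative degree the only form is zero. The multiplicative fields of the module record are junk.
\<close>

type_synonym form = "nat set \<Rightarrow> mpser"

definition Omega :: "nat \<Rightarrow> int \<Rightarrow> (mpser, form) module" where
  "Omega n q =
     \<lparr>carrier = {\<omega>. (\<forall>J. \<omega> J \<in> carrier (conv_ring n)) \<and>
                    (\<forall>J. \<omega> J \<noteq> 0 \<longrightarrow> J \<subseteq> {..<n} \<and> int (card J) = q)},
      monoid.mult = undefined, monoid.one = undefined,
      ring.zero = (\<lambda>J. 0), ring.add = (\<lambda>\<omega> \<eta> J. \<omega> J + \<eta> J), module.smult = (\<lambda>f \<omega> J. f * \<omega> J)\<rparr>"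

text \<open>For disjoint \<open>J\<close> and \<open>L\<close>: \<open>dx\<^sub>J \<and> dx\<^sub>L = shuffle_sign J L dx\<^bsub>J \<union> L\<^esub>\<close>.\<close>

definition shuffle_sign :: "nat set \<Rightarrow> nat set \<Rightarrow> mpser" where
  "shuffle_sign J L = (- 1) ^ card {(j, l). j \<in> J \<and> l \<in> L \<and> l < j}"

definition wedge :: "form \<Rightarrow> form \<Rightarrow> form" where
  "wedge \<alpha> \<beta> K = (\<Sum>J\<in>Pow K. shuffle_sign J (K - J) * \<alpha> J * \<beta> (K - J))"

definition unit_form :: form where
  "unit_form J = (if J = {} then 1 else 0)"

definition differential :: "mpser \<Rightarrow> form" where
  "differential f J = (if \<exists>i. J = {i} then pd (the_elem J) f else 0)"

definition wedge_differentials :: "mpser list \<Rightarrow> form" where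
  "wedge_differentials hs = foldr wedge (map differential hs) unit_form"

text \<open>
  Multivector fields of degree \<open>q\<close> as the dual of \<open>q\<close>-forms; the pairing is evaluation.
\<close>

definition Theta :: "nat \<Rightarrow> int \<Rightarrow> (form \<Rightarrow> mpser) set" where
  "Theta n q = mod_hom (conv_ring n) (Omega n q) (self_module (conv_ring n))"

section \<open>Embedded germs, fundamental forms and Jacobian modules\<close>

text \<open>
  A germ \<open>X\<close> is represented by its local ring \<open>R\<close>, a complex algebra, and a closed embedding of
  \<open>X\<close> into affine \<open>n\<close>-space by the surjective restriction homomorphism \<open>\<pi>\<close>.
\<close>

definition embedding :: "nat \<Rightarrow> (complex, 'r) module \<Rightarrow> (mpser \<Rightarrow> 'r) \<Rightarrow> bool" where
  "embedding n R \<pi> \<longleftrightarrow>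
     \<pi> \<in> ring_hom (conv_ring n) R \<and>
     (\<forall>c. \<forall>f\<in>carrier (conv_ring n). \<pi> (c \<odot>\<^bsub>conv_ring n\<^esub> f) = c \<odot>\<^bsub>R\<^esub> \<pi> f) \<and>
     \<pi> ` carrier (conv_ring n) = carrier R"

definition reduced_complete_intersection :: "nat \<Rightarrow> mpser list \<Rightarrow> bool" where
  "reduced_complete_intersection n hs \<longleftrightarrow>
     regular_sequence (conv_ring n) hs \<and>
     reduced_ring (conv_ring n Quot genideal (conv_ring n) (set hs))"

text \<open>
  The ideal of the closure of the difference of the zero sets of \<open>I\<close> and \<open>J\<close> in the spectrum: the
  functions vanishing at every prime that contains \<open>I\<close> but not \<open>J\<close>.
\<close>

definition difference_ideal :: "('a, 'm) ring_scheme \<Rightarrow> 'a set \<Rightarrow> 'a set \<Rightarrow> 'a set" where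
  "difference_ideal A I J =
     {f \<in> carrier A. \<forall>P. primeideal P A \<and> I \<subseteq> P \<and> \<not> J \<subseteq> P \<longrightarrow> f \<in> P}"

text \<open>
  For ideals \<open>I \<subseteq> J\<close> of \<open>A\<close>, the canonical homomorphism \<open>A/I \<rightarrow> A/J\<close> sends the coset \<open>K\<close> to
  \<open>J + K\<close>. If \<open>I\<close> and \<open>J\<close> are the ideals of \<open>C\<close> and \<open>X\<close>, then \<open>is_indicator A I J e\<close> says that
  \<open>e\<close> is the element of the total ring of fractions of \<open>A/I\<close> that corresponds to \<open>(1, 0)\<close> in
  the product of those of \<open>X\<close> and of \<open>X' = closure (C - X)\<close>.
\<close>

definition is_indicator ::
  "('a, 'm) ring_scheme \<Rightarrow> 'a set \<Rightarrow> 'a set \<Rightarrow> ('a set \<times> 'a set) set \<Rightarrow> bool" where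
  "is_indicator A I J e \<longleftrightarrow>
     (let J' = difference_ideal A I J
      in e \<in> carrier (total_frac_ring (A Quot I)) \<and>
         frac_map (A Quot I) (A Quot J) (\<lambda>K. J <+>\<^bsub>A\<^esub> K) e
           \<one>\<^bsub>total_frac_ring (A Quot J)\<^esub> \<and>
         frac_map (A Quot I) (A Quot J') (\<lambda>K. J' <+>\<^bsub>A\<^esub> K) e
           \<zero>\<^bsub>total_frac_ring (A Quot J')\<^esub>)"

text \<open>
  \<open>\<alpha>\<close> is a fundamental form of the germ with ideal \<open>J\<close> with respect to \<open>hs\<close>. Scalar extension of
  the free module of forms to the total ring of fractions acts on coefficients, so the defining
  equation is stated coefficient by coefficient.
\<close>

definition fundamental_form :: "nat \<Rightarrow> mpser list \<Rightarrow> mpser set \<Rightarrow> form \<Rightarrow> bool" where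
  "fundamental_form n hs J \<alpha> \<longleftrightarrow>
     (let A = conv_ring n;
          I = genideal A (set hs);
          Q = total_frac_ring (A Quot I);
          image = (\<lambda>f. fraction (A Quot I) (I +>\<^bsub>A\<^esub> f) \<one>\<^bsub>A Quot I\<^esub>)
      in \<alpha> \<in> carrier (Omega n (int (length hs))) \<and>
         (\<exists>e. is_indicator A I J e \<and>
              (\<forall>L. L \<subseteq> {..<n} \<and> card L = length hs \<longrightarrow>
                   image (\<alpha> L) = e \<otimes>\<^bsub>Q\<^esub> image (wedge_differentials hs L))))"

text \<open>
  All the data entering the construction of a Jacobian module of the germ with local ring \<open>R\<close>: an
  embedding \<open>\<pi>\<close> of codimension \<open>k \<ge> 2\<close>, a regular sequence \<open>hs\<close> of length \<open>k\<close> that defines a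
  reduced complete intersection containing the germ, and a fundamental form.
\<close>

definition jacobian_data ::
  "(complex, 'r) module \<Rightarrow> nat \<Rightarrow> (mpser \<Rightarrow> 'r) \<Rightarrow> mpser list \<Rightarrow> form \<Rightarrow> bool" where
  "jacobian_data R n \<pi> hs \<alpha> \<longleftrightarrow>
     embedding n R \<pi> \<and>
     2 \<le> length hs \<and>
     krull_dim R + enat (length hs) = enat n \<and>
     reduced_complete_intersection n hs \<and>
     genideal (conv_ring n) (set hs) \<subseteq> a_kernel (conv_ring n) R \<pi> \<and>
     fundamental_form n hs (a_kernel (conv_ring n) R \<pi>) \<alpha>"

definition contraction ::
  "nat \<Rightarrow> (mpser \<Rightarrow> 'r) \<Rightarrow> int \<Rightarrow> form \<Rightarrow> int \<Rightarrow> (form \<Rightarrow> mpser) \<Rightarrow> form \<Rightarrow> 'r" where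
  "contraction n \<pi> k \<alpha> q \<delta> = (\<lambda>\<omega>\<in>carrier (Omega n (q - k)). \<pi> (\<delta> (wedge \<alpha> \<omega>)))"

text \<open>
  The \<open>p\<close>-th Jacobian module, with the pointwise operations of the module of homomorphisms from
  \<open>(q - k)\<close>-forms to \<open>R\<close>, where \<open>q = n - p\<close>. The multiplicative fields of the record are junk.
\<close>

definition jacobian_module ::
  "(complex, 'r) module \<Rightarrow> nat \<Rightarrow> (mpser \<Rightarrow> 'r) \<Rightarrow> nat \<Rightarrow> form \<Rightarrow> nat \<Rightarrow>
   ('r, form \<Rightarrow> 'r) module" where
  "jacobian_module R n \<pi> k \<alpha> p =
     (let q = int n - int p;
          \<Omega> = carrier (Omega n (q - int k))
      in \<lparr>carrier = contraction n \<pi> (int k) \<alpha> q ` Theta n q,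
          monoid.mult = undefined, monoid.one = undefined,
          ring.zero = (\<lambda>\<omega>\<in>\<Omega>. \<zero>\<^bsub>R\<^esub>),
          ring.add = (\<lambda>\<phi> \<psi>. \<lambda>\<omega>\<in>\<Omega>. \<phi> \<omega> \<oplus>\<^bsub>R\<^esub> \<psi> \<omega>),
          module.smult = (\<lambda>r \<phi>. \<lambda>\<omega>\<in>\<Omega>. r \<otimes>\<^bsub>R\<^esub> \<phi> \<omega>)\<rparr>)"

end

theory Submission
  imports Defs
begin

text \<open>
  Let \<open>A\<close> be the ring of convergent power series in \<open>n\<close> variables, \<open>J\<close> the kernel of \<open>\<pi> : A \<rightarrow> R\<close>,
  \<open>I\<close> the ideal generated by \<open>hs = (h\<^sub>1, \<dots>, h\<^sub>k)\<close>, \<open>dh\<close> the wedge product of the \<open>dh\<^sub>i\<close> and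
  \<open>d = n - k\<close> the dimension of \<open>R\<close>.

  Multivector fields of degree \<open>n - p\<close> are dual to forms of that degree, so each of them is
  \<open>\<omega> \<mapsto> (\<eta> \<and> \<omega>)\<close>, read in top degree, for a \<open>p\<close>-form \<open>\<eta>\<close> (\<open>Theta_eq\<close>). Hence the Jacobian module
  consists of the maps \<open>\<omega> \<mapsto> \<eta> \<and> \<alpha> \<and> \<omega>\<close> modulo \<open>J\<close>. The indicator in the definition of a fundamental
  form is \<open>1\<close> on the germ, so \<open>\<alpha>\<close> is congruent to \<open>dh\<close> modulo \<open>J\<close> (\<open>fundamental_form_congruent\<close>), and
  the map of \<open>\<eta>\<close> vanishes iff \<open>\<eta> \<and> dh\<close> is zero modulo \<open>J\<close>. The heart of the proof is a description of
  these \<open>\<eta>\<close> that does not mention \<open>dh\<close>: they are the \<open>p\<close>-forms whose value on any \<open>p\<close> vector fields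
  tangent to the germ lies in \<open>J\<close> (\<open>contraction_kernel\<close>). In other words, the Jacobian module is the
  module of \<open>p\<close>-forms on the germ modulo torsion. Tangent vector fields induce derivations of \<open>R\<close>,
  and by Krull's intersection theorem each of these derivations is induced by a tangent vector field
  of any other presentation (\<open>tangent_transfer\<close>). Substituting lifts of the coordinates turns a form
  of one presentation into a form of the other with the same values on derivations of \<open>R\<close>
  (\<open>pull_back\<close>), and this correspondence induces the isomorphism.

  Two properties of \<open>dh\<close> give the description of the kernel. First, \<open>dg \<and> dh\<close> is zero modulo \<open>J\<close> for
  \<open>g \<in> J\<close>; so the vector fields whose coefficients are coefficients of \<open>dh\<close> are tangent, and they are
  numerous enough to detect \<open>\<eta> \<and> dh\<close>. Second, an element of \<open>A\<close> that multiplies all coefficients of \<open>dh\<close>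
  into \<open>J\<close> lies in \<open>J\<close>; so \<open>dh\<close> can be cancelled. Both are verified at each associated prime \<open>Q\<close> of \<open>R\<close>.
  Since \<open>R\<close> is Cohen--Macaulay, \<open>A/Q\<close> has dimension \<open>d\<close>, the dimension of \<open>A/I\<close>; as \<open>I\<close> is radical, \<open>I\<close>
  and \<open>Q\<close> coincide locally at \<open>Q\<close> (\<open>locally_equal\<close>), and the first property follows from the Leibniz
  rule. The second one is the Jacobian criterion: if all coefficients of \<open>dh\<close> were in \<open>Q\<close>, there would
  be \<open>d + 1\<close> vector fields tangent to \<open>Q\<close> that are independent modulo \<open>Q\<close>, which a counting
  argument excludes (\<open>tangent_dimension\<close>).

  The dimension of \<open>A/K\<close> enters as the growth of its Hilbert function. All that is needed is that a
  nonzerodivisor lowers the growth exponent, that it is a unit if this exponent is \<open>0\<close>, and Krull's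
  intersection theorem. These come from division by a standard basis of \<open>K\<close>
  (\<open>standard_basis_division\<close>), which also shows that \<open>A\<close> is Noetherian. Monomials are ordered by a
  weight that is multiplicative and injective, with the primes as weights of the variables; a power
  series then converges iff it does so as a Dirichlet series, and division converges by a geometric
  estimate.
\<close>

section \<open>Weights of monomials and convergence\<close>

definition nth_prime :: "nat \<Rightarrow> nat" where
  "nth_prime = enumerate {p. Factorial_Ring.prime p}"

lemma prime_nth_prime: "Factorial_Ring.prime (nth_prime i)"
  using enumerate_in_set[OF primes_infinite, of i] by (simp add: nth_prime_def)

lemma nth_prime_less: "i < j \<Longrightarrow> nth_prime i < nth_prime j"
  unfolding nth_prime_def by (rule enumerate_mono[OF _ primes_infinite])

lemma nth_prime_eq_iff [simp]: "nth_prime i = nth_prime j \<longleftrightarrow> i = j"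
  by (metis linorder_neqE_nat order_less_irrefl nth_prime_less)

lemma nth_prime_ge_2: "2 \<le> nth_prime i"
  using prime_nth_prime prime_ge_2_nat by blast

type_synonym exponent = "nat \<Rightarrow>\<^sub>0 nat"

abbreviation vars :: "exponent \<Rightarrow> nat set" where
  "vars \<equiv> Poly_Mapping.keys"

abbreviation expo :: "exponent \<Rightarrow> nat \<Rightarrow> nat" where
  "expo \<equiv> Poly_Mapping.lookup"

text \<open>
  Unique factorisation makes this weight injective. It is multiplicative, and only finitely many
  monomials lie below a given bound, so it orders the monomials in type \<open>\<omega>\<close>, compatibly with products.
\<close>

definition weight :: "exponent \<Rightarrow> nat" where
  "weight m = (\<Prod>i\<in>vars m. nth_prime i ^ expo m i)"

lemma weight_eq_prod:
  assumes "finite S" "vars m \<subseteq> S"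
  shows "weight m = (\<Prod>i\<in>S. nth_prime i ^ expo m i)"
  unfolding weight_def
  by (rule prod.mono_neutral_left) (use assms in \<open>auto simp: in_keys_iff\<close>)

lemma keys_add_nat: "vars (a + b :: exponent) = vars a \<union> vars b"
  by (auto simp: in_keys_iff lookup_add)

lemma weight_0 [simp]: "weight 0 = 1"
  by (simp add: weight_def)

lemma weight_add: "weight (a + b) = weight a * weight b"
proof -
  let ?S = "vars a \<union> vars b"
  have "weight (a + b) = (\<Prod>i\<in>?S. nth_prime i ^ expo (a + b) i)"
    by (rule weight_eq_prod) (auto simp: keys_add_nat)
  also have "\<dots> = (\<Prod>i\<in>?S. nth_prime i ^ expo a i) * (\<Prod>i\<in>?S. nth_prime i ^ expo b i)"
    by (simp add: lookup_add power_add prod.distrib)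
  also have "\<dots> = weight a * weight b"
    by (simp add: weight_eq_prod[of ?S a] weight_eq_prod[of ?S b])
  finally show ?thesis .
qed

lemma weight_pos [simp]: "weight m > 0"
  unfolding weight_def by (rule prod_pos) (use nth_prime_ge_2 in \<open>auto intro!: zero_less_power simp: Suc_le_eq less_le_trans[OF _ nth_prime_ge_2]\<close>)

lemma weight_neq_0 [simp]: "weight m \<noteq> 0"
  using weight_pos[of m] by linarith

lemma weight_ge_1 [simp]: "1 \<le> weight m" "Suc 0 \<le> weight m"
  using weight_pos[of m] by linarith+

lemma weight_single: "weight (Poly_Mapping.single i k) = nth_prime i ^ k"
  by (cases "k = 0") (auto simp: weight_def)

lemma multiplicity_weight: "multiplicity (nth_prime i) (weight m) = expo m i"
proof -
  let ?S = "insert i (vars m)"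
  have inj: "inj nth_prime"
    by (simp add: inj_on_def)
  have "weight m = (\<Prod>j\<in>?S. nth_prime j ^ expo m j)"
    by (rule weight_eq_prod) auto
  also have "\<dots> = (\<Prod>p\<in>nth_prime ` ?S. p ^ expo m (inv_into UNIV nth_prime p))"
    by (subst prod.reindex) (use inj in \<open>auto intro: inj_on_subset simp: inv_f_f\<close>)
  finally have eq: "weight m = (\<Prod>p\<in>nth_prime ` ?S. p ^ expo m (inv_into UNIV nth_prime p))" .
  have "multiplicity (nth_prime i) (weight m) = (if nth_prime i \<in> nth_prime ` ?S then expo m (inv_into UNIV nth_prime (nth_prime i)) else 0)"
    unfolding eq by (rule multiplicity_prod_prime_powers) (auto simp: prime_nth_prime)
  then show ?thesis using inj by (auto simp: inv_f_f)
qed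

lemma weight_inj: "weight a = weight b \<Longrightarrow> a = b"
  by (metis multiplicity_weight poly_mapping_eqI)

lemma weight_eq_iff [simp]: "weight a = weight b \<longleftrightarrow> a = b"
  using weight_inj by blast

lemma finite_weight_le: "finite {m. weight m \<le> t}"
  by (rule finite_imageD[of weight]) (auto intro: finite_subset[of _ "{..t}"] simp: inj_on_def)

lemma weight_power_deg_le: "2 ^ monom_deg m \<le> weight m"
  unfolding monom_deg_def power_sum weight_def
  by (rule prod_mono) (auto intro: power_mono nth_prime_ge_2)

lemma weight_le_power_deg:
  assumes "vars m \<subseteq> {..<n}"
  shows "weight m \<le> nth_prime n ^ monom_deg m"
  unfolding monom_deg_def power_sum weight_def
  by (rule prod_mono) (use assms in \<open>auto intro!: power_mono less_imp_le[OF nth_prime_less]\<close>)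

lemma lookup_less_weight: "expo m i < weight m"
proof -
  have "expo m i \<le> monom_deg m"
  proof (cases "i \<in> vars m")
    case True then show ?thesis unfolding monom_deg_def by (intro member_le_sum) auto
  qed (simp add: in_keys_iff)
  also have "\<dots> < 2 ^ monom_deg m" by simp
  also have "\<dots> \<le> weight m" by (rule weight_power_deg_le)
  finally show ?thesis .
qed

text \<open>
  Absolute convergence at \<open>\<rho>\<close>, with sum at most \<open>B\<close>, of the Dirichlet series with coefficients \<open>coef f m\<close>
  at the integers \<open>weight m\<close>.
\<close>

definition coef_bound :: "nat \<Rightarrow> mpser \<Rightarrow> real \<Rightarrow> bool" where
  "coef_bound \<rho> f B \<longleftrightarrow> (\<forall>S. finite S \<longrightarrow> (\<Sum>m\<in>S. norm (coef f m) / real (weight m) ^ \<rho>) \<le> B)"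

lemma coef_bound_nonneg: "coef_bound \<rho> f B \<Longrightarrow> 0 \<le> B"
  unfolding coef_bound_def by (drule spec[of _ "{}"]) simp

lemma coef_bound_mono:
  assumes "coef_bound \<rho> f B" "\<rho> \<le> \<rho>'" "B \<le> B'"
  shows "coef_bound \<rho>' f B'"
  unfolding coef_bound_def
proof (intro allI impI)
  fix S :: "exponent set" assume "finite S"
  have "(\<Sum>m\<in>S. norm (coef f m) / real (weight m) ^ \<rho>') \<le> (\<Sum>m\<in>S. norm (coef f m) / real (weight m) ^ \<rho>)"
    by (rule sum_mono, rule divide_left_mono) (use assms in \<open>auto intro!: power_increasing\<close>)
  also have "\<dots> \<le> B'" using assms \<open>finite S\<close> unfolding coef_bound_def by fastforce
  finally show "(\<Sum>m\<in>S. norm (coef f m) / real (weight m) ^ \<rho>') \<le> B'" .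
qed

lemma coef_bound_add: "coef_bound \<rho> f B \<Longrightarrow> coef_bound \<rho> g C \<Longrightarrow> coef_bound \<rho> (f + g) (B + C)"
  unfolding coef_bound_def
proof (intro allI impI)
  fix S :: "exponent set"
  assume *: "\<forall>S. finite S \<longrightarrow> (\<Sum>m\<in>S. norm (coef f m) / real (weight m) ^ \<rho>) \<le> B"
    "\<forall>S. finite S \<longrightarrow> (\<Sum>m\<in>S. norm (coef g m) / real (weight m) ^ \<rho>) \<le> C" "finite S"
  have "(\<Sum>m\<in>S. norm (coef (f + g) m) / real (weight m) ^ \<rho>)
     \<le> (\<Sum>m\<in>S. norm (coef f m) / real (weight m) ^ \<rho> + norm (coef g m) / real (weight m) ^ \<rho>)"
    by (rule sum_mono) (auto simp: plus_mpser.rep_eq norm_triangle_ineq divide_right_mono simp flip: add_divide_distrib)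
  also have "\<dots> \<le> B + C" using * by (auto simp: sum.distrib intro!: add_mono)
  finally show "(\<Sum>m\<in>S. norm (coef (f + g) m) / real (weight m) ^ \<rho>) \<le> B + C" .
qed

text \<open>
  The Cauchy product of the two families of absolute values; multiplicativity of the weight is what
  makes the bound submultiplicative.
\<close>

lemma coef_bound_mult:
  assumes f: "coef_bound \<rho> f B" and g: "coef_bound \<rho> g C"
  shows "coef_bound \<rho> (f * g) (B * C)"
  unfolding coef_bound_def
proof (intro allI impI)
  fix S :: "exponent set" assume S: "finite S"
  let ?T = "\<lambda>m. {(a, b). a + b = (m :: exponent)}"
  let ?U = "\<lambda>m a. norm (coef m a) / real (weight a) ^ \<rho>"
  let ?X = "\<Union>m\<in>S. ?T m"
  have fX: "finite ?X" using S finite_monom_splittings by blast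
  have "(\<Sum>m\<in>S. norm (coef (f * g) m) / real (weight m) ^ \<rho>) \<le> (\<Sum>m\<in>S. \<Sum>(a, b)\<in>?T m. ?U f a * ?U g b)"
  proof (rule sum_mono)
    fix m
    have "norm (coef (f * g) m) \<le> (\<Sum>(a, b)\<in>?T m. norm (coef f a) * norm (coef g b))"
      unfolding times_mpser.rep_eq by (rule order_trans[OF norm_sum]) (auto simp: norm_mult case_prod_beta)
    then have "norm (coef (f * g) m) / real (weight m) ^ \<rho> \<le> (\<Sum>(a, b)\<in>?T m. norm (coef f a) * norm (coef g b)) / real (weight m) ^ \<rho>"
      by (rule divide_right_mono) simp
    also have "\<dots> = (\<Sum>(a, b)\<in>?T m. ?U f a * ?U g b)"
      unfolding sum_divide_distrib by (rule sum.cong) (auto simp: weight_add power_mult_distrib)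
    finally show "norm (coef (f * g) m) / real (weight m) ^ \<rho> \<le> (\<Sum>(a, b)\<in>?T m. ?U f a * ?U g b)" .
  qed
  also have "\<dots> = (\<Sum>(a, b)\<in>?X. ?U f a * ?U g b)"
    by (rule sum.UNION_disjoint[symmetric]) (use S finite_monom_splittings in auto)
  also have "\<dots> \<le> (\<Sum>(a, b)\<in>fst ` ?X \<times> snd ` ?X. ?U f a * ?U g b)"
    by (rule sum_mono2) (use fX in \<open>force+\<close>)
  also have "\<dots> = (\<Sum>a\<in>fst ` ?X. ?U f a) * (\<Sum>b\<in>snd ` ?X. ?U g b)"
    by (simp add: sum_product sum.cartesian_product)
  also have "\<dots> \<le> B * C"
    by (rule mult_mono) (use f g fX coef_bound_nonneg in \<open>auto simp: coef_bound_def intro!: sum_nonneg\<close>)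
  finally show "(\<Sum>m\<in>S. norm (coef (f * g) m) / real (weight m) ^ \<rho>) \<le> B * C" .
qed

abbreviation cps :: "nat \<Rightarrow> mpser set" where
  "cps n \<equiv> carrier (conv_ring n)"

lemma convergent_of_coef_bound:
  assumes f: "coef_bound \<rho> f B" and k: "\<And>m. coef f m \<noteq> 0 \<Longrightarrow> vars m \<subseteq> {..<n}"
  shows "convergent_mpser f"
  unfolding convergent_mpser_def
proof (intro exI conjI)
  let ?r = "1 / real (nth_prime n) ^ \<rho>"
  have pn: "nth_prime n > 0" using nth_prime_ge_2[of n] by linarith
  then show "?r > 0" by simp
  have le: "norm (coef f m) * ?r ^ monom_deg m \<le> norm (coef f m) / real (weight m) ^ \<rho>" for m
  proof (cases "coef f m = 0")
    case False
    have "real (weight m) ^ \<rho> \<le> (real (nth_prime n) ^ monom_deg m) ^ \<rho>"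
      using weight_le_power_deg[OF k[OF False]] by (intro power_mono) (metis of_nat_le_iff of_nat_power, simp)
    also have "\<dots> = (real (nth_prime n) ^ \<rho>) ^ monom_deg m"
      by (metis mult.commute power_mult)
    finally show ?thesis
      by (simp add: power_divide divide_simps) (use pn in \<open>auto simp: divide_simps intro!: mult_left_mono\<close>)
  qed simp
  show "(\<lambda>m. norm (coef f m) * ?r ^ monom_deg m) summable_on UNIV"
  proof (rule nonneg_bdd_above_summable_on)
    show "bdd_above (sum (\<lambda>m. norm (coef f m) * ?r ^ monom_deg m) ` {F. F \<subseteq> UNIV \<and> finite F})"
      by (rule bdd_aboveI2[of _ _ B], rule order_trans[OF sum_mono[OF le]]) (use f in \<open>auto simp: coef_bound_def\<close>)
  qed simp
qed

lemma coef_bound_of_convergent: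
  assumes "convergent_mpser f"
  obtains \<rho> B where "coef_bound \<rho> f B"
proof -
  obtain r where r: "r > 0" "(\<lambda>m. norm (coef f m) * r ^ monom_deg m) summable_on UNIV"
    using assms by (auto simp: convergent_mpser_def)
  obtain \<rho> where \<rho>: "(1 / 2 :: real) ^ \<rho> < r"
    using real_arch_pow_inv[of r "1/2"] r by auto
  have "coef_bound \<rho> f (\<Sum>\<^sub>\<infinity>m. norm (coef f m) * r ^ monom_deg m)"
    unfolding coef_bound_def
  proof (intro allI impI)
    fix S :: "exponent set" assume S: "finite S"
    have "(\<Sum>m\<in>S. norm (coef f m) / real (weight m) ^ \<rho>) \<le> (\<Sum>m\<in>S. norm (coef f m) * r ^ monom_deg m)"
    proof (rule sum_mono)
      fix m
      have "(2 :: real) ^ monom_deg m \<le> real (weight m)"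
        using weight_power_deg_le[of m] by (metis of_nat_le_iff of_nat_power of_nat_numeral)
      then have "(1 / real (weight m)) ^ \<rho> \<le> (1 / 2 ^ monom_deg m) ^ \<rho>"
        by (intro power_mono divide_left_mono) auto
      also have "\<dots> = ((1/2) ^ \<rho>) ^ monom_deg m"
        by (metis mult.commute power_mult power_one_over)
      also have "\<dots> \<le> r ^ monom_deg m" by (rule power_mono) (use \<rho> in auto)
      finally have "norm (coef f m) * (1 / real (weight m)) ^ \<rho> \<le> norm (coef f m) * r ^ monom_deg m"
        by (rule mult_left_mono) simp
      then show "norm (coef f m) / real (weight m) ^ \<rho> \<le> norm (coef f m) * r ^ monom_deg m"
        by (simp add: power_one_over divide_simps)
    qed
    also have "\<dots> \<le> (\<Sum>\<^sub>\<infinity>m. norm (coef f m) * r ^ monom_deg m)"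
      by (rule finite_sum_le_infsum) (use r S in auto)
    finally show "(\<Sum>m\<in>S. norm (coef f m) / real (weight m) ^ \<rho>) \<le> \<dots>" .
  qed
  then show thesis by (rule that)
qed

text \<open>
  In \<open>n\<close> variables the weight lies between \<open>2\<close> and a fixed prime, each raised to the degree, so
  convergence on a polydisc and convergence as a Dirichlet series are the same.
\<close>

lemma cps_iff: "f \<in> cps n \<longleftrightarrow> (\<forall>m. coef f m \<noteq> 0 \<longrightarrow> vars m \<subseteq> {..<n}) \<and> (\<exists>\<rho> B. coef_bound \<rho> f B)"
  unfolding conv_ring_def by (auto intro: convergent_of_coef_bound) (metis coef_bound_of_convergent)

lemma cps_keys: "f \<in> cps n \<Longrightarrow> coef f m \<noteq> 0 \<Longrightarrow> vars m \<subseteq> {..<n}"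
  by (simp add: cps_iff)

lemma cps_0 [simp]: "0 \<in> cps n"
  by (auto simp: cps_iff zero_mpser.rep_eq coef_bound_def)

lemma cps_1 [simp]: "1 \<in> cps n"
proof -
  have "coef_bound 0 1 1" by (auto simp: coef_bound_def one_mpser.rep_eq sum.If_cases if_distrib[of norm] cong: if_cong)
  then show ?thesis by (auto simp: cps_iff one_mpser.rep_eq split: if_splits)
qed

lemma cps_add [simp]: assumes "f \<in> cps n" "g \<in> cps n" shows "f + g \<in> cps n"
proof -
  obtain \<rho> B \<rho>' B' where "coef_bound \<rho> f B" "coef_bound \<rho>' g B'" using assms by (auto simp: cps_iff)
  then have "coef_bound (max \<rho> \<rho>') f B" "coef_bound (max \<rho> \<rho>') g B'" by (auto intro: coef_bound_mono)
  then have "coef_bound (max \<rho> \<rho>') (f + g) (B + B')" by (rule coef_bound_add)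
  moreover have "vars m \<subseteq> {..<n}" if "coef (f + g) m \<noteq> 0" for m
    using that assms unfolding cps_iff plus_mpser.rep_eq by (cases "coef f m = 0") auto
  ultimately show ?thesis unfolding cps_iff by blast
qed

lemma cps_mult [simp]: assumes "f \<in> cps n" "g \<in> cps n" shows "f * g \<in> cps n"
proof -
  obtain \<rho> B \<rho>' B' where "coef_bound \<rho> f B" "coef_bound \<rho>' g B'" using assms by (auto simp: cps_iff)
  then have "coef_bound (max \<rho> \<rho>') f B" "coef_bound (max \<rho> \<rho>') g B'" by (auto intro: coef_bound_mono)
  then have "coef_bound (max \<rho> \<rho>') (f * g) (B * B')" by (rule coef_bound_mult)
  moreover have "vars m \<subseteq> {..<n}" if "coef (f * g) m \<noteq> 0" for m
  proof -
    have "\<exists>(a, b)\<in>{(a, b). a + b = m}. coef f a * coef g b \<noteq> 0"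
      using that unfolding times_mpser.rep_eq by (force intro: sum.neutral)
    then obtain a b where "a + b = m" "coef f a \<noteq> 0" "coef g b \<noteq> 0" by auto
    with assms show ?thesis unfolding cps_iff keys_add_nat by (metis Un_least keys_add_nat)
  qed
  ultimately show ?thesis unfolding cps_iff by blast
qed

lemma coef_scale [simp]: "coef (scale_mpser c f) m = c * coef f m"
  by (simp add: scale_mpser.rep_eq)

lemma coef_bound_scale: "coef_bound \<rho> f B \<Longrightarrow> coef_bound \<rho> (scale_mpser c f) (norm c * B)"
  unfolding coef_bound_def by (auto simp: norm_mult simp flip: sum_distrib_left times_divide_eq_right intro!: mult_left_mono)

lemma cps_scale [simp]: "f \<in> cps n \<Longrightarrow> scale_mpser c f \<in> cps n"
  unfolding cps_iff by (auto intro: coef_bound_scale)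

lemma uminus_eq_scale: "- f = scale_mpser (- 1) f"
  by (rule mpser_eqI) (simp add: uminus_mpser.rep_eq)

lemma cps_uminus [simp]: "f \<in> cps n \<Longrightarrow> - f \<in> cps n"
  by (simp add: uminus_eq_scale)

lemma cps_minus [simp]: "f \<in> cps n \<Longrightarrow> g \<in> cps n \<Longrightarrow> f - g \<in> cps n"
  by (metis cps_add cps_uminus diff_conv_add_uminus)

lemma cps_sum: "(\<And>i. i \<in> S \<Longrightarrow> f i \<in> cps n) \<Longrightarrow> sum f S \<in> cps n"
  by (induction S rule: infinite_finite_induct) auto

lemma cps_power [simp]: "f \<in> cps n \<Longrightarrow> f ^ k \<in> cps n"
  by (induction k) auto

lemma coef_sum: "coef (sum f S) m = (\<Sum>i\<in>S. coef (f i) m)"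
  by (induction S rule: infinite_finite_induct) (auto simp: zero_mpser.rep_eq plus_mpser.rep_eq)

lemmas coef_simps = zero_mpser.rep_eq plus_mpser.rep_eq minus_mpser.rep_eq uminus_mpser.rep_eq one_mpser.rep_eq

definition monomial :: "exponent \<Rightarrow> mpser" where
  "monomial a = Mpser (\<lambda>m. if m = a then 1 else 0)"

lemma coef_Mpser [simp]: "coef (Mpser f) = f"
  by (simp add: Mpser_inverse)

lemma coef_monomial: "coef (monomial a) m = (if m = a then 1 else 0)"
  by (simp add: monomial_def)

lemma monomial_0 [simp]: "monomial 0 = 1"
  by (rule mpser_eqI) (simp add: coef_monomial one_mpser.rep_eq)

lemma coef_mult_monomial: "coef (monomial a * f) (a + m) = coef f m"
proof -
  have "coef (monomial a * f) (a + m) = (\<Sum>(b, c)\<in>{(a, m)}. coef (monomial a) b * coef f c)"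
    unfolding times_mpser.rep_eq
    by (rule sum.mono_neutral_right) (auto simp: coef_monomial finite_monom_splittings split: if_splits)
  then show ?thesis by (simp add: coef_monomial)
qed

lemma coef_mult_monomial_0:
  assumes "\<And>b. m \<noteq> a + b" shows "coef (monomial a * f) m = 0"
  unfolding times_mpser.rep_eq by (rule sum.neutral) (use assms in \<open>auto simp: coef_monomial\<close>)

lemma cps_monomial [simp]: "vars a \<subseteq> {..<n} \<Longrightarrow> monomial a \<in> cps n"
proof -
  assume "vars a \<subseteq> {..<n}"
  moreover have "coef_bound 0 (monomial a) 1" by (auto simp: coef_bound_def coef_monomial if_distrib[of norm] cong: if_cong)
  ultimately show ?thesis unfolding cps_iff by (auto simp: coef_monomial split: if_splits)
qed

definition coord :: "nat \<Rightarrow> mpser" where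
  "coord i = monomial (Poly_Mapping.single i 1)"

lemma cps_coord [simp]: "i < n \<Longrightarrow> coord i \<in> cps n"
  unfolding coord_def by (rule cps_monomial) simp

lemma double_eq_0: "(f :: mpser) + f = 0 \<Longrightarrow> f = 0"

proof (rule mpser_eqI)
  fix m assume "f + f = 0"
  then have "coef f m + coef f m = 0" by (metis plus_mpser.rep_eq zero_mpser.rep_eq)
  then show "coef f m = coef 0 m" by (simp add: coef_simps)
qed

lemma coef_pd: "coef (pd i f) m = of_nat (expo m i + 1) * coef f (m + Poly_Mapping.single i 1)"
  by (simp add: pd.rep_eq)

lemma pd_add: "pd i (f + g) = pd i f + pd i g"
  by (rule mpser_eqI) (simp add: coef_pd coef_simps algebra_simps)

lemma pd_scale: "pd i (scale_mpser c f) = scale_mpser c (pd i f)"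
  by (rule mpser_eqI) (simp add: coef_pd coef_simps algebra_simps)

lemma pd_0 [simp]: "pd i 0 = 0"
  by (rule mpser_eqI) (simp add: coef_pd coef_simps)

lemma pd_mult: "pd i (f * g) = pd i f * g + f * pd i g"
proof (rule mpser_eqI)
  fix m
  let ?e = "Poly_Mapping.single i (1 :: nat)"
  let ?T = "\<lambda>m. {(a, b). a + b = (m :: exponent)}"
  let ?l = "\<lambda>a. of_nat (expo a i) :: complex"
  have ex: "\<exists>c. a = c + ?e" if "expo a i \<noteq> 0" for a
  proof
    show "a = (a - ?e) + ?e"
      by (rule poly_mapping_eqI) (use that in \<open>auto simp: lookup_add lookup_minus lookup_single when_def\<close>)
  qed
  have gen: "(\<Sum>(a, b)\<in>?T (m + ?e). ?l a * (u a * v b)) = (\<Sum>(a, b)\<in>?T m. of_nat (expo a i + 1) * u (a + ?e) * v b)"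
    for u v :: "exponent \<Rightarrow> complex"
  proof -
    have "(\<Sum>(a, b)\<in>?T (m + ?e). ?l a * (u a * v b)) = (\<Sum>(a, b)\<in>(\<lambda>(a, b). (a + ?e, b)) ` ?T m. ?l a * (u a * v b))"
    proof (rule sum.mono_neutral_right)
      show "\<forall>x\<in>?T (m + ?e) - (\<lambda>(a, b). (a + ?e, b)) ` ?T m. (case x of (a, b) \<Rightarrow> ?l a * (u a * v b)) = 0"
      proof
        fix x assume x: "x \<in> ?T (m + ?e) - (\<lambda>(a, b). (a + ?e, b)) ` ?T m"
        obtain a b where ab: "x = (a, b)" by force
        have *: "a + b = m + ?e" "\<forall>x. x + b = m \<longrightarrow> a \<noteq> x + ?e" using x ab by (auto simp: image_iff)
        have "expo a i = 0"
        proof (rule ccontr)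
          assume "expo a i \<noteq> 0"
          then obtain c where c: "a = c + ?e" using ex by blast
          then have "c + b = m" using *(1) by (metis add.assoc add.commute add_right_cancel)
          then show False using *(2) c by auto
        qed
        then show "(case x of (a, b) \<Rightarrow> ?l a * (u a * v b)) = 0" by (simp add: ab)
      qed
    qed (auto simp: finite_monom_splittings add_ac)
    also have "\<dots> = (\<Sum>(a, b)\<in>?T m. of_nat (expo a i + 1) * u (a + ?e) * v b)"
      by (subst sum.reindex) (auto simp: inj_on_def lookup_add case_prod_beta mult.assoc)
    finally show ?thesis .
  qed
  have "coef (pd i (f * g)) m = (\<Sum>(a, b)\<in>?T (m + ?e). ?l (m + ?e) * (coef f a * coef g b))"
    by (simp add: coef_pd times_mpser.rep_eq sum_distrib_left case_prod_beta lookup_add)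
  also have "\<dots> = (\<Sum>(a, b)\<in>?T (m + ?e). ?l (a + b) * (coef f a * coef g b))"
    by (rule sum.cong) auto
  also have "\<dots> = (\<Sum>(a, b)\<in>?T (m + ?e). ?l a * (coef f a * coef g b) + ?l b * (coef f a * coef g b))"
    by (rule sum.cong) (auto simp: algebra_simps lookup_add)
  also have "\<dots> = (\<Sum>(a, b)\<in>?T (m + ?e). ?l a * (coef f a * coef g b)) + (\<Sum>(a, b)\<in>?T (m + ?e). ?l b * (coef g b * coef f a))"
    by (simp add: sum.distrib case_prod_beta mult_ac)
  also have "(\<Sum>(a, b)\<in>?T (m + ?e). ?l b * (coef g b * coef f a)) = (\<Sum>(a, b)\<in>?T (m + ?e). ?l a * (coef g a * coef f b))"
    by (rule sum.reindex_bij_witness[where i = prod.swap and j = prod.swap]) (auto simp: add.commute)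
  also have "(\<Sum>(a, b)\<in>?T (m + ?e). ?l a * (coef f a * coef g b)) = coef (pd i f * g) m"
    unfolding gen by (simp add: times_mpser.rep_eq coef_pd)
  also have "(\<Sum>(a, b)\<in>?T (m + ?e). ?l a * (coef g a * coef f b)) = coef (pd i g * f) m"
    unfolding gen by (simp add: times_mpser.rep_eq coef_pd)
  finally show "coef (pd i (f * g)) m = coef (pd i f * g + f * pd i g) m"
    by (simp add: coef_simps mult.commute)
qed

lemma cps_pd [simp]: assumes "f \<in> cps n" shows "pd i f \<in> cps n"
proof -
  let ?e = "Poly_Mapping.single i (1 :: nat)"
  obtain \<rho> B where B: "coef_bound \<rho> f B" using assms by (auto simp: cps_iff)
  have "coef_bound (Suc \<rho>) (pd i f) (real (nth_prime i) ^ Suc \<rho> * B)"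
    unfolding coef_bound_def
  proof (intro allI impI)
    fix S :: "exponent set" assume S: "finite S"
    have "(\<Sum>m\<in>S. norm (coef (pd i f) m) / real (weight m) ^ Suc \<rho>) \<le>
       (\<Sum>m\<in>S. real (nth_prime i) ^ Suc \<rho> * (norm (coef f (m + ?e)) / real (weight (m + ?e)) ^ \<rho>))"
    proof (rule sum_mono)
      fix m
      have "real (expo m i + 1) \<le> real (weight (m + ?e))"
        using lookup_less_weight[of "m + ?e" i] by (simp add: lookup_add)
      then have "real (expo m i + 1) * norm (coef f (m + ?e)) / real (weight m) ^ Suc \<rho>
        \<le> real (weight (m + ?e)) * norm (coef f (m + ?e)) / real (weight m) ^ Suc \<rho>"
        by (intro divide_right_mono mult_right_mono) auto
      also have "\<dots> = real (nth_prime i) ^ Suc \<rho> * (norm (coef f (m + ?e)) / real (weight (m + ?e)) ^ \<rho>)"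
        using nth_prime_ge_2[of i] less_imp_neq[OF weight_pos[of m]] by (simp add: weight_add weight_single divide_simps power_mult_distrib)
      finally show "norm (coef (pd i f) m) / real (weight m) ^ Suc \<rho> \<le> real (nth_prime i) ^ Suc \<rho> * (norm (coef f (m + ?e)) / real (weight (m + ?e)) ^ \<rho>)"
        unfolding coef_pd norm_mult norm_of_nat .
    qed
    also have "\<dots> = real (nth_prime i) ^ Suc \<rho> * (\<Sum>m\<in>(\<lambda>m. m + ?e) ` S. norm (coef f m) / real (weight m) ^ \<rho>)"
      by (subst sum.reindex) (auto simp: sum_distrib_left)
    also have "\<dots> \<le> real (nth_prime i) ^ Suc \<rho> * B"
      by (rule mult_left_mono) (use B S in \<open>auto simp: coef_bound_def\<close>)
    finally show "(\<Sum>m\<in>S. norm (coef (pd i f) m) / real (weight m) ^ Suc \<rho>) \<le> real (nth_prime i) ^ Suc \<rho> * B" .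
  qed
  moreover have "vars m \<subseteq> {..<n}" if "coef (pd i f) m \<noteq> 0" for m
    using that cps_keys[OF assms, of "m + ?e"] by (auto simp: coef_pd keys_add_nat)
  ultimately show ?thesis unfolding cps_iff by blast
qed

lemma pd_coord: "pd i (coord j) = (if i = j then 1 else 0)"
proof (rule mpser_eqI)
  fix m
  have "m + Poly_Mapping.single i (1 :: nat) = Poly_Mapping.single j 1 \<longleftrightarrow> i = j \<and> m = 0"
  proof
    assume *: "m + Poly_Mapping.single i (1 :: nat) = Poly_Mapping.single j 1"
    have "expo (m + Poly_Mapping.single i 1) i = expo (Poly_Mapping.single j (1::nat)) i"
      using * by simp
    then have "i = j" by (simp add: lookup_add lookup_single when_def split: if_splits)
    then show "i = j \<and> m = 0" using * by simp
  qed auto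
  then show "coef (pd i (coord j)) m = coef (if i = j then 1 else 0) m"
    by (auto simp: coef_pd coord_def coef_monomial coef_simps)
qed

section \<open>Division with remainder and standard bases\<close>

lemma weight_le_add: "weight a \<le> weight (a + b)" "weight b \<le> weight (a + b)"
  by (auto simp: weight_add)

definition lweight :: "exponent \<Rightarrow> real" where
  "lweight m = ln (real (weight m))"

lemma lweight_add: "lweight (a + b) = lweight a + lweight b"
  by (simp add: lweight_def weight_add ln_mult)

lemma lweight_0 [simp]: "lweight 0 = 0"
  by (simp add: lweight_def)

lemma lweight_nonneg [simp]: "0 \<le> lweight m"
  by (simp add: lweight_def)

lemma lweight_le_iff: "lweight a \<le> lweight b \<longleftrightarrow> weight a \<le> weight b"
  by (simp add: lweight_def)

text \<open>
  The series with this property form the filtration \<open>F\<^sub>t\<close>, which takes the place of the powers of the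
  maximal ideal.
\<close>

definition ord_ge :: "mpser \<Rightarrow> real \<Rightarrow> bool" where
  "ord_ge f t \<longleftrightarrow> (\<forall>m. coef f m \<noteq> 0 \<longrightarrow> t \<le> lweight m)"

lemma ord_ge_0 [simp]: "ord_ge 0 t"
  by (simp add: ord_ge_def coef_simps)

lemma ord_ge_add: "ord_ge f t \<Longrightarrow> ord_ge g t \<Longrightarrow> ord_ge (f + g) t"
  unfolding ord_ge_def
proof (intro allI impI)
  fix m assume *: "\<forall>m. coef f m \<noteq> 0 \<longrightarrow> t \<le> lweight m" "\<forall>m. coef g m \<noteq> 0 \<longrightarrow> t \<le> lweight m" "coef (f + g) m \<noteq> 0"
  show "t \<le> lweight m" using * by (cases "coef f m = 0") (auto simp: coef_simps)
qed

lemma ord_ge_mono: "ord_ge f t \<Longrightarrow> t' \<le> t \<Longrightarrow> ord_ge f t'"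
  unfolding ord_ge_def by (meson order_trans)

lemma ord_ge_sum: "(\<And>i. i \<in> S \<Longrightarrow> ord_ge (f i) t) \<Longrightarrow> ord_ge (sum f S) t"
  by (induction S rule: infinite_finite_induct) (auto intro: ord_ge_add)

lemma coef_mult_nonzeroE:
  assumes "coef (f * g) m \<noteq> 0"
  obtains a b where "m = a + b" "coef f a \<noteq> 0" "coef g b \<noteq> 0"
proof -
  have "\<exists>(a, b)\<in>{(a, b). a + b = m}. coef f a * coef g b \<noteq> 0"
    using assms unfolding times_mpser.rep_eq by (force intro: sum.neutral)
  then show ?thesis using that by auto
qed

lemma ord_ge_mult: "ord_ge f s \<Longrightarrow> ord_ge g t \<Longrightarrow> ord_ge (f * g) (s + t)"
  unfolding ord_ge_def
proof (intro allI impI)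
  fix m assume *: "\<forall>m. coef f m \<noteq> 0 \<longrightarrow> s \<le> lweight m" "\<forall>m. coef g m \<noteq> 0 \<longrightarrow> t \<le> lweight m" "coef (f * g) m \<noteq> 0"
  obtain a b where "m = a + b" "coef f a \<noteq> 0" "coef g b \<noteq> 0" using *(3) by (rule coef_mult_nonzeroE)
  then show "s + t \<le> lweight m" using *(1,2) by (auto simp: lweight_add intro: add_mono)
qed

lemma ord_ge_zero [simp]: "ord_ge f 0"
  by (simp add: ord_ge_def)

lemma ord_ge_mult1: "ord_ge g t \<Longrightarrow> ord_ge (f * g) t"
  using ord_ge_mult[of f 0 g t] by simp

lemma ord_ge_power: "ord_ge f t \<Longrightarrow> ord_ge (f ^ k) (real k * t)"
proof (induction k)
  case (Suc k)
  then have "ord_ge (f * f ^ k) (t + real k * t)" by (intro ord_ge_mult)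
  then show ?case by (simp add: algebra_simps)
qed simp

lemma ord_ge_1: "ord_ge 1 t \<Longrightarrow> t \<le> 0"
  unfolding ord_ge_def by (drule spec[of _ 0]) (simp add: coef_simps)

lemma ord_ge_pd: assumes "ord_ge f t" shows "ord_ge (pd i f) (t - ln (real (nth_prime i)))"
  unfolding ord_ge_def
proof (intro allI impI)
  fix m assume "coef (pd i f) m \<noteq> 0"
  then have "coef f (m + Poly_Mapping.single i 1) \<noteq> 0" by (auto simp: coef_pd)
  then have "t \<le> lweight m + lweight (Poly_Mapping.single i 1)" using assms by (auto simp: ord_ge_def lweight_add)
  then show "t - ln (real (nth_prime i)) \<le> lweight m" by (simp add: lweight_def[of "Poly_Mapping.single i (Suc 0)"] weight_single)
qed

text \<open>
  Ideals of \<open>conv_ring n\<close> as subsets of the type \<open>mpser\<close>, so that the arithmetic is that of a commutative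
  ring type.
\<close>

definition idl :: "nat \<Rightarrow> mpser set \<Rightarrow> bool" where
  "idl n K \<longleftrightarrow> K \<subseteq> cps n \<and> 0 \<in> K \<and> (\<forall>a\<in>K. \<forall>b\<in>K. a + b \<in> K) \<and> (\<forall>a\<in>cps n. \<forall>b\<in>K. a * b \<in> K)"

lemma idlD:
  assumes "idl n K"
  shows idl_sub: "a \<in> K \<Longrightarrow> a \<in> cps n" and idl_0: "0 \<in> K"
    and idl_add: "a \<in> K \<Longrightarrow> b \<in> K \<Longrightarrow> a + b \<in> K"
    and idl_mult: "a \<in> cps n \<Longrightarrow> b \<in> K \<Longrightarrow> a * b \<in> K"
    and idl_mult2: "a \<in> cps n \<Longrightarrow> b \<in> K \<Longrightarrow> b * a \<in> K"
  using assms by (auto simp: idl_def mult.commute)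

lemma idl_uminus: "idl n K \<Longrightarrow> a \<in> K \<Longrightarrow> - a \<in> K"
  using idl_mult[of n K "- 1" a] by simp

lemma idl_minus: "idl n K \<Longrightarrow> a \<in> K \<Longrightarrow> b \<in> K \<Longrightarrow> a - b \<in> K"
  by (metis idl_add idl_uminus diff_conv_add_uminus)

lemma idl_sum: "idl n K \<Longrightarrow> (\<And>i. i \<in> S \<Longrightarrow> f i \<in> K) \<Longrightarrow> sum f S \<in> K"
  by (induction S rule: infinite_finite_induct) (auto intro: idl_add idl_0)

lemma scale_eq_mult: "scale_mpser c f = scale_mpser c 1 * f"
proof (rule mpser_eqI)
  fix m
  have "scale_mpser c 1 * f = (\<Sum>(i::nat)\<in>{0}. scale_mpser c 1 * f)" by simp
  have "coef (scale_mpser c 1 * f) m = (\<Sum>(a, b)\<in>{(0, m)}. coef (scale_mpser c 1) a * coef f b)"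
    unfolding times_mpser.rep_eq
    by (rule sum.mono_neutral_right) (auto simp: coef_simps finite_monom_splittings split: if_splits)
  then show "coef (scale_mpser c f) m = coef (scale_mpser c 1 * f) m" by (simp add: coef_simps)
qed

lemma idl_scale: "idl n K \<Longrightarrow> a \<in> K \<Longrightarrow> scale_mpser c a \<in> K"
  by (subst scale_eq_mult) (auto intro: idl_mult)

definition is_lead :: "mpser \<Rightarrow> exponent \<Rightarrow> bool" where
  "is_lead f m \<longleftrightarrow> coef f m \<noteq> 0 \<and> (\<forall>m'. coef f m' \<noteq> 0 \<longrightarrow> weight m \<le> weight m')"

definition leads :: "mpser set \<Rightarrow> exponent set" where
  "leads K = {m. \<exists>f\<in>K. is_lead f m}"

lemma ex_lead: assumes "f \<noteq> 0" obtains m where "is_lead f m"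
proof -
  have "\<exists>m. coef f m \<noteq> 0" using assms mpser_eqI[of f 0] by (auto simp: coef_simps)
  then obtain m where "coef f m \<noteq> 0" "\<forall>m'. coef f m' \<noteq> 0 \<longrightarrow> weight m \<le> weight m'"
    using ex_has_least_nat[of "\<lambda>m. coef f m \<noteq> 0" _ weight] by blast
  then show thesis using that by (auto simp: is_lead_def)
qed

lemma leads_mono: "K \<subseteq> L \<Longrightarrow> leads K \<subseteq> leads L"
  by (auto simp: leads_def)

lemma leads_keys: "idl n K \<Longrightarrow> m \<in> leads K \<Longrightarrow> vars m \<subseteq> {..<n}"
  unfolding leads_def is_lead_def using cps_keys idl_sub by blast

lemma is_lead_monomial_mult: assumes "is_lead f m" shows "is_lead (monomial b * f) (b + m)"
  unfolding is_lead_def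
proof (intro conjI allI impI)
  show "coef (monomial b * f) (b + m) \<noteq> 0" using assms by (simp add: coef_mult_monomial is_lead_def)
  fix m' assume "coef (monomial b * f) m' \<noteq> 0"
  then obtain c where c: "m' = b + c" "coef f c \<noteq> 0"
    by (metis coef_mult_monomial coef_mult_monomial_0)
  then show "weight (b + m) \<le> weight m'" using assms by (simp add: weight_add is_lead_def)
qed

lemma leads_add: "idl n K \<Longrightarrow> m \<in> leads K \<Longrightarrow> vars b \<subseteq> {..<n} \<Longrightarrow> m + b \<in> leads K"
  unfolding leads_def using is_lead_monomial_mult[of _ m b] by (auto simp: add.commute intro!: bexI[of _ "monomial b * _"] idl_mult)

lemma eq_0_if_off_leads:
  assumes "f \<in> K" "\<And>m. m \<in> leads K \<Longrightarrow> coef f m = 0"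
  shows "f = 0"
proof (rule ccontr)
  assume "f \<noteq> 0"
  then obtain m where "is_lead f m" by (rule ex_lead)
  then show False using assms unfolding leads_def is_lead_def by blast
qed

lemma subseq_incseq_nat:
  fixes s :: "nat \<Rightarrow> nat"
  shows "\<exists>r :: nat \<Rightarrow> nat. strict_mono r \<and> incseq (s \<circ> r)"
proof -
  obtain f where f: "strict_mono f" "monoseq (\<lambda>n. s (f n))" using seq_monosub by blast
  show ?thesis
  proof (cases "incseq (\<lambda>n. s (f n))")
    case True then show ?thesis using f by (auto simp: comp_def)
  next
    case False
    then have dec: "decseq (\<lambda>n. s (f n))" using f(2) by (auto simp: monoseq_iff)
    obtain N where N: "\<And>n. s (f N) \<le> s (f n)"
      using ex_has_least_nat[of "\<lambda>_. True" 0 "\<lambda>n. s (f n)"] by auto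
    have "s (f (N + n)) = s (f N)" for n
      using N[of "N + n"] dec by (auto simp: decseq_def intro: antisym)
    then have "incseq (s \<circ> (\<lambda>n. f (N + n)))" by (simp add: incseq_def)
    moreover have "strict_mono (\<lambda>n. f (N + n))" using f(1) by (simp add: strict_mono_def)
    ultimately show ?thesis by blast
  qed
qed

lemma subseq_incseq_coords:
  fixes s :: "nat \<Rightarrow> exponent"
  shows "\<exists>r :: nat \<Rightarrow> nat. strict_mono r \<and> (\<forall>k<n. incseq (\<lambda>i. expo (s (r i)) k))"
proof (induction n)
  case 0
  show ?case by (rule exI[of _ id]) (auto simp: strict_mono_def)
next
  case (Suc n)
  then obtain r where r: "strict_mono r" "\<And>k. k < n \<Longrightarrow> incseq (\<lambda>i. expo (s (r i)) k)" by blast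
  obtain r' where r': "strict_mono r'" "incseq ((\<lambda>i. expo (s (r i)) n) \<circ> r')"
    using subseq_incseq_nat by blast
  have "incseq (\<lambda>i. expo (s (r (r' i))) k)" if "k < Suc n" for k
    using r(2)[of k] r' that by (cases "k = n") (auto simp: incseq_def comp_def strict_mono_less_eq)
  then show ?case using r(1) r'(1) by (intro exI[of _ "r \<circ> r'"]) (auto simp: strict_mono_def)
qed

text \<open>
  The minimal elements for divisibility do it: an infinite sequence of distinct ones would have a
  subsequence that is nondecreasing in each coordinate, and so two comparable members.
\<close>

lemma dickson:
  assumes "\<And>m. m \<in> S \<Longrightarrow> vars m \<subseteq> {..<n}"
  obtains F where "finite F" "F \<subseteq> S" "\<And>m. m \<in> S \<Longrightarrow> \<exists>a\<in>F. \<exists>b. m = a + (b :: exponent)"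
proof
  define F where "F = {a \<in> S. \<forall>a'\<in>S. \<forall>b. a = a' + b \<longrightarrow> a' = a}"
  show "F \<subseteq> S" by (auto simp: F_def)
  show "\<exists>a\<in>F. \<exists>b. m = a + b" if "m \<in> S" for m
    using that
  proof (induction "weight m" arbitrary: m rule: less_induct)
    case less
    show ?case
    proof (cases "m \<in> F")
      case True then show ?thesis by (intro bexI[of _ m] exI[of _ 0]) auto
    next
      case False
      then obtain a b where ab: "a \<in> S" "m = a + b" "a \<noteq> m" using less.prems by (auto simp: F_def)
      then have "b \<noteq> 0" by auto
      then have "weight b \<noteq> 1" using weight_eq_iff[of b 0] by (simp del: weight_eq_iff)
      then have "1 < weight b" using weight_pos[of b] by linarith
      then have "weight a < weight m" using ab(2) by (simp add: weight_add)
      then obtain a' b' where "a' \<in> F" "a = a' + b'" using less.hyps ab by blast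
      then show ?thesis using ab by (metis add.assoc)
    qed
  qed
  show "finite F"
  proof (rule ccontr)
    assume "infinite F"
    then obtain s :: "nat \<Rightarrow> exponent" where s: "inj s" "range s \<subseteq> F"
      using infinite_countable_subset by blast
    obtain r where r: "strict_mono r" "\<And>k. k < n \<Longrightarrow> incseq (\<lambda>i. expo (s (r i)) k)"
      using subseq_incseq_coords[of n s] by blast
    have le: "expo (s (r 0)) k \<le> expo (s (r 1)) k" for k
    proof (cases "k < n")
      case True then show ?thesis using r(2)[OF True] by (auto simp: incseq_def)
    next
      case False
      then have "k \<notin> vars (s (r 0))" using assms[of "s (r 0)"] s(2) \<open>F \<subseteq> S\<close> by fastforce
      then show ?thesis by (simp add: in_keys_iff)
    qed
    have "s (r 1) = s (r 0) + (s (r 1) - s (r 0))"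
      by (rule poly_mapping_eqI) (use le in \<open>simp add: lookup_add lookup_minus\<close>)
    then have "s (r 0) = s (r 1)" using s(2) unfolding F_def by blast
    then have "r 0 = r 1" using s(1) by (simp add: inj_eq)
    then show False using r(1) by (metis strict_mono_eq zero_neq_one)
  qed
qed

text \<open>
  Weights are integers, so each monomial of \<open>f\<close> is heavier than \<open>a\<close> by the factor \<open>(weight a + 1) / weight a\<close>
  at least. A large exponent \<open>\<rho>\<close> makes the tail negligible against \<open>a\<close>.
\<close>

lemma coef_bound_tail:
  assumes f: "f \<in> cps n" and tl: "\<And>c. coef f c \<noteq> 0 \<Longrightarrow> weight a < weight c"
  shows "\<exists>\<rho>0. \<forall>\<rho>\<ge>\<rho>0. coef_bound \<rho> f (1 / (2 * real (weight a) ^ \<rho>))"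
proof -
  obtain \<rho>1 B where B: "coef_bound \<rho>1 f B" using f by (auto simp: cps_iff)
  have B0: "0 \<le> B" using B by (rule coef_bound_nonneg)
  let ?q = "real (weight a) / (real (weight a) + 1)"
  have q: "0 < ?q" "?q < 1" by (auto simp: divide_simps add_pos_pos)
  let ?y = "1 / (2 * B * real (weight a) ^ \<rho>1 + 1)"
  have "?y > 0" using B0 by (simp add: add_nonneg_pos)
  then obtain j0 where j0: "?q ^ j0 < ?y" using real_arch_pow_inv q by blast
  show ?thesis
  proof (intro exI[of _ "\<rho>1 + j0"] allI impI)
    fix \<rho> assume "\<rho> \<ge> \<rho>1 + j0"
    then obtain k where "\<rho> = \<rho>1 + j0 + k" using le_Suc_ex by blast
    then have "\<rho> = \<rho>1 + (j0 + k)" by simp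
    then obtain j where j: "\<rho> = \<rho>1 + j" "j \<ge> j0" using le_add1 by blast
    have "coef_bound \<rho> f (B / (real (weight a) + 1) ^ j)"
      unfolding coef_bound_def
    proof (intro allI impI)
      fix S :: "exponent set" assume S: "finite S"
      have "(\<Sum>m\<in>S. norm (coef f m) / real (weight m) ^ \<rho>) \<le> (\<Sum>m\<in>S. norm (coef f m) / real (weight m) ^ \<rho>1 / (real (weight a) + 1) ^ j)"
      proof (rule sum_mono)
        fix m
        show "norm (coef f m) / real (weight m) ^ \<rho> \<le> norm (coef f m) / real (weight m) ^ \<rho>1 / (real (weight a) + 1) ^ j"
        proof (cases "coef f m = 0")
          case False
          then have "(real (weight a) + 1) ^ j \<le> real (weight m) ^ j" using tl[OF False] by (intro power_mono) auto
          then show ?thesis unfolding j(1) power_add divide_divide_eq_left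
            by (intro divide_left_mono mult_left_mono) auto
        qed simp
      qed
      also have "\<dots> = (\<Sum>m\<in>S. norm (coef f m) / real (weight m) ^ \<rho>1) / (real (weight a) + 1) ^ j"
        by (simp add: sum_divide_distrib)
      also have "\<dots> \<le> B / (real (weight a) + 1) ^ j"
        using B S by (auto simp: coef_bound_def intro!: divide_right_mono)
      finally show "(\<Sum>m\<in>S. norm (coef f m) / real (weight m) ^ \<rho>) \<le> B / (real (weight a) + 1) ^ j" .
    qed
    moreover have "B / (real (weight a) + 1) ^ j \<le> 1 / (2 * real (weight a) ^ \<rho>)"
    proof -
      define q where "q = ?q ^ j"
      define y where "y = 2 * B * real (weight a) ^ \<rho>1"
      have y: "0 \<le> y" using B0 by (simp add: y_def)
      have q0: "0 \<le> q" by (simp add: q_def)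
      have "q \<le> ?q ^ j0" unfolding q_def using q j(2) by (intro power_decreasing) auto
      then have "q \<le> 1 / (y + 1)" using j0 unfolding y_def by linarith
      then have "q * (y + 1) \<le> 1" using y by (simp add: pos_le_divide_eq)
      then have "q * y \<le> 1" using q0 by (simp add: distrib_left)
      then have "y * real (weight a) ^ j \<le> (real (weight a) + 1) ^ j"
        unfolding q_def by (simp add: power_divide pos_divide_le_eq mult.commute)
      then have "B * (2 * real (weight a) ^ \<rho>) \<le> 1 * (real (weight a) + 1) ^ j"
        by (simp add: y_def j(1) power_add mult_ac)
      then show ?thesis
        by (simp add: pos_divide_le_eq pos_le_divide_eq mult.commute)
    qed
    ultimately show "coef_bound \<rho> f (1 / (2 * real (weight a) ^ \<rho>))" by (auto intro: coef_bound_mono)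
  qed
qed

text \<open>
  Division by the series \<open>g a\<close>, \<open>a \<in> F\<close>, with leading monomials \<open>a\<close>. Let \<open>h\<close> be the series of all
  monomials met in the course of the division. Those in \<open>L\<close> are removed by subtracting a multiple of
  some \<open>g a\<close>, which creates heavier monomials; so the coefficients of \<open>h\<close> satisfy a recursion on the
  weight. For a large exponent the tails of the \<open>g a\<close> are so small that the partial sums \<open>T\<close> of the
  absolute values of \<open>h\<close> satisfy \<open>T \<le> B + T / 2\<close>, where \<open>B\<close> bounds \<open>f\<close>; so \<open>h\<close> converges.
\<close>

lemma standard_basis_division:
  assumes F: "finite F" and g: "\<And>a. a \<in> F \<Longrightarrow> g a \<in> cps n" "\<And>a. a \<in> F \<Longrightarrow> coef (g a) a = 1"
    and lead: "\<And>a c. a \<in> F \<Longrightarrow> coef (g a) c \<noteq> 0 \<Longrightarrow> weight a \<le> weight c"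
    and sel: "\<And>m. m \<in> L \<Longrightarrow> sel m \<in> F \<and> (\<exists>b. m = sel m + b)"
    and f: "f \<in> cps n"
  obtains q r where "\<And>a. a \<in> F \<Longrightarrow> q a \<in> cps n" "r \<in> cps n"
    "f = (\<Sum>a\<in>F. q a * g a) + r" "\<And>m. m \<in> L \<Longrightarrow> coef r m = 0"
    "\<And>t. ord_ge f t \<Longrightarrow> ord_ge r t" "\<And>a t. a \<in> F \<Longrightarrow> ord_ge f t \<Longrightarrow> ord_ge (q a) (t - lweight a)"
proof -
  let ?T = "\<lambda>m. {(b, c). b + c = (m :: exponent)}"
  define tl where "tl a = g a - monomial a" for a
  have tl_cps: "tl a \<in> cps n" if "a \<in> F" for a
  proof -
    have "vars a \<subseteq> {..<n}" using g[OF that] cps_keys[of "g a" n a] by simp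
    then show ?thesis using g[OF that] by (simp add: tl_def)
  qed
  have tl_weight: "weight a < weight c" if "a \<in> F" "coef (tl a) c \<noteq> 0" for a c
  proof -
    have "c \<noteq> a" using that g(2)[of a] by (auto simp: tl_def coef_simps coef_monomial)
    then show ?thesis using that lead[of a c] weight_eq_iff[of a c]
      by (auto simp: tl_def coef_simps coef_monomial le_less)
  qed
  \<comment> \<open>the quotient by \<open>g a\<close>, if \<open>h\<close> collects the monomials met during the division\<close>
  define qc where "qc h a b = (if a + b \<in> L \<and> sel (a + b) = a then h (a + b) else 0)"
    for h :: "exponent \<Rightarrow> complex" and a b
  define G where "G h m = coef f m - (\<Sum>a\<in>F. \<Sum>(b, c)\<in>?T m. qc h a b * coef (tl a) c)"
    for h :: "exponent \<Rightarrow> complex" and m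
  define h where "h = wfrec (Wellfounded.measure weight) G"
  have "adm_wf (Wellfounded.measure weight) G"
    unfolding adm_wf_def
  proof (intro allI impI)
    fix h h' :: "exponent \<Rightarrow> complex" and m assume eq: "\<forall>z. (z, m) \<in> Wellfounded.measure weight \<longrightarrow> h z = h' z"
    have "qc h a b * coef (tl a) c = qc h' a b * coef (tl a) c" if "a \<in> F" "b + c = m" for a b c
    proof (cases "coef (tl a) c = 0")
      case False
      then have "weight (a + b) < weight m" using tl_weight[of a c] that by (auto simp: weight_add)
      then show ?thesis using eq by (simp add: qc_def)
    qed simp
    then show "G h m = G h' m" unfolding G_def by (intro arg_cong2[where f = minus] sum.cong refl) auto
  qed
  then have h: "h m = G h m" for m
    using wfrec_fixpoint[OF wf_measure, of weight G] by (metis h_def)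
  have step: "coef f m \<noteq> 0 \<or> (\<exists>a\<in>F. \<exists>b c. b + c = m \<and> h (a + b) \<noteq> 0 \<and> coef (tl a) c \<noteq> 0 \<and> weight (a + b) < weight m)" if "h m \<noteq> 0" for m
  proof (rule ccontr)
    assume no: "\<not> ?thesis"
    have "qc h a b * coef (tl a) c = 0" if "a \<in> F" "b + c = m" for a b c
    proof (rule ccontr)
      assume nz: "qc h a b * coef (tl a) c \<noteq> 0"
      then have "weight (a + b) < weight m" using tl_weight[of a c] that by (auto simp: weight_add)
      then show False using nz no that by (auto simp: qc_def split: if_splits)
    qed
    then have "G h m = 0" using no unfolding G_def by (auto intro!: sum.neutral)
    then show False using h that by simp
  qed
  have hkeys: "vars m \<subseteq> {..<n}" if "h m \<noteq> 0" for m
    using that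
  proof (induction "weight m" arbitrary: m rule: less_induct)
    case less
    from step[OF less.prems] show ?case
    proof
      assume "coef f m \<noteq> 0" then show ?thesis using f cps_keys by blast
    next
      assume "\<exists>a\<in>F. \<exists>b c. b + c = m \<and> h (a + b) \<noteq> 0 \<and> coef (tl a) c \<noteq> 0 \<and> weight (a + b) < weight m"
      then obtain a b c where *: "a \<in> F" "b + c = m" "h (a + b) \<noteq> 0" "coef (tl a) c \<noteq> 0" "weight (a + b) < weight m" by blast
      then have "vars (a + b) \<subseteq> {..<n}" using less.hyps by blast
      moreover have "vars c \<subseteq> {..<n}" using * tl_cps cps_keys by blast
      ultimately show ?thesis using *(2) by (auto simp: keys_add_nat)
    qed
  qed
  have hord: "t \<le> lweight m" if "h m \<noteq> 0" "ord_ge f t" for m t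
    using that
  proof (induction "weight m" arbitrary: m rule: less_induct)
    case less
    from step[OF less.prems(1)] show ?case
    proof
      assume "coef f m \<noteq> 0" then show ?thesis using less by (auto simp: ord_ge_def)
    next
      assume "\<exists>a\<in>F. \<exists>b c. b + c = m \<and> h (a + b) \<noteq> 0 \<and> coef (tl a) c \<noteq> 0 \<and> weight (a + b) < weight m"
      then obtain a b where *: "h (a + b) \<noteq> 0" "weight (a + b) < weight m" by blast
      then have "t \<le> lweight (a + b)" using less by blast
      also have "\<dots> \<le> lweight m" using * by (simp add: lweight_le_iff)
      finally show ?thesis .
    qed
  qed
  have "\<exists>\<rho>0. \<forall>\<rho>\<ge>\<rho>0. coef_bound \<rho> (tl a) (1 / (2 * real (weight a) ^ \<rho>))" if "a \<in> F" for a
    by (rule coef_bound_tail[OF tl_cps[OF that] tl_weight[OF that]])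
  then obtain \<rho>0 where \<rho>0: "\<And>a \<rho>. a \<in> F \<Longrightarrow> \<rho> \<ge> \<rho>0 a \<Longrightarrow> coef_bound \<rho> (tl a) (1 / (2 * real (weight a) ^ \<rho>))"
    by metis
  obtain \<rho>1 B where B1: "coef_bound \<rho>1 f B" using f by (auto simp: cps_iff)
  define \<rho> where "\<rho> = \<rho>1 + (\<Sum>a\<in>F. \<rho>0 a)"
  have B: "coef_bound \<rho> f B" using B1 by (rule coef_bound_mono) (auto simp: \<rho>_def)
  have tlbd: "coef_bound \<rho> (tl a) (1 / (2 * real (weight a) ^ \<rho>))" if "a \<in> F" for a
    by (rule \<rho>0[OF that]) (use member_le_sum[of a F \<rho>0] F that in \<open>auto simp: \<rho>_def\<close>)
  let ?w = "\<lambda>m. real (weight m) ^ \<rho>"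
  \<comment> \<open>sets of monomials closed under passing to lower weights, on which the recursion can be summed\<close>
  have main: "(\<Sum>m\<in>{m. weight m \<le> t}. norm (h m) / ?w m) \<le> 2 * B" for t
  proof -
    let ?S = "{m. weight m \<le> t}"
    have fS: "finite ?S" by (rule finite_weight_le)
    let ?B = "\<lambda>a. {b. a + b \<in> ?S}"
    have fB: "finite (?B a)" for a
      by (rule finite_subset[OF _ fS]) (auto intro: order_trans[OF weight_le_add(2)])
    have inner: "(\<Sum>m\<in>?S. \<Sum>(b, c)\<in>?T m. norm (qc h a b) * norm (coef (tl a) c) / ?w m)
       \<le> (\<Sum>b\<in>?B a. norm (qc h a b) / ?w (a + b)) / 2" if a: "a \<in> F" for a
    proof -
      let ?u = "\<lambda>(b, c). norm (qc h a b) / ?w b * (norm (coef (tl a) c) / ?w c)"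
      have "(\<Sum>m\<in>?S. \<Sum>(b, c)\<in>?T m. norm (qc h a b) * norm (coef (tl a) c) / ?w m) = (\<Sum>m\<in>?S. \<Sum>p\<in>?T m. ?u p)"
        by (intro sum.cong refl) (auto simp: weight_add power_mult_distrib)
      also have "\<dots> = (\<Sum>p\<in>(\<Union>m\<in>?S. ?T m). ?u p)"
        by (rule sum.UNION_disjoint[symmetric]) (use fS finite_monom_splittings in auto)
      also have "\<dots> = (\<Sum>p\<in>(\<Union>m\<in>?S. ?T m) \<inter> (?B a \<times> UNIV). ?u p)"
      proof (rule sum.mono_neutral_right)
        show "\<forall>p\<in>(\<Union>m\<in>?S. ?T m) - (\<Union>m\<in>?S. ?T m) \<inter> ?B a \<times> UNIV. ?u p = 0"
        proof
          fix p assume p: "p \<in> (\<Union>m\<in>?S. ?T m) - (\<Union>m\<in>?S. ?T m) \<inter> ?B a \<times> UNIV"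
          obtain b c where bc: "p = (b, c)" by force
          have "weight (b + c) \<le> t" "\<not> weight (a + b) \<le> t" using p bc by auto
          have "\<not> weight a < weight c"
          proof
            assume "weight a < weight c"
            then have "weight (a + b) \<le> weight (b + c)" by (simp add: weight_add mult.commute[of "weight b"])
            then show False using \<open>weight (b + c) \<le> t\<close> \<open>\<not> weight (a + b) \<le> t\<close> by linarith
          qed
          then have "coef (tl a) c = 0" using tl_weight[OF a] by blast
          then show "?u p = 0" using bc by simp
        qed
      qed (use fS finite_monom_splittings in auto)
      also have "\<dots> \<le> (\<Sum>p\<in>?B a \<times> ?S. ?u p)"
      proof (rule sum_mono2)
        show "(\<Union>m\<in>?S. ?T m) \<inter> (?B a \<times> UNIV) \<subseteq> ?B a \<times> ?S"
          by (auto intro: order_trans[OF weight_le_add(2)])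
      qed (use fS fB in \<open>auto simp del: mem_Collect_eq\<close>)
      also have "\<dots> = (\<Sum>b\<in>?B a. norm (qc h a b) / ?w b) * (\<Sum>c\<in>?S. norm (coef (tl a) c) / ?w c)"
        by (simp add: sum_product sum.cartesian_product)
      also have "\<dots> \<le> (\<Sum>b\<in>?B a. norm (qc h a b) / ?w b) * (1 / (2 * ?w a))"
        by (rule mult_left_mono) (use tlbd[OF a] fS in \<open>auto simp: coef_bound_def intro: sum_nonneg\<close>)
      also have "\<dots> = (\<Sum>b\<in>?B a. norm (qc h a b) / ?w (a + b)) / 2"
        by (simp add: sum_distrib_right sum_divide_distrib weight_add power_mult_distrib mult_ac)
      finally show ?thesis .
    qed
    have "(\<Sum>a\<in>F. \<Sum>b\<in>?B a. norm (qc h a b) / ?w (a + b)) = (\<Sum>(a, b)\<in>Sigma F ?B. norm (qc h a b) / ?w (a + b))"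
      by (rule sum.Sigma[OF F]) (rule ballI, rule fB)
    also have "\<dots> = (\<Sum>(a, b)\<in>{(a, b)\<in>Sigma F ?B. a + b \<in> L \<and> sel (a + b) = a}. norm (h (a + b)) / ?w (a + b))"
    proof (rule sum.mono_neutral_cong_right)
      show "finite (Sigma F ?B)" by (rule finite_SigmaI[OF F fB])
      show "{(a, b)\<in>Sigma F ?B. a + b \<in> L \<and> sel (a + b) = a} \<subseteq> Sigma F ?B" by blast
      show "\<forall>p\<in>Sigma F ?B - {(a, b)\<in>Sigma F ?B. a + b \<in> L \<and> sel (a + b) = a}.
          (case p of (a, b) \<Rightarrow> norm (qc h a b) / ?w (a + b)) = 0"
        unfolding qc_def by (intro ballI) (simp split: prod.splits, blast)
      show "(case p of (a, b) \<Rightarrow> norm (qc h a b) / ?w (a + b)) = (case p of (a, b) \<Rightarrow> norm (h (a + b)) / ?w (a + b))"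
        if "p \<in> {(a, b)\<in>Sigma F ?B. a + b \<in> L \<and> sel (a + b) = a}" for p
        using that unfolding qc_def by (simp split: prod.splits)
    qed
    also have "\<dots> = (\<Sum>m\<in>(\<lambda>(a, b). a + b) ` {(a, b)\<in>Sigma F ?B. a + b \<in> L \<and> sel (a + b) = a}. norm (h m) / ?w m)"
      by (subst sum.reindex) (auto simp: inj_on_def case_prod_beta)
    also have "\<dots> \<le> (\<Sum>m\<in>?S. norm (h m) / ?w m)"
      by (rule sum_mono2[OF fS]) auto
    finally have regroup: "(\<Sum>a\<in>F. \<Sum>b\<in>?B a. norm (qc h a b) / ?w (a + b)) \<le> (\<Sum>m\<in>?S. norm (h m) / ?w m)" .
    have "(\<Sum>m\<in>?S. norm (h m) / ?w m) \<le> (\<Sum>m\<in>?S. norm (coef f m) / ?w m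
          + (\<Sum>a\<in>F. \<Sum>(b, c)\<in>?T m. norm (qc h a b) * norm (coef (tl a) c) / ?w m))"
    proof (rule sum_mono)
      fix m
      have "norm (h m) \<le> norm (coef f m) + norm (\<Sum>a\<in>F. \<Sum>(b, c)\<in>?T m. qc h a b * coef (tl a) c)"
        unfolding h[of m] G_def by (rule norm_triangle_ineq4)
      also have "norm (\<Sum>a\<in>F. \<Sum>(b, c)\<in>?T m. qc h a b * coef (tl a) c) \<le> (\<Sum>a\<in>F. \<Sum>(b, c)\<in>?T m. norm (qc h a b) * norm (coef (tl a) c))"
        by (rule order_trans[OF norm_sum], rule sum_mono, rule order_trans[OF norm_sum]) (auto simp: norm_mult case_prod_beta)
      finally have "norm (h m) / ?w m \<le> (norm (coef f m) + (\<Sum>a\<in>F. \<Sum>(b, c)\<in>?T m. norm (qc h a b) * norm (coef (tl a) c))) / ?w m"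
        by (intro divide_right_mono) auto
      then show "norm (h m) / ?w m \<le> norm (coef f m) / ?w m
          + (\<Sum>a\<in>F. \<Sum>(b, c)\<in>?T m. norm (qc h a b) * norm (coef (tl a) c) / ?w m)"
        by (simp add: add_divide_distrib sum_divide_distrib case_prod_beta)
    qed
    also have "\<dots> = (\<Sum>m\<in>?S. norm (coef f m) / ?w m) + (\<Sum>a\<in>F. \<Sum>m\<in>?S. \<Sum>(b, c)\<in>?T m. norm (qc h a b) * norm (coef (tl a) c) / ?w m)"
      unfolding sum.distrib by (subst sum.swap[of _ F]) simp
    also have "\<dots> \<le> B + (\<Sum>a\<in>F. (\<Sum>b\<in>?B a. norm (qc h a b) / ?w (a + b)) / 2)"
      by (intro add_mono sum_mono inner) (use B fS in \<open>auto simp: coef_bound_def\<close>)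
    also have "\<dots> = B + (\<Sum>a\<in>F. \<Sum>b\<in>?B a. norm (qc h a b) / ?w (a + b)) / 2"
      by (simp add: sum_divide_distrib)
    finally show ?thesis using regroup by linarith
  qed
  have hbd: "(\<Sum>m\<in>S. norm (h m) / ?w m) \<le> 2 * B" if "finite S" for S
  proof -
    have "(\<Sum>m\<in>S. norm (h m) / ?w m) \<le> (\<Sum>m\<in>{m. weight m \<le> Max (weight ` S)}. norm (h m) / ?w m)"
      by (rule sum_mono2) (use that finite_weight_le in auto)
    then show ?thesis using main by (rule order_trans)
  qed
  define q where "q a = Mpser (qc h a)" for a
  define r where "r = Mpser (\<lambda>m. if m \<in> L then 0 else h m)"
  have rbd: "coef_bound \<rho> r (2 * B)" unfolding coef_bound_def r_def
    by (intro allI impI order_trans[OF _ hbd]) (auto intro!: sum_mono)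
  have qbd: "coef_bound \<rho> (q a) (?w a * (2 * B))" for a
    unfolding coef_bound_def
  proof (intro allI impI)
    fix S :: "exponent set" assume S: "finite S"
    have "(\<Sum>b\<in>S. norm (coef (q a) b) / ?w b) \<le> (\<Sum>b\<in>S. ?w a * (norm (h (a + b)) / ?w (a + b)))"
      by (rule sum_mono) (auto simp: q_def qc_def weight_add power_mult_distrib)
    also have "\<dots> = ?w a * (\<Sum>m\<in>(+) a ` S. norm (h m) / ?w m)"
      by (subst sum.reindex) (auto simp: sum_distrib_left)
    also have "\<dots> \<le> ?w a * (2 * B)" by (intro mult_left_mono hbd) (use S in auto)
    finally show "(\<Sum>b\<in>S. norm (coef (q a) b) / ?w b) \<le> ?w a * (2 * B)" .
  qed
  have f1: "r \<in> cps n" unfolding cps_iff using rbd hkeys by (auto simp: r_def split: if_splits)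
  have f2: "q a \<in> cps n" for a unfolding cps_iff
  proof (intro conjI allI impI)
    fix b assume "coef (q a) b \<noteq> 0"
    then have "h (a + b) \<noteq> 0" by (auto simp: q_def qc_def split: if_splits)
    then show "vars b \<subseteq> {..<n}" using hkeys[of "a + b"] by (simp add: keys_add_nat)
  qed (use qbd in blast)
  have f3: "coef r m = 0" if "m \<in> L" for m using that by (simp add: r_def)
  have f4: "ord_ge r t" if "ord_ge f t" for t using hord[OF _ that] by (auto simp: ord_ge_def r_def)
  have f5: "ord_ge (q a) (t - lweight a)" if "ord_ge f t" for a t
    unfolding ord_ge_def
  proof (intro allI impI)
    fix b assume "coef (q a) b \<noteq> 0"
    then have "h (a + b) \<noteq> 0" by (auto simp: q_def qc_def split: if_splits)
    then show "t - lweight a \<le> lweight b" using hord[OF _ that, of "a + b"] by (simp add: lweight_add)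
  qed
  have f6: "f = (\<Sum>a\<in>F. q a * g a) + r"
  proof (rule mpser_eqI)
    fix m
    have q1: "coef (monomial a * q a) m = (if m \<in> L \<and> sel m = a then h m else 0)" if "a \<in> F" for a
    proof (cases "\<exists>b. m = a + b")
      case True then show ?thesis by (auto simp: coef_mult_monomial q_def qc_def)
    next
      case False then show ?thesis using sel[of m] by (auto simp: coef_mult_monomial_0)
    qed
    have "(\<Sum>a\<in>F. q a * g a) = (\<Sum>a\<in>F. monomial a * q a) + (\<Sum>a\<in>F. q a * tl a)"
      by (simp add: tl_def algebra_simps flip: sum.distrib)
    then have "coef ((\<Sum>a\<in>F. q a * g a) + r) m = (\<Sum>a\<in>F. coef (monomial a * q a) m) + (\<Sum>a\<in>F. coef (q a * tl a) m) + coef r m"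
      by (simp add: coef_simps coef_sum)
    also have "(\<Sum>a\<in>F. coef (monomial a * q a) m) = (\<Sum>a\<in>F. if m \<in> L \<and> sel m = a then h m else 0)"
      by (rule sum.cong) (auto simp: q1)
    also have "\<dots> = (if m \<in> L then h m else 0)"
      using F sel[of m] by (cases "m \<in> L") (auto simp: sum.delta)
    also have "(\<Sum>a\<in>F. coef (q a * tl a) m) = coef f m - h m"
      unfolding h[of m] G_def by (simp add: times_mpser.rep_eq q_def)
    finally show "coef f m = coef ((\<Sum>a\<in>F. q a * g a) + r) m" by (simp add: r_def)
  qed
  show thesis
  by (rule that[OF f2 f1 f6 f3 f4 f5])
qed

text \<open>
  Since \<open>F\<close> is finite, the loss of order in passing from \<open>f\<close> to the quotients is bounded by a constant
  \<open>c\<close>. This uniformity is the source of the Artin--Rees property below.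
\<close>

lemma ideal_division:
  assumes K: "idl n K"
  obtains F :: "exponent set" and c :: real and g where "finite F" "0 \<le> c" "\<And>a. a \<in> F \<Longrightarrow> g a \<in> K"
    "\<And>f. f \<in> cps n \<Longrightarrow> \<exists>q r. (\<forall>a\<in>F. q a \<in> cps n) \<and> r \<in> cps n \<and> f = (\<Sum>a\<in>F. q a * g a) + r \<and>
        (\<forall>m\<in>leads K. coef r m = 0) \<and> (\<forall>t. ord_ge f t \<longrightarrow> ord_ge r t \<and> (\<forall>a\<in>F. ord_ge (q a) (t - c)))"
proof -
  obtain F where F: "finite F" "F \<subseteq> leads K" "\<And>m. m \<in> leads K \<Longrightarrow> \<exists>a\<in>F. \<exists>b. m = a + b"
    using dickson[of "leads K" n] leads_keys[OF K] by blast
  have "\<exists>g\<in>K. coef g a = 1 \<and> (\<forall>c. coef g c \<noteq> 0 \<longrightarrow> weight a \<le> weight c)" if "a \<in> F" for a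
  proof -
    have "a \<in> leads K" using F(2) that by blast
    then obtain f where f: "f \<in> K" "is_lead f a" unfolding leads_def by blast
    then show ?thesis
      by (intro bexI[of _ "scale_mpser (1 / coef f a) f"]) (auto simp: is_lead_def intro: idl_scale[OF K])
  qed
  then obtain g where g: "\<And>a. a \<in> F \<Longrightarrow> g a \<in> K" "\<And>a. a \<in> F \<Longrightarrow> coef (g a) a = 1"
    "\<And>a c. a \<in> F \<Longrightarrow> coef (g a) c \<noteq> 0 \<Longrightarrow> weight a \<le> weight c" by metis
  obtain sel where sel: "\<And>m. m \<in> leads K \<Longrightarrow> sel m \<in> F \<and> (\<exists>b. m = sel m + b)"
    using F(3) by metis
  define c where "c = (\<Sum>a\<in>F. lweight a)"
  have c: "lweight a \<le> c" if "a \<in> F" for a unfolding c_def by (rule member_le_sum) (use that F in auto)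
  show thesis
  proof (rule that)
    show "finite F" by fact
    show "0 \<le> c" unfolding c_def by (simp add: sum_nonneg)
    show "g a \<in> K" if "a \<in> F" for a using g that by blast
    fix f assume f: "f \<in> cps n"
    obtain q r where qr: "\<And>a. a \<in> F \<Longrightarrow> q a \<in> cps n" "r \<in> cps n"
      "f = (\<Sum>a\<in>F. q a * g a) + r" "\<And>m. m \<in> leads K \<Longrightarrow> coef r m = 0"
      "\<And>t. ord_ge f t \<Longrightarrow> ord_ge r t" "\<And>a t. a \<in> F \<Longrightarrow> ord_ge f t \<Longrightarrow> ord_ge (q a) (t - lweight a)"
      by (rule standard_basis_division[OF F(1) idl_sub[OF K g(1)] g(2) g(3) sel f]) (assumption+, rule that)
    have "ord_ge (q a) (t - c)" if "a \<in> F" "ord_ge f t" for a t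
      by (rule ord_ge_mono[OF qr(6)[OF that]]) (use c[OF that(1)] in simp)
    then show "\<exists>q r. (\<forall>a\<in>F. q a \<in> cps n) \<and> r \<in> cps n \<and> f = (\<Sum>a\<in>F. q a * g a) + r \<and>
        (\<forall>m\<in>leads K. coef r m = 0) \<and> (\<forall>t. ord_ge f t \<longrightarrow> ord_ge r t \<and> (\<forall>a\<in>F. ord_ge (q a) (t - c)))"
      using qr(1-5) by (intro exI[of _ q] exI[of _ r]) blast
  qed
qed

section \<open>Normal forms and the Artin--Rees property\<close>

text \<open>
  This says \<open>f \<in> K + F\<^sub>t\<close>.
\<close>

definition near :: "mpser set \<Rightarrow> mpser \<Rightarrow> real \<Rightarrow> bool" where
  "near K f t \<longleftrightarrow> (\<exists>k\<in>K. ord_ge (f - k) t)"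

lemma near_mono: "near K f t \<Longrightarrow> t' \<le> t \<Longrightarrow> near K f t'"
  unfolding near_def by (meson ord_ge_mono)

lemma near_add: "idl n K \<Longrightarrow> near K f t \<Longrightarrow> near K g t \<Longrightarrow> near K (f + g) t"
  unfolding near_def by (metis add_diff_add idl_add ord_ge_add)

lemma near_mult: assumes "idl n K" "near K f t" "g \<in> cps n" shows "near K (g * f) t"
proof -
  obtain k where k: "k \<in> K" "ord_ge (f - k) t" using assms by (auto simp: near_def)
  have "ord_ge (g * f - g * k) t" using ord_ge_mult1[OF k(2), of g] by (simp add: algebra_simps)
  then show ?thesis using k assms idl_mult unfolding near_def by blast
qed

lemma near_uminus: "idl n K \<Longrightarrow> near K f t \<Longrightarrow> near K (- f) t"
  using near_mult[of n K f t "- 1"] by simp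

lemma near_diff: "idl n K \<Longrightarrow> near K f t \<Longrightarrow> near K g t \<Longrightarrow> near K (f - g) t"
  using near_add[of n K f t "- g"] near_uminus[of n K g t] by simp

definition normal_form :: "nat \<Rightarrow> mpser set \<Rightarrow> mpser \<Rightarrow> mpser" where
  "normal_form n K f = (SOME r. r \<in> cps n \<and> f - r \<in> K \<and> (\<forall>m\<in>leads K. coef r m = 0))"

lemma normal_form_unique:
  assumes K: "idl n K" and "f - r \<in> K" "\<And>m. m \<in> leads K \<Longrightarrow> coef r m = 0"
    "f - r' \<in> K" "\<And>m. m \<in> leads K \<Longrightarrow> coef r' m = 0"
  shows "r = r'"
proof -
  have "(f - r') - (f - r) \<in> K" using idl_minus[OF K] assms by blast
  then have "r - r' \<in> K" by (simp add: algebra_simps)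
  then have "r - r' = 0" by (rule eq_0_if_off_leads) (simp add: assms coef_simps)
  then show ?thesis by simp
qed

lemma normal_form:
  assumes K: "idl n K" and f: "f \<in> cps n"
  shows normal_form_cps: "normal_form n K f \<in> cps n" and normal_form_diff: "f - normal_form n K f \<in> K"
    and normal_form_leads: "m \<in> leads K \<Longrightarrow> coef (normal_form n K f) m = 0"
    and normal_form_ord: "ord_ge f t \<Longrightarrow> ord_ge (normal_form n K f) t"
proof -
  obtain F :: "exponent set" and c g where F: "finite F" "0 \<le> c" "\<And>a. a \<in> F \<Longrightarrow> g a \<in> K"
    "\<And>f. f \<in> cps n \<Longrightarrow> \<exists>q r. (\<forall>a\<in>F. q a \<in> cps n) \<and> r \<in> cps n \<and> f = (\<Sum>a\<in>F. q a * g a) + r \<and>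
        (\<forall>m\<in>leads K. coef r m = 0) \<and> (\<forall>t. ord_ge f t \<longrightarrow> ord_ge r t \<and> (\<forall>a\<in>F. ord_ge (q a) (t - c)))"
    by (rule ideal_division[OF K]) (rule that)
  obtain q r where qr: "\<forall>a\<in>F. q a \<in> cps n" "r \<in> cps n" "f = (\<Sum>a\<in>F. q a * g a) + r"
    "\<forall>m\<in>leads K. coef r m = 0" "\<forall>t. ord_ge f t \<longrightarrow> ord_ge r t"
    using F(4)[OF f] by blast
  have fr: "f - r \<in> K" unfolding qr(3) using qr(1) F(3) by (auto intro!: idl_sum[OF K] idl_mult[OF K])
  have ex: "normal_form n K f \<in> cps n \<and> f - normal_form n K f \<in> K \<and> (\<forall>m\<in>leads K. coef (normal_form n K f) m = 0)"
    unfolding normal_form_def by (rule someI[of _ r]) (use fr qr in auto)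
  have "normal_form n K f = r" by (rule normal_form_unique[OF K, of f]) (use ex fr qr in auto)
  then show "normal_form n K f \<in> cps n" "f - normal_form n K f \<in> K" "m \<in> leads K \<Longrightarrow> coef (normal_form n K f) m = 0"
    "ord_ge f t \<Longrightarrow> ord_ge (normal_form n K f) t" using ex qr by auto
qed

lemma normal_form_eqI:
  assumes K: "idl n K" and "f \<in> cps n" "f - r \<in> K" "\<And>m. m \<in> leads K \<Longrightarrow> coef r m = 0"
  shows "normal_form n K f = r"
  by (rule normal_form_unique[OF K, of f]) (use assms normal_form[OF K] in auto)

lemma normal_form_add:
  assumes K: "idl n K" and "f \<in> cps n" "g \<in> cps n"
  shows "normal_form n K (f + g) = normal_form n K f + normal_form n K g"
proof (rule normal_form_eqI[OF K])
  have "(f - normal_form n K f) + (g - normal_form n K g) \<in> K" using assms normal_form_diff idl_add by blast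
  then show "f + g - (normal_form n K f + normal_form n K g) \<in> K" by (simp add: algebra_simps)
qed (use assms normal_form_leads[OF K] in \<open>auto simp: coef_simps\<close>)

lemma scale_diff: "scale_mpser c (f - g) = scale_mpser c f - scale_mpser c g"
  by (rule mpser_eqI) (simp add: coef_simps algebra_simps)

lemma normal_form_scale:
  assumes K: "idl n K" and "f \<in> cps n"
  shows "normal_form n K (scale_mpser c f) = scale_mpser c (normal_form n K f)"
proof (rule normal_form_eqI[OF K])
  have "scale_mpser c (f - normal_form n K f) \<in> K" using assms normal_form_diff idl_scale by blast
  then show "scale_mpser c f - scale_mpser c (normal_form n K f) \<in> K" by (simp add: scale_diff)
qed (use assms normal_form_leads[OF K] in auto)

lemma normal_form_mem: assumes K: "idl n K" and "f \<in> K" shows "normal_form n K f = 0"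
  by (rule normal_form_eqI[OF K]) (use assms idl_sub in \<open>auto simp: coef_simps\<close>)

lemma normal_form_sum:
  assumes K: "idl n K" and "\<And>i. i \<in> S \<Longrightarrow> f i \<in> cps n"
  shows "normal_form n K (sum f S) = (\<Sum>i\<in>S. normal_form n K (f i))"
  using assms(2)
  by (induction S rule: infinite_finite_induct) (auto simp: normal_form_mem[OF K] idl_0[OF K] normal_form_add[OF K] cps_sum)

lemma near_iff_normal_form:
  assumes K: "idl n K" and f: "f \<in> cps n"
  shows "near K f t \<longleftrightarrow> ord_ge (normal_form n K f) t"
proof
  assume "near K f t"
  then obtain k where k: "k \<in> K" "ord_ge (f - k) t" by (auto simp: near_def)
  have kc: "k \<in> cps n" using K k idl_sub by blast
  have "normal_form n K f = normal_form n K (f - k) + normal_form n K k" using normal_form_add[OF K, of "f - k" k] f kc by simp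
  also have "\<dots> = normal_form n K (f - k)" using normal_form_mem[OF K k(1)] by simp
  finally show "ord_ge (normal_form n K f) t" using normal_form_ord[OF K _ k(2)] f kc by simp
next
  assume "ord_ge (normal_form n K f) t"
  then show "near K f t" unfolding near_def
    by (intro bexI[of _ "f - normal_form n K f"]) (use normal_form_diff[OF K f] in auto)
qed

text \<open>
  Krull's intersection theorem: the leading monomial of a nonzero normal form would have arbitrarily
  large weight.
\<close>

lemma mem_if_near:
  assumes K: "idl n K" and f: "f \<in> cps n" and near: "\<And>t. near K f t"
  shows "f \<in> K"
proof -
  have "normal_form n K f = 0"
  proof (rule ccontr)
    assume "normal_form n K f \<noteq> 0"
    then obtain m where "is_lead (normal_form n K f) m" by (rule ex_lead)
    then have "coef (normal_form n K f) m \<noteq> 0" by (simp add: is_lead_def)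
    moreover have "ord_ge (normal_form n K f) (lweight m + 1)" using near near_iff_normal_form[OF K f] by blast
    ultimately show False by (auto simp: ord_ge_def)
  qed
  then show ?thesis using normal_form_diff[OF K f] by simp
qed

text \<open>
  If an element had a constant term, every monomial would be a leading one of \<open>K\<close>, so all normal
  forms would vanish.
\<close>

lemma proper_ord_ge:
  assumes K: "idl n K" and "1 \<notin> K" "f \<in> K"
  shows "ord_ge f (ln 2)"
proof -
  have "coef f 0 = 0"
  proof (rule ccontr)
    assume "coef f 0 \<noteq> 0"
    then have "0 \<in> leads K" using assms unfolding leads_def is_lead_def by auto
    then have "m \<in> leads K" if "vars m \<subseteq> {..<n}" for m
      using leads_add[OF K, of 0 m] that by simp
    then have "coef (normal_form n K 1) m = 0" for m
      using normal_form_leads[OF K cps_1] cps_keys[OF normal_form_cps[OF K cps_1]] by blast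
    then have "normal_form n K 1 = 0" by (intro mpser_eqI) (simp add: coef_simps)
    then show False using normal_form_diff[OF K cps_1] assms by simp
  qed
  show ?thesis unfolding ord_ge_def
  proof (intro allI impI)
    fix m assume "coef f m \<noteq> 0"
    then have "m \<noteq> 0" using \<open>coef f 0 = 0\<close> by auto
    then have "weight m \<noteq> 1" using weight_eq_iff[of m 0] by (simp del: weight_eq_iff)
    then have "2 \<le> weight m" using weight_pos[of m] by linarith
    then show "ln 2 \<le> lweight m" by (simp add: lweight_def)
  qed
qed

lemma not_near_1:
  assumes K: "idl n K" and "1 \<notin> K" and "near K 1 t"
  shows "t \<le> 0"
proof (rule ccontr)
  assume "\<not> t \<le> 0"
  obtain k where k: "k \<in> K" "ord_ge (1 - k) t" using assms by (auto simp: near_def)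
  then have "ord_ge (1 - k) (min t (ln 2))" "ord_ge k (min t (ln 2))"
    using proper_ord_ge[OF K assms(2)] by (auto intro: ord_ge_mono[of _ t] ord_ge_mono[of _ "ln 2"])
  then have "ord_ge ((1 - k) + k) (min t (ln 2))" by (rule ord_ge_add)
  then have "min t (ln 2) \<le> 0" by (intro ord_ge_1) simp
  then show False using \<open>\<not> t \<le> 0\<close> ln_gt_zero[of "2 :: real"] by linarith
qed

definition adjoin :: "nat \<Rightarrow> mpser set \<Rightarrow> mpser \<Rightarrow> mpser set" where
  "adjoin n K x = {k + x * y | k y. k \<in> K \<and> y \<in> cps n}"

lemma idl_adjoin: assumes K: "idl n K" and x: "x \<in> cps n" shows "idl n (adjoin n K x)"
  unfolding idl_def
proof (intro conjI ballI subsetI)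
  show "a \<in> cps n" if "a \<in> adjoin n K x" for a using that idl_sub[OF K] x by (auto simp: adjoin_def)
  show "0 \<in> adjoin n K x" unfolding adjoin_def using idl_0[OF K] by (auto intro!: exI[of _ 0])
  show "a + b \<in> adjoin n K x" if "a \<in> adjoin n K x" "b \<in> adjoin n K x" for a b
  proof -
    obtain k y k' y' where "a = k + x * y" "b = k' + x * y'" "k \<in> K" "k' \<in> K" "y \<in> cps n" "y' \<in> cps n"
      using \<open>a \<in> _\<close> \<open>b \<in> _\<close> by (auto simp: adjoin_def)
    moreover from this have "(k + k') + x * (y + y') \<in> adjoin n K x"
      unfolding adjoin_def using idl_add[OF K, of k k'] cps_add[of y n y'] by blast
    ultimately show ?thesis by (simp add: algebra_simps)
  qed
  show "a * b \<in> adjoin n K x" if "a \<in> cps n" "b \<in> adjoin n K x" for a b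
  proof -
    obtain k y where "b = k + x * y" "k \<in> K" "y \<in> cps n"
      using \<open>b \<in> _\<close> by (auto simp: adjoin_def)
    moreover from this have "a * k + x * (a * y) \<in> adjoin n K x"
      unfolding adjoin_def using idl_mult[OF K, of a k] cps_mult[of a n y] \<open>a \<in> _\<close> by blast
    ultimately show ?thesis by (simp add: algebra_simps)
  qed
qed

lemma adjoin_sub: "K \<subseteq> adjoin n K x"
proof
  fix k assume "k \<in> K"
  then have "k + x * 0 \<in> adjoin n K x" unfolding adjoin_def using cps_0 by blast
  then show "k \<in> adjoin n K x" by simp
qed

lemma adjoin_mem: "idl n K \<Longrightarrow> x \<in> adjoin n K x"
proof -
  assume "idl n K"
  then have "0 + x * 1 \<in> adjoin n K x" unfolding adjoin_def using cps_1 idl_0 by blast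
  then show ?thesis by simp
qed

lemma adjoin_minimal: "idl n L \<Longrightarrow> K \<subseteq> L \<Longrightarrow> x \<in> L \<Longrightarrow> adjoin n K x \<subseteq> L"
  unfolding adjoin_def by (auto intro: idl_add idl_mult2)

definition nonzerodivisor_mod :: "nat \<Rightarrow> mpser set \<Rightarrow> mpser \<Rightarrow> bool" where
  "nonzerodivisor_mod n K x \<longleftrightarrow> x \<in> cps n \<and> (\<forall>z\<in>cps n. x * z \<in> K \<longrightarrow> z \<in> K)"

text \<open>
  Write \<open>x z = k + \<phi>\<close> with \<open>\<phi> \<in> F\<^sub>t\<close> and divide \<open>\<phi>\<close> by a standard basis of \<open>K + (x)\<close>: the quotients have
  order at least \<open>t - c\<close>. Collecting the multiples of \<open>x\<close> gives \<open>x (z - y) \<in> K\<close> with \<open>y \<in> F\<^bsub>t-c\<^esub>\<close>, and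
  \<open>x\<close> cancels.
\<close>

lemma artin_rees_colon:
  assumes K: "idl n K" and x: "nonzerodivisor_mod n K x"
  obtains c where "0 \<le> c" "\<And>z t. z \<in> cps n \<Longrightarrow> near K (x * z) t \<Longrightarrow> near K z (t - c)"
proof -
  let ?L = "adjoin n K x"
  have xc: "x \<in> cps n" using x by (simp add: nonzerodivisor_mod_def)
  have L: "idl n ?L" by (rule idl_adjoin[OF K xc])
  obtain F :: "exponent set" and c g where F: "finite F" "0 \<le> c" "\<And>a. a \<in> F \<Longrightarrow> g a \<in> ?L"
    "\<And>f. f \<in> cps n \<Longrightarrow> \<exists>q r. (\<forall>a\<in>F. q a \<in> cps n) \<and> r \<in> cps n \<and> f = (\<Sum>a\<in>F. q a * g a) + r \<and>
        (\<forall>m\<in>leads ?L. coef r m = 0) \<and> (\<forall>t. ord_ge f t \<longrightarrow> ord_ge r t \<and> (\<forall>a\<in>F. ord_ge (q a) (t - c)))"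
    by (rule ideal_division[OF L]) (rule that)
  have "\<exists>k y. g a = k + x * y \<and> k \<in> K \<and> y \<in> cps n" if "a \<in> F" for a
    using F(3)[OF that] by (auto simp: adjoin_def)
  then obtain \<kappa> y where ky: "\<And>a. a \<in> F \<Longrightarrow> g a = \<kappa> a + x * y a" "\<And>a. a \<in> F \<Longrightarrow> \<kappa> a \<in> K" "\<And>a. a \<in> F \<Longrightarrow> y a \<in> cps n"
    by metis
  show thesis
  proof (rule that[OF F(2)])
    fix z t assume z: "z \<in> cps n" "near K (x * z) t"
    then obtain k where k: "k \<in> K" "ord_ge (x * z - k) t" by (auto simp: near_def)
    define \<phi> where "\<phi> = x * z - k"
    have "- k + x * z \<in> ?L" unfolding adjoin_def using idl_uminus[OF K k(1)] z by blast
    then have \<phi>L: "\<phi> \<in> ?L" by (simp add: \<phi>_def)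
    obtain q r where qr: "\<forall>a\<in>F. q a \<in> cps n" "\<phi> = (\<Sum>a\<in>F. q a * g a) + r"
      "\<forall>m\<in>leads ?L. coef r m = 0" "\<forall>t. ord_ge \<phi> t \<longrightarrow> (\<forall>a\<in>F. ord_ge (q a) (t - c))"
      using F(4)[OF idl_sub[OF L \<phi>L]] by blast
    have "(\<Sum>a\<in>F. q a * g a) \<in> ?L" using qr(1) F(3) by (auto intro!: idl_sum[OF L] idl_mult[OF L])
    then have "\<phi> - (\<Sum>a\<in>F. q a * g a) \<in> ?L" using \<phi>L idl_minus[OF L] by blast
    then have "r \<in> ?L" using qr(2) by simp
    then have "r = 0" by (rule eq_0_if_off_leads) (use qr in auto)
    then have "\<phi> = (\<Sum>a\<in>F. q a * \<kappa> a) + x * (\<Sum>a\<in>F. q a * y a)"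
      unfolding qr(2) using ky by (simp add: sum_distrib_left sum.distrib[symmetric] algebra_simps)
    then have "x * (z - (\<Sum>a\<in>F. q a * y a)) = k + (\<Sum>a\<in>F. q a * \<kappa> a)"
      by (simp add: \<phi>_def algebra_simps)
    moreover have "k + (\<Sum>a\<in>F. q a * \<kappa> a) \<in> K"
      using k ky qr(1) by (auto intro!: idl_add[OF K] idl_sum[OF K] idl_mult[OF K])
    moreover have "z - (\<Sum>a\<in>F. q a * y a) \<in> cps n" using z ky qr(1) by (auto intro!: cps_sum cps_minus)
    ultimately have "z - (\<Sum>a\<in>F. q a * y a) \<in> K" using x unfolding nonzerodivisor_mod_def by metis
    moreover have "ord_ge (\<Sum>a\<in>F. q a * y a) (t - c)"
      by (rule ord_ge_sum, subst mult.commute, rule ord_ge_mult1) (use qr k in \<open>auto simp: \<phi>_def\<close>)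
    ultimately show "near K z (t - c)" unfolding near_def
      by (intro bexI[of _ "z - (\<Sum>a\<in>F. q a * y a)"]) auto
  qed
qed

section \<open>Growth of quotients\<close>

lemma underdetermined:
  fixes a :: "'e \<Rightarrow> 'b \<Rightarrow> complex"
  assumes "finite E" "finite B" "card E < card B"
  obtains l where "\<exists>b\<in>B. l b \<noteq> 0" "\<And>e. e \<in> E \<Longrightarrow> (\<Sum>b\<in>B. a e b * l b) = 0"
proof -
  have "\<exists>l. (\<exists>b\<in>B. l b \<noteq> 0) \<and> (\<forall>e\<in>E. (\<Sum>b\<in>B. a e b * l b) = 0)"
    using assms
  proof (induction E arbitrary: B a rule: finite_induct)
    case empty
    then obtain b where "b \<in> B" by fastforce
    then show ?case by (intro exI[of _ "\<lambda>_. 1"]) auto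
  next
    case (insert e E)
    show ?case
    proof (cases "\<forall>b\<in>B. a e b = 0")
      case True
      have "card E < card B" using insert by simp
      then obtain l where "\<exists>b\<in>B. l b \<noteq> 0" "\<forall>e\<in>E. (\<Sum>b\<in>B. a e b * l b) = 0"
        using insert.IH[OF insert.prems(1)] by blast
      then show ?thesis using True by (intro exI[of _ l]) auto
    next
      case False
      then obtain b0 where b0: "b0 \<in> B" "a e b0 \<noteq> 0" by blast
      \<comment> \<open>eliminate the unknown \<open>b0\<close> with the equation \<open>e\<close>\<close>
      let ?a = "\<lambda>e' b. a e' b - a e' b0 * a e b / a e b0"
      have "card E < card (B - {b0})" using insert b0 by simp
      then obtain l where l: "\<exists>b\<in>B - {b0}. l b \<noteq> 0" "\<forall>e'\<in>E. (\<Sum>b\<in>B - {b0}. ?a e' b * l b) = 0"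
        using insert.IH[of "B - {b0}" ?a] insert.prems by blast
      define l' where "l' = l(b0 := - (\<Sum>b\<in>B - {b0}. a e b * l b) / a e b0)"
      have split: "(\<Sum>b\<in>B. a e' b * l' b) = a e' b0 * l' b0 + (\<Sum>b\<in>B - {b0}. a e' b * l b)" for e'
        using insert.prems(1) b0 by (subst sum.remove[of _ b0]) (auto simp: l'_def intro!: sum.cong)
      have "(\<Sum>b\<in>B. a e' b * l' b) = 0" if "e' \<in> insert e E" for e'
      proof (cases "e' = e")
        case True then show ?thesis unfolding split using b0 by (simp add: l'_def)
      next
        case False
        then have "(\<Sum>b\<in>B - {b0}. ?a e' b * l b) = 0" using that l by blast
        moreover have "(\<Sum>b\<in>B - {b0}. ?a e' b * l b) = (\<Sum>b\<in>B - {b0}. a e' b * l b) - a e' b0 / a e b0 * (\<Sum>b\<in>B - {b0}. a e b * l b)"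
          by (simp add: left_diff_distrib right_diff_distrib sum_subtractf sum_distrib_left mult_ac)
        ultimately show ?thesis unfolding split by (simp add: l'_def field_simps)
      qed
      moreover have "\<exists>b\<in>B. l' b \<noteq> 0" using l(1) by (auto simp: l'_def)
      ultimately show ?thesis by blast
    qed
  qed
  then show thesis using that by blast
qed

definition standard_monomials :: "nat \<Rightarrow> mpser set \<Rightarrow> real \<Rightarrow> exponent set" where
  "standard_monomials n K t = {m. vars m \<subseteq> {..<n} \<and> m \<notin> leads K \<and> lweight m < t}"

text \<open>
  By uniqueness of normal forms this is the complex dimension of \<open>A / (K + F\<^sub>t)\<close>.
\<close>

definition hilbert :: "nat \<Rightarrow> mpser set \<Rightarrow> real \<Rightarrow> nat" where
  "hilbert n K t = card (standard_monomials n K t)"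

lemma finite_lweight_less: "finite {m. lweight m < t}"
proof (rule finite_subset[OF _ finite_weight_le])
  show "{m. lweight m < t} \<subseteq> {m. weight m \<le> nat \<lceil>exp t\<rceil>}"
  proof
    fix m assume "m \<in> {m. lweight m < t}"
    then have "real (weight m) < exp t" unfolding lweight_def by (metis weight_pos exp_less_cancel_iff exp_ln mem_Collect_eq of_nat_0_less_iff)
    then show "m \<in> {m. weight m \<le> nat \<lceil>exp t\<rceil>}" by (simp, linarith)
  qed
qed

lemma finite_standard_monomials [simp]: "finite (standard_monomials n K t)"
  by (rule finite_subset[OF _ finite_lweight_less[of t]]) (auto simp: standard_monomials_def)

lemma hilbert_mono: "t \<le> t' \<Longrightarrow> hilbert n K t \<le> hilbert n K t'"
  unfolding hilbert_def by (rule card_mono[OF finite_standard_monomials]) (auto simp: standard_monomials_def)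

lemma hilbert_antimono: "K \<subseteq> L \<Longrightarrow> hilbert n L t \<le> hilbert n K t"
  unfolding hilbert_def by (rule card_mono[OF finite_standard_monomials]) (use leads_mono in \<open>auto simp: standard_monomials_def\<close>)

text \<open>
  If \<open>y\<close> is not in \<open>K + F\<^bsub>t-c\<^esub>\<close>, then \<open>x y\<close> is not in \<open>K + F\<^sub>t\<close>. So the products of \<open>x\<close> with the standard
  monomials below \<open>t - c\<close> are independent in \<open>A / (K + F\<^sub>t)\<close>, and they vanish in \<open>A / (K + (x) + F\<^sub>t)\<close>.
\<close>

lemma hilbert_drop:
  assumes K: "idl n K" and x: "x \<in> cps n"
    and c: "\<And>z t. z \<in> cps n \<Longrightarrow> near K (x * z) t \<Longrightarrow> near K z (t - c)"
  shows "hilbert n (adjoin n K x) t + hilbert n K (t - c) \<le> hilbert n K t"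
proof -
  let ?L = "adjoin n K x"
  have L: "idl n ?L" by (rule idl_adjoin[OF K x])
  let ?E = "standard_monomials n K t - standard_monomials n ?L t" and ?B = "standard_monomials n K (t - c)"
  have sub: "standard_monomials n ?L t \<subseteq> standard_monomials n K t" using leads_mono[OF adjoin_sub[of K n x]] by (auto simp: standard_monomials_def)
  have "card ?B \<le> card ?E"
  proof (rule ccontr)
    assume "\<not> card ?B \<le> card ?E"
    then obtain l where l: "\<exists>b\<in>?B. l b \<noteq> 0"
      "\<And>e. e \<in> ?E \<Longrightarrow> (\<Sum>b\<in>?B. coef (normal_form n K (x * monomial b)) e * l b) = 0"
      using underdetermined[of ?E ?B "\<lambda>e b. coef (normal_form n K (x * monomial b)) e"] by auto
    have bc: "monomial b \<in> cps n" if "b \<in> ?B" for b using that by (auto simp: standard_monomials_def)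
    define y where "y = (\<Sum>b\<in>?B. scale_mpser (l b) (monomial b))"
    have yc: "y \<in> cps n" unfolding y_def using bc by (auto intro!: cps_sum)
    have coefy: "coef y m = (if m \<in> ?B then l m else 0)" for m
      by (simp add: y_def coef_sum coef_monomial if_distrib[of "(*) _"] sum.delta' cong: if_cong)
    have nfy: "normal_form n K y = y"
      by (rule normal_form_eqI[OF K yc]) (use idl_0[OF K] in \<open>auto simp: coefy standard_monomials_def\<close>)
    obtain b where b: "b \<in> ?B" "l b \<noteq> 0" using l(1) by blast
    then have "coef y b \<noteq> 0" "lweight b < t - c" using coefy by (auto simp: standard_monomials_def)
    then have "\<not> ord_ge y (t - c)" unfolding ord_ge_def by force
    then have "\<not> near K y (t - c)" using near_iff_normal_form[OF K yc] nfy by simp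
    then have nn: "\<not> near K (x * y) t" using c[OF yc] by blast
    define r where "r = normal_form n K (x * y)"
    have xy: "x * y \<in> cps n" using x yc by simp
    have r: "\<not> ord_ge r t" using nn near_iff_normal_form[OF K xy] by (simp add: r_def)
    have rr: "r = (\<Sum>b\<in>?B. scale_mpser (l b) (normal_form n K (x * monomial b)))"
    proof -
      have "x * y = (\<Sum>b\<in>?B. scale_mpser (l b) (x * monomial b))"
        unfolding y_def sum_distrib_left by (rule sum.cong) (auto simp: scale_eq_mult[of _ "_ * _"] scale_eq_mult[of _ "monomial _"] mult_ac)
      then show ?thesis unfolding r_def using x bc by (simp add: normal_form_sum[OF K] normal_form_scale[OF K])
    qed
    obtain m0 where m0: "coef r m0 \<noteq> 0" "lweight m0 < t" using r by (auto simp: ord_ge_def not_le)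
    then have "r \<noteq> 0" by (auto simp: coef_simps)
    then obtain m where m: "is_lead r m" by (rule ex_lead)
    then have "lweight m \<le> lweight m0" using m0 by (simp add: is_lead_def lweight_le_iff)
    then have mt: "lweight m < t" using m0 by simp
    have "r \<in> ?L"
    proof -
      have "x * y - r \<in> K" unfolding r_def by (rule normal_form_diff[OF K xy])
      then have "- (x * y - r) \<in> K" by (rule idl_uminus[OF K])
      then have "- (x * y - r) + x * y \<in> ?L" using yc unfolding adjoin_def by blast
      then show ?thesis by simp
    qed
    then have "m \<in> leads ?L" using m by (auto simp: leads_def)
    moreover have "m \<notin> leads K" using m normal_form_leads[OF K xy, of m] by (auto simp: r_def is_lead_def)
    moreover have "vars m \<subseteq> {..<n}" using leads_keys[OF L] \<open>m \<in> leads ?L\<close> by blast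
    ultimately have "m \<in> ?E" using mt by (auto simp: standard_monomials_def)
    then have "coef r m = 0" using l(2)[of m] unfolding rr by (simp add: coef_sum mult.commute)
    then show False using m by (simp add: is_lead_def)
  qed
  moreover have "card ?E = card (standard_monomials n K t) - card (standard_monomials n ?L t)"
    by (rule card_Diff_subset) (use sub in auto)
  moreover have "card (standard_monomials n ?L t) \<le> card (standard_monomials n K t)" by (rule card_mono) (use sub in auto)
  ultimately show ?thesis by (simp add: hilbert_def)
qed

lemma hilbert_drop_sum:
  assumes K: "idl n K" and x: "nonzerodivisor_mod n K x"
  obtains c where "0 \<le> c" "\<And>t N. real N * hilbert n (adjoin n K x) t \<le> hilbert n K (t + real N * c)"
proof -
  obtain c where c: "0 \<le> c" "\<And>z t. z \<in> cps n \<Longrightarrow> near K (x * z) t \<Longrightarrow> near K z (t - c)"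
    using artin_rees_colon[OF K x] by blast
  have xc: "x \<in> cps n" using x by (simp add: nonzerodivisor_mod_def)
  have "real N * hilbert n (adjoin n K x) t \<le> hilbert n K (t + real N * c)" for t N
  proof (induction N)
    case (Suc N)
    have "hilbert n (adjoin n K x) t \<le> hilbert n (adjoin n K x) (t + real (Suc N) * c)"
      by (rule hilbert_mono) (use c in auto)
    moreover have "hilbert n (adjoin n K x) (t + real (Suc N) * c) + hilbert n K (t + real (Suc N) * c - c) \<le> hilbert n K (t + real (Suc N) * c)"
      by (rule hilbert_drop[OF K xc]) (use c in auto)
    moreover have "t + real (Suc N) * c - c = t + real N * c" by (simp add: algebra_simps)
    ultimately show ?case using Suc by (simp add: algebra_simps)
  qed simp
  then show thesis using that c by blast
qed

text \<open>
  This plays the role of \<open>dim (A / K) \<le> e\<close>.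
\<close>

definition growth_le :: "nat \<Rightarrow> mpser set \<Rightarrow> nat \<Rightarrow> bool" where
  "growth_le n K e \<longleftrightarrow> (\<exists>C. \<forall>t\<ge>0. real (hilbert n K t) \<le> C * (t + 1) ^ e)"

lemma growth_le_antimono: "growth_le n K e \<Longrightarrow> K \<subseteq> L \<Longrightarrow> growth_le n L e"
  unfolding growth_le_def using hilbert_antimono[of K L n] by (meson of_nat_le_iff order_trans)

text \<open>
  Summing the drop over \<open>N\<close> steps of length \<open>c\<close> with \<open>N\<close> about \<open>t\<close> divides the bound by \<open>t\<close>.
\<close>

lemma growth_le_drop:
  assumes K: "idl n K" and x: "nonzerodivisor_mod n K x" and u: "growth_le n K (Suc e)"
  shows "growth_le n (adjoin n K x) e"
proof -
  obtain c where c: "0 \<le> c" "\<And>t N. real N * hilbert n (adjoin n K x) t \<le> hilbert n K (t + real N * c)"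
    using hilbert_drop_sum[OF K x] by blast
  obtain C where C: "\<And>t. t \<ge> 0 \<Longrightarrow> real (hilbert n K t) \<le> C * (t + 1) ^ Suc e"
    using u by (auto simp: growth_le_def)
  have C0: "0 \<le> C" using C[of 0] by simp
  have "real (hilbert n (adjoin n K x) t) \<le> (C * (2 * c + 1) ^ Suc e) * (t + 1) ^ e" if t: "t \<ge> 0" for t
  proof -
    define N where "N = nat \<lceil>t + 1\<rceil>"
    have "real (nat \<lceil>s\<rceil>) \<le> 2 * s" if "s \<ge> 1" for s :: real
      using that by linarith
    from this[of "t + 1"] have N: "t + 1 \<le> real N" "real N \<le> 2 * (t + 1)"
      using t real_nat_ceiling_ge[of "t + 1"] by (simp_all only: N_def)
    have "(t + 1) * hilbert n (adjoin n K x) t \<le> real N * hilbert n (adjoin n K x) t"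
      by (rule mult_right_mono) (use N in auto)
    also have "\<dots> \<le> hilbert n K (t + real N * c)" by (rule c)
    also have "\<dots> \<le> C * (t + real N * c + 1) ^ Suc e" by (rule C) (use t c in auto)
    also have "\<dots> \<le> C * ((2 * c + 1) * (t + 1)) ^ Suc e"
    proof (intro mult_left_mono power_mono C0)
      have "real N * c \<le> 2 * (t + 1) * c" by (rule mult_right_mono) (use N c in auto)
      then show "t + real N * c + 1 \<le> (2 * c + 1) * (t + 1)" by (simp add: algebra_simps)
    qed (use t c in auto)
    also have "\<dots> = (t + 1) * ((C * (2 * c + 1) ^ Suc e) * (t + 1) ^ e)" by (simp add: power_mult_distrib mult_ac)
    finally show ?thesis using t by (simp add: mult_le_cancel_left)
  qed
  then show ?thesis unfolding growth_le_def by blast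
qed

text \<open>
  A bounded increasing sequence of integers is eventually constant, so the Hilbert function of
  \<open>A / (K + (x))\<close> must vanish.
\<close>

lemma growth_le_0_drop:
  assumes K: "idl n K" and x: "nonzerodivisor_mod n K x" and u: "growth_le n K 0"
  shows "1 \<in> adjoin n K x"
proof (rule ccontr)
  assume one: "1 \<notin> adjoin n K x"
  have L: "idl n (adjoin n K x)" using idl_adjoin K x by (auto simp: nonzerodivisor_mod_def)
  obtain c where c: "0 \<le> c" "\<And>t N. real N * hilbert n (adjoin n K x) t \<le> hilbert n K (t + real N * c)"
    using hilbert_drop_sum[OF K x] by blast
  obtain C where C: "\<And>t. t \<ge> 0 \<Longrightarrow> real (hilbert n K t) \<le> C" using u by (auto simp: growth_le_def)
  have "0 \<notin> leads (adjoin n K x)"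
  proof
    assume "0 \<in> leads (adjoin n K x)"
    then obtain f where f: "f \<in> adjoin n K x" "coef f 0 \<noteq> 0" by (auto simp: leads_def is_lead_def)
    then have "ln 2 \<le> lweight 0" using proper_ord_ge[OF L one f(1)] unfolding ord_ge_def by blast
    then show False using ln_gt_zero[of 2] by simp
  qed
  then have "0 \<in> standard_monomials n (adjoin n K x) 1" by (simp add: standard_monomials_def)
  then have "hilbert n (adjoin n K x) 1 > 0" unfolding hilbert_def by (auto simp: card_gt_0_iff)
  then have "1 \<le> real (hilbert n (adjoin n K x) 1)" by simp
  then have ge: "real N \<le> real N * hilbert n (adjoin n K x) 1" for N by (metis mult.right_neutral mult_left_mono of_nat_0_le_iff)
  obtain N where "real N > C" using reals_Archimedean2 by blast
  moreover have "real N \<le> C"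
    using ge[of N] c(2)[of N 1] C[of "1 + real N * c"] c(1) by (smt (verit) mult_nonneg_nonneg of_nat_0_le_iff)
  ultimately show False by simp
qed

lemma idl_zero: "idl n {0}"
  by (auto simp: idl_def)

text \<open>
  A monomial of weight below \<open>exp t\<close> has exponents below \<open>2 t\<close>, since \<open>ln 2 \<ge> 1 / 2\<close>.
\<close>

lemma growth_le_zero: "growth_le n {0} n"
  unfolding growth_le_def
proof (intro exI allI impI)
  fix t :: real assume t: "t \<ge> 0"
  let ?f = "\<lambda>m. restrict (expo m) {..<n}"
  define u where "u = nat \<lceil>2 * t\<rceil>"
  have "?f ` standard_monomials n {0} t \<subseteq> PiE {..<n} (\<lambda>_. {..<u + 1})"
  proof (intro image_subsetI PiE_I)
    fix m i assume m: "m \<in> standard_monomials n {0} t" "i \<in> {..<n}"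
    have "2 ^ expo m i \<le> weight m"
    proof -
      have "(2 :: nat) ^ expo m i \<le> 2 ^ monom_deg m"
      proof (cases "i \<in> vars m")
        case True then show ?thesis unfolding monom_deg_def by (intro power_increasing member_le_sum) auto
      qed (simp add: in_keys_iff)
      then show ?thesis using weight_power_deg_le[of m] by linarith
    qed
    then have "(2 :: real) ^ expo m i \<le> real (weight m)" by (metis of_nat_le_iff of_nat_numeral of_nat_power)
    then have "ln ((2 :: real) ^ expo m i) \<le> lweight m" unfolding lweight_def by (subst ln_le_cancel_iff) auto
    then have "real (expo m i) * ln 2 < t" using m by (simp add: ln_realpow standard_monomials_def)
    moreover have "real (expo m i) * (1/2) \<le> real (expo m i) * ln 2"
      by (rule mult_left_mono) (use exp_half_le2 ln_ge_iff[of "2 :: real" "1 / 2"] in simp_all)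
    ultimately have "real (expo m i) < 2 * t" by simp
    then have "expo m i < u + 1" unfolding u_def by linarith
    then show "?f m i \<in> {..<u + 1}" using m by simp
  qed auto
  moreover have "inj_on ?f (standard_monomials n {0} t)"
  proof (rule inj_onI)
    fix m m' assume m: "m \<in> standard_monomials n {0} t" "m' \<in> standard_monomials n {0} t" and eq: "?f m = ?f m'"
    have "expo m i = expo m' i" for i
    proof (cases "i < n")
      case True then show ?thesis using fun_cong[OF eq, of i] by simp
    next
      case False
      then have "i \<notin> vars m" "i \<notin> vars m'" using m by (auto simp: standard_monomials_def)
      then show ?thesis by (simp add: in_keys_iff)
    qed
    then show "m = m'" by (rule poly_mapping_eqI)
  qed
  ultimately have "hilbert n {0} t \<le> card (PiE {..<n} (\<lambda>_. {..<u + 1}))"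
    unfolding hilbert_def by (intro card_inj_on_le) (auto intro!: finite_PiE)
  also have "\<dots> = (u + 1) ^ n" by (simp add: card_PiE)
  finally have "real (hilbert n {0} t) \<le> (real u + 1) ^ n"
    by (metis of_nat_le_iff of_nat_power of_nat_Suc Suc_eq_plus1 add.commute)
  also have "\<dots> \<le> (2 * (t + 1)) ^ n" by (rule power_mono) (use t in \<open>auto simp: u_def\<close>, linarith)
  finally show "real (hilbert n {0} t) \<le> 2 ^ n * (t + 1) ^ n" by (simp only: power_mult_distrib)
qed

section \<open>Regular sequences, depth and associated primes\<close>

primrec adjoin_list :: "nat \<Rightarrow> mpser set \<Rightarrow> mpser list \<Rightarrow> mpser set" where
  "adjoin_list n K [] = K"
| "adjoin_list n K (x # xs) = adjoin_list n (adjoin n K x) xs"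

primrec regular_mod :: "nat \<Rightarrow> mpser set \<Rightarrow> mpser list \<Rightarrow> bool" where
  "regular_mod n K [] = True"
| "regular_mod n K (x # xs) = (nonzerodivisor_mod n K x \<and> regular_mod n (adjoin n K x) xs)"

lemma adjoin_list_sub: "K \<subseteq> adjoin_list n K xs"
  by (induction xs arbitrary: K) (use adjoin_sub in \<open>fastforce+\<close>)

lemma growth_le_regular_mod:
  assumes "idl n K" "regular_mod n K xs" "1 \<notin> adjoin_list n K xs" "growth_le n K e"
  shows "length xs \<le> e \<and> growth_le n (adjoin_list n K xs) (e - length xs)"
  using assms
proof (induction xs arbitrary: K e)
  case (Cons x xs)
  then have x: "nonzerodivisor_mod n K x" by simp
  have L: "idl n (adjoin n K x)" using idl_adjoin Cons.prems(1) x by (simp add: nonzerodivisor_mod_def)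
  have one: "1 \<notin> adjoin n K x" using Cons.prems(3) adjoin_list_sub by auto
  obtain e' where e': "e = Suc e'"
    using growth_le_0_drop[OF Cons.prems(1) x] one Cons.prems(4) by (cases e) auto
  have u: "growth_le n (adjoin n K x) e'" using growth_le_drop[OF Cons.prems(1) x] Cons.prems(4) e' by blast
  show ?case using Cons.IH[OF L _ _ u] Cons.prems e' by simp
qed simp

definition colon :: "nat \<Rightarrow> mpser set \<Rightarrow> mpser \<Rightarrow> mpser set" where
  "colon n K r = {z \<in> cps n. z * r \<in> K}"

lemma idl_colon: "idl n K \<Longrightarrow> idl n (colon n K r)"
  by (auto simp: idl_def colon_def distrib_right mult.assoc)

lemma colon_sub: "idl n K \<Longrightarrow> r \<in> cps n \<Longrightarrow> K \<subseteq> colon n K r"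
  by (auto simp: colon_def idl_sub idl_mult2)

text \<open>
  The depth of \<open>A / K\<close> is at most the dimension of the quotient of \<open>A\<close> by the annihilator of any nonzero
  class \<open>r\<close>. By Krull's intersection theorem one can divide \<open>r\<close> by the
  highest power of the first element \<open>x\<close> that it contains modulo \<open>K\<close>, without changing the annihilator; then \<open>r\<close> is nonzero modulo \<open>K + (x)\<close>, and \<open>x\<close>
  lowers the dimension on both sides.
\<close>

lemma depth_bound:
  assumes "idl n K" "regular_mod n K xs" "1 \<notin> adjoin_list n K xs" "r \<in> cps n" "r \<notin> K" "growth_le n (colon n K r) e"
  shows "length xs \<le> e"
  using assms
proof (induction xs arbitrary: K r e)
  case (Cons x xs)
  have K: "idl n K" by fact
  have x: "nonzerodivisor_mod n K x" using Cons.prems by simp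
  then have xc: "x \<in> cps n" by (simp add: nonzerodivisor_mod_def)
  have L: "idl n (adjoin n K x)" by (rule idl_adjoin[OF K xc])
  have one: "1 \<notin> adjoin n K x" using Cons.prems(3) adjoin_list_sub by auto
  have xord: "ord_ge x (ln 2)" by (rule proper_ord_ge[OF L one adjoin_mem[OF K]])
  have "\<exists>j. r \<notin> adjoin n K (x ^ j)"
  proof (rule ccontr)
    assume no: "\<nexists>j. r \<notin> adjoin n K (x ^ j)"
    have "near K r t" for t
    proof -
      obtain j where j: "real j * ln 2 > t" using ex_less_of_nat_mult[of "ln 2" t] by auto
      have "r \<in> adjoin n K (x ^ j)" using no by blast
      then obtain k y where ky: "r = k + x ^ j * y" "k \<in> K" by (auto simp: adjoin_def)
      have "ord_ge (y * x ^ j) (real j * ln 2)" by (intro ord_ge_mult1 ord_ge_power xord)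
      then show ?thesis unfolding near_def using ky j
        by (intro bexI[of _ k]) (auto simp: mult.commute intro: ord_ge_mono)
    qed
    then show False using mem_if_near[OF K] Cons.prems by blast
  qed
  \<comment> \<open>\<open>r\<close> is divisible by \<open>x\<^bsup>j-1\<^esup>\<close> modulo \<open>K\<close>, but not by \<open>x\<^sup>j\<close>\<close>
  define j where "j = (LEAST j. r \<notin> adjoin n K (x ^ j))"
  have j: "r \<notin> adjoin n K (x ^ j)" unfolding j_def by (rule LeastI_ex) fact
  have "0 + x ^ 0 * r \<in> adjoin n K (x ^ 0)" unfolding adjoin_def using Cons.prems idl_0[OF K] by blast
  then have "j \<noteq> 0" using j by (intro notI) simp
  then obtain i where i: "j = Suc i" by (cases j) auto
  have "r \<in> adjoin n K (x ^ i)" using not_less_Least[of i "\<lambda>j. r \<notin> adjoin n K (x ^ j)"] i by (simp add: j_def)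
  then obtain k r' where r': "r = k + x ^ i * r'" "k \<in> K" "r' \<in> cps n" by (auto simp: adjoin_def)
  have r'L: "r' \<notin> adjoin n K x"
  proof
    assume "r' \<in> adjoin n K x"
    then obtain k' y where y: "r' = k' + x * y" "k' \<in> K" "y \<in> cps n" by (auto simp: adjoin_def)
    have "k + x ^ i * k' \<in> K" using idl_add[OF K] idl_mult[OF K] r' y xc by simp
    then have "(k + x ^ i * k') + x ^ j * y \<in> adjoin n K (x ^ j)" unfolding adjoin_def using y by blast
    then show False using j r' y by (simp add: i algebra_simps)
  qed
  have pow: "z \<in> K" if "z \<in> cps n" "x ^ i * z \<in> K" for z
    using that
  proof (induction i arbitrary: z)
    case (Suc i)
    have "x * (x ^ i * z) \<in> K" using Suc.prems by (simp add: mult.assoc)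
    then have "x ^ i * z \<in> K" using x Suc.prems xc by (simp add: nonzerodivisor_mod_def)
    then show ?case using Suc by blast
  qed simp
  have colon_eq: "colon n K r = colon n K r'"
  proof -
    have "z * r \<in> K \<longleftrightarrow> z * r' \<in> K" if z: "z \<in> cps n" for z
    proof -
      have zr: "z * r = z * k + x ^ i * (z * r')" by (simp add: r' algebra_simps)
      have zk: "z * k \<in> K" using idl_mult[OF K] z r' by blast
      show ?thesis
      proof
        assume "z * r \<in> K"
        then have "z * r - z * k \<in> K" using zk idl_minus[OF K] by blast
        then show "z * r' \<in> K" using zr pow z r' by simp
      next
        assume "z * r' \<in> K"
        then have "x ^ i * (z * r') \<in> K" using xc idl_mult[OF K] by simp
        then show "z * r \<in> K" using zr zk idl_add[OF K] by simp
      qed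
    qed
    then show ?thesis by (auto simp: colon_def)
  qed
  let ?C = "colon n K r'"
  have C: "idl n ?C" by (rule idl_colon[OF K])
  have xC: "nonzerodivisor_mod n ?C x"
    using x r' by (auto simp: nonzerodivisor_mod_def colon_def mult.assoc)
  have sub: "adjoin n ?C x \<subseteq> colon n (adjoin n K x) r'"
  proof (rule adjoin_minimal[OF idl_colon[OF L]])
    show "?C \<subseteq> colon n (adjoin n K x) r'" using adjoin_sub[of K n x] by (auto simp: colon_def)
    show "x \<in> colon n (adjoin n K x) r'" using idl_mult2[OF L r'(3) adjoin_mem[OF K]] xc by (simp add: colon_def)
  qed
  have "1 \<notin> colon n (adjoin n K x) r'" using r'L by (simp add: colon_def)
  then obtain e' where e': "e = Suc e'"
    using growth_le_0_drop[OF C xC] Cons.prems(6) sub by (cases e) (auto simp: colon_eq)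
  then have "growth_le n (adjoin n ?C x) e'" using growth_le_drop[OF C xC] Cons.prems(6) colon_eq by simp
  then have "growth_le n (colon n (adjoin n K x) r') e'" by (rule growth_le_antimono[OF _ sub])
  then have "length xs \<le> e'" using Cons.IH[OF L _ _ r'(3) r'L] Cons.prems by simp
  then show ?case using e' by simp
qed simp

definition prime_idl :: "nat \<Rightarrow> mpser set \<Rightarrow> bool" where
  "prime_idl n Q \<longleftrightarrow> idl n Q \<and> 1 \<notin> Q \<and> (\<forall>a\<in>cps n. \<forall>b\<in>cps n. a * b \<in> Q \<longrightarrow> a \<in> Q \<or> b \<in> Q)"

lemma prime_idlD: "prime_idl n Q \<Longrightarrow> a \<in> cps n \<Longrightarrow> b \<in> cps n \<Longrightarrow> a * b \<in> Q \<Longrightarrow> a \<in> Q \<or> b \<in> Q"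
  by (simp add: prime_idl_def)

lemma prime_idl_is_idl: "prime_idl n Q \<Longrightarrow> idl n Q"
  by (simp add: prime_idl_def)

text \<open>
  The ring is Noetherian: a finite standard basis of the union lies in some member of the chain.
\<close>

lemma idl_chain_Union:
  assumes ch: "subset.chain {K. idl n K} \<C>" and ne: "\<C> \<noteq> {}"
  shows "\<Union>\<C> \<in> \<C>"
proof -
  have id: "idl n C" if "C \<in> \<C>" for C using ch that by (auto simp: subset.chain_def)
  have lin: "C \<subseteq> D \<or> D \<subseteq> C" if "C \<in> \<C>" "D \<in> \<C>" for C D using ch that by (auto simp: subset_chain_def)
  have U: "idl n (\<Union>\<C>)"
    unfolding idl_def
  proof (intro conjI ballI)
    show "\<Union>\<C> \<subseteq> cps n" using id idl_sub by blast
    show "0 \<in> \<Union>\<C>" using id idl_0 ne by blast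
    show "a + b \<in> \<Union>\<C>" if "a \<in> \<Union>\<C>" "b \<in> \<Union>\<C>" for a b
    proof -
      obtain C D where "C \<in> \<C>" "a \<in> C" "D \<in> \<C>" "b \<in> D" using \<open>a \<in> _\<close> \<open>b \<in> _\<close> by blast
      then show ?thesis using lin[of C D] id idl_add by (metis Union_iff subsetD)
    qed
    show "a * b \<in> \<Union>\<C>" if "a \<in> cps n" "b \<in> \<Union>\<C>" for a b using that id idl_mult by blast
  qed
  obtain F :: "exponent set" and c g where F: "finite F" "0 \<le> c" "\<And>a. a \<in> F \<Longrightarrow> g a \<in> \<Union>\<C>"
    "\<And>f. f \<in> cps n \<Longrightarrow> \<exists>q r. (\<forall>a\<in>F. q a \<in> cps n) \<and> r \<in> cps n \<and> f = (\<Sum>a\<in>F. q a * g a) + r \<and>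
        (\<forall>m\<in>leads (\<Union>\<C>). coef r m = 0) \<and> (\<forall>t. ord_ge f t \<longrightarrow> ord_ge r t \<and> (\<forall>a\<in>F. ord_ge (q a) (t - c)))"
    by (rule ideal_division[OF U]) (rule that)
  have "finite (g ` F)" "g ` F \<subseteq> \<Union>\<C>" using F by auto
  then obtain C where C: "C \<in> \<C>" "g ` F \<subseteq> C"
    by (rule finite_subset_Union_chain[OF _ _ ne ch])
  have "\<Union>\<C> \<subseteq> C"
  proof
    fix f assume f: "f \<in> \<Union>\<C>"
    obtain q r where qr: "\<forall>a\<in>F. q a \<in> cps n" "f = (\<Sum>a\<in>F. q a * g a) + r"
      "\<forall>m\<in>leads (\<Union>\<C>). coef r m = 0" using F(4)[OF idl_sub[OF U f]] by blast
    have s: "(\<Sum>a\<in>F. q a * g a) \<in> C"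
      using qr C by (auto intro!: idl_sum[OF id[OF C(1)]] idl_mult[OF id[OF C(1)]])
    then have "f - (\<Sum>a\<in>F. q a * g a) \<in> \<Union>\<C>" using C f idl_minus[OF U] by blast
    then have "r \<in> \<Union>\<C>" using qr(2) by simp
    then have "r = 0" by (rule eq_0_if_off_leads) (use qr in auto)
    then show "f \<in> C" using s qr by simp
  qed
  then have "\<Union>\<C> = C" using C by blast
  then show ?thesis using C by simp
qed

lemma idl_maximal:
  assumes "\<And>K. K \<in> \<S> \<Longrightarrow> idl n K" "\<S> \<noteq> {}"
  obtains M where "M \<in> \<S>" "\<And>K. K \<in> \<S> \<Longrightarrow> M \<subseteq> K \<Longrightarrow> K = M"
proof -
  have "\<exists>M\<in>\<S>. \<forall>K\<in>\<S>. M \<subseteq> K \<longrightarrow> K = M"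
  proof (rule subset_Zorn_nonempty[OF assms(2)])
    fix \<C> assume ne: "\<C> \<noteq> {}" and ch: "subset.chain \<S> \<C>"
    then have "subset.chain {K. idl n K} \<C>" using assms(1) by (auto simp: subset.chain_def)
    then have "\<Union>\<C> \<in> \<C>" using ne by (rule idl_chain_Union)
    then show "\<Union>\<C> \<in> \<S>" using ch by (auto simp: subset.chain_def)
  qed
  then show thesis using that by blast
qed

definition associated_prime :: "nat \<Rightarrow> mpser set \<Rightarrow> mpser set \<Rightarrow> bool" where
  "associated_prime n J Q \<longleftrightarrow> prime_idl n Q \<and> (\<exists>r\<in>cps n. r \<notin> J \<and> Q = colon n J r)"

text \<open>
  A maximal element among the annihilators of nonzero multiples of \<open>c\<close> in \<open>A / J\<close> is prime. It cannot
  contain \<open>c\<close>, since a multiple of \<open>c\<close> with square zero in a reduced ring is zero.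
\<close>

lemma associated_prime_avoiding:
  assumes J: "idl n J" and rad: "\<And>a. a \<in> cps n \<Longrightarrow> a * a \<in> J \<Longrightarrow> a \<in> J"
    and c: "c \<in> cps n" "c \<notin> J"
  obtains Q where "associated_prime n J Q" "c \<notin> Q"
proof -
  let ?S = "{colon n J (c * r) | r. r \<in> cps n \<and> c * r \<notin> J}"
  have ne: "?S \<noteq> {}" using c by (auto intro!: exI[of _ 1])
  obtain Q where Q: "Q \<in> ?S" "\<And>K. K \<in> ?S \<Longrightarrow> Q \<subseteq> K \<Longrightarrow> K = Q"
    by (rule idl_maximal[of ?S n, OF _ ne]) (use idl_colon[OF J] in auto)
  then obtain r where r: "Q = colon n J (c * r)" "r \<in> cps n" "c * r \<notin> J" by blast
  have "a \<in> Q \<or> b \<in> Q" if ab: "a \<in> cps n" "b \<in> cps n" "a * b \<in> Q" for a b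
  proof (rule disjCI)
    assume "b \<notin> Q"
    then have nb: "c * (r * b) \<notin> J" using ab r by (auto simp: colon_def mult_ac)
    have "Q \<subseteq> colon n J (c * (r * b))"
    proof
      fix z assume z: "z \<in> Q"
      then have "b * (z * (c * r)) \<in> J" using r ab idl_mult[OF J] by (auto simp: colon_def)
      then show "z \<in> colon n J (c * (r * b))" using z r by (auto simp: colon_def mult_ac)
    qed
    then have "colon n J (c * (r * b)) = Q" using nb r ab by (intro Q(2)) auto
    moreover have "a \<in> colon n J (c * (r * b))" using ab r by (auto simp: colon_def mult_ac)
    ultimately show "a \<in> Q" by simp
  qed
  moreover have "1 \<notin> Q" using r by (simp add: colon_def)
  ultimately have "prime_idl n Q" using r idl_colon[OF J] by (auto simp: prime_idl_def)
  then have "associated_prime n J Q" unfolding associated_prime_def using r c by auto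
  moreover have "c \<notin> Q"
  proof
    assume "c \<in> Q"
    then have "c * (c * r) \<in> J" using r by (simp add: colon_def)
    then have "r * (c * (c * r)) \<in> J" using r idl_mult[OF J] by blast
    then have "(c * r) * (c * r) \<in> J" by (simp add: mult_ac)
    then show False using rad[of "c * r"] c r by simp
  qed
  ultimately show thesis by (rule that)
qed

text \<open>
  The series killed by \<open>g\<close> in the localisation of \<open>A / I\<close> at \<open>Q\<close> form an ideal \<open>K\<close>. If the conclusion
  fails, then \<open>I \<subseteq> K \<subseteq> Q\<close>, and \<open>g \<in> Q\<close> is a nonzerodivisor modulo \<open>K\<close> because \<open>I\<close> is radical. So the
  dimension of \<open>A / Q\<close> would be smaller than that of \<open>A / K\<close>, hence smaller than \<open>d\<close>.
\<close>

lemma locally_equal: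
  assumes I: "idl n I" and rad: "\<And>a. a \<in> cps n \<Longrightarrow> a * a \<in> I \<Longrightarrow> a \<in> I"
    and uI: "growth_le n I d" and Q: "prime_idl n Q" and IQ: "I \<subseteq> Q" and lower: "\<And>e. growth_le n Q e \<Longrightarrow> d \<le> e"
    and g: "g \<in> Q"
  shows "\<exists>s\<in>cps n. s \<notin> Q \<and> s * g \<in> I"
proof (rule ccontr)
  assume neg: "\<not> ?thesis"
  have Qi: "idl n Q" by (rule prime_idl_is_idl[OF Q])
  have gc: "g \<in> cps n" using idl_sub[OF Qi g] .
  have no: "s \<in> Q" if "s \<in> cps n" "s * g \<in> I" for s using neg that by blast
  \<comment> \<open>the kernel of multiplication by \<open>g\<close> in the localisation of \<open>A / I\<close> at \<open>Q\<close>\<close>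
  define K where "K = {z \<in> cps n. \<exists>s\<in>cps n. s \<notin> Q \<and> s * g * z \<in> I}"
  have mQ: "s * s' \<notin> Q" if "s \<in> cps n" "s' \<in> cps n" "s \<notin> Q" "s' \<notin> Q" for s s'
    using prime_idlD[OF Q] that by blast
  have K: "idl n K"
    unfolding idl_def
  proof (intro conjI ballI)
    show "K \<subseteq> cps n" by (auto simp: K_def)
    show "0 \<in> K" using Q idl_0[OF I] by (auto simp: K_def prime_idl_def intro!: bexI[of _ 1])
    show "a + b \<in> K" if "a \<in> K" "b \<in> K" for a b
    proof -
      obtain s s' where s: "s \<in> cps n" "s \<notin> Q" "s * g * a \<in> I" "s' \<in> cps n" "s' \<notin> Q" "s' * g * b \<in> I" "a \<in> cps n" "b \<in> cps n"
        using \<open>a \<in> K\<close> \<open>b \<in> K\<close> by (auto simp: K_def)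
      have "s' * (s * g * a) + s * (s' * g * b) \<in> I" using s idl_mult[OF I] idl_add[OF I] by blast
      then have "(s * s') * g * (a + b) \<in> I" by (simp add: algebra_simps)
      then show ?thesis unfolding K_def using s mQ[of s s'] cps_add cps_mult by blast
    qed
    show "a * b \<in> K" if "a \<in> cps n" "b \<in> K" for a b
    proof -
      obtain s where s: "s \<in> cps n" "s \<notin> Q" "s * g * b \<in> I" "b \<in> cps n" using \<open>b \<in> K\<close> by (auto simp: K_def)
      then have "a * (s * g * b) \<in> I" using idl_mult[OF I] that by blast
      then have "s * g * (a * b) \<in> I" by (simp add: mult_ac)
      then show ?thesis unfolding K_def using s that by auto
    qed
  qed
  have IK: "I \<subseteq> K"
  proof
    fix z assume z: "z \<in> I"
    then have "1 * g * z \<in> I" using idl_mult[OF I gc] by simp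
    then show "z \<in> K" unfolding K_def using z idl_sub[OF I] Q by (auto simp: prime_idl_def intro!: bexI[of _ 1])
  qed
  have KQ: "K \<subseteq> Q"
  proof
    fix z assume "z \<in> K"
    then obtain s where s: "s \<in> cps n" "s \<notin> Q" "s * g * z \<in> I" "z \<in> cps n" by (auto simp: K_def)
    then have "s * z \<in> Q" by (intro no) (auto simp: mult_ac)
    then show "z \<in> Q" using prime_idlD[OF Q, of s z] s by blast
  qed
  have gK: "nonzerodivisor_mod n K g"
    unfolding nonzerodivisor_mod_def
  proof (intro conjI ballI impI)
    fix z assume z: "z \<in> cps n" "g * z \<in> K"
    then obtain s where s: "s \<in> cps n" "s \<notin> Q" "s * g * (g * z) \<in> I" unfolding K_def by blast
    have "(s * z) * (s * g * (g * z)) \<in> I" by (rule idl_mult[OF I]) (use s z in simp_all)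
    then have "(s * g * z) * (s * g * z) \<in> I" by (simp add: mult_ac)
    moreover have "s * g * z \<in> cps n" using s z gc by simp
    ultimately have "s * g * z \<in> I" using rad by blast
    then show "z \<in> K" unfolding K_def using s z by blast
  qed (rule gc)
  have sub: "adjoin n K g \<subseteq> Q" by (rule adjoin_minimal[OF Qi KQ g])
  have uK: "growth_le n K d" by (rule growth_le_antimono[OF uI IK])
  have one: "1 \<notin> adjoin n K g" using sub Q by (auto simp: prime_idl_def)
  obtain d' where d': "d = Suc d'" using growth_le_0_drop[OF K gK] uK one by (cases d) auto
  then have "growth_le n (adjoin n K g) d'" using growth_le_drop[OF K gK] uK by simp
  then have "d \<le> d'" using lower growth_le_antimono[OF _ sub] by blast
  then show False using d' by simp
qed

section \<open>Vector fields tangent to a prime\<close>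

definition deriv :: "nat \<Rightarrow> (nat \<Rightarrow> mpser) \<Rightarrow> mpser \<Rightarrow> mpser" where
  "deriv n v f = (\<Sum>i<n. v i * pd i f)"

lemma deriv_add: "deriv n v (f + g) = deriv n v f + deriv n v g"
  by (simp add: deriv_def pd_add distrib_left sum.distrib)

lemma deriv_mult: "deriv n v (f * g) = deriv n v f * g + f * deriv n v g"
  by (simp add: deriv_def pd_mult distrib_left sum.distrib sum_distrib_left sum_distrib_right mult_ac)

lemma deriv_scale: "deriv n v (scale_mpser c f) = scale_mpser c (deriv n v f)"
  by (simp add: deriv_def pd_scale scale_eq_mult[of c "pd _ _"] scale_eq_mult[of c "sum _ _"] sum_distrib_left mult_ac)

lemma deriv_uminus: "deriv n v (- f) = - deriv n v f"
  unfolding uminus_eq_scale by (rule deriv_scale)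

lemma deriv_diff: "deriv n v (f - g) = deriv n v f - deriv n v g"
  using deriv_add[of n v f "- g"] by (simp add: deriv_uminus)

lemma deriv_cps: "(\<And>i. i < n \<Longrightarrow> v i \<in> cps n) \<Longrightarrow> f \<in> cps n \<Longrightarrow> deriv n v f \<in> cps n"
  unfolding deriv_def by (intro cps_sum) auto

lemma deriv_coord: "i < n \<Longrightarrow> deriv n v (coord i) = v i"
  by (simp add: deriv_def pd_coord if_distrib[of "(*) _"] sum.delta cong: if_cong)

lemma deriv_power: "deriv n v (f ^ k) * f = of_nat k * f ^ k * deriv n v f"
proof (induction k)
  case 0
  have "deriv n v (1 * 1) = deriv n v 1 * 1 + 1 * deriv n v 1" by (rule deriv_mult)
  then show ?case by simp
next
  case (Suc k)
  have "deriv n v (f ^ Suc k) * f = deriv n v f * f ^ Suc k + f * (deriv n v (f ^ k) * f)"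
    by (simp add: deriv_mult algebra_simps)
  then show ?case using Suc by (simp add: algebra_simps)
qed

lemma ord_ge_deriv:
  assumes "ord_ge f t" shows "ord_ge (deriv n v f) (t - ln (real (nth_prime n)))"
  unfolding deriv_def
proof (rule ord_ge_sum, rule ord_ge_mult1)
  fix i assume "i \<in> {..<n}"
  then have "ln (real (nth_prime i)) \<le> ln (real (nth_prime n))"
    using nth_prime_less[of i n] nth_prime_ge_2[of i] by (subst ln_le_cancel_iff) auto
  then show "ord_ge (pd i f) (t - ln (real (nth_prime n)))"
    using ord_ge_mono[OF ord_ge_pd[OF assms, of i]] by simp
qed

lemma near_deriv:
  assumes v: "\<And>f. f \<in> Q \<Longrightarrow> deriv n v f \<in> Q" and "near Q f t"
  shows "near Q (deriv n v f) (t - ln (real (nth_prime n)))"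
proof -
  obtain k where k: "k \<in> Q" "ord_ge (f - k) t" using assms by (auto simp: near_def)
  have "ord_ge (deriv n v f - deriv n v k) (t - ln (real (nth_prime n)))"
    using ord_ge_deriv[OF k(2)] by (simp add: deriv_diff)
  then show ?thesis unfolding near_def using v[OF k(1)] by blast
qed

text \<open>
  On a polynomial \<open>G\<close> in the variables of \<open>M\<close> the field \<open>v m\<close> acts as \<open>\<mu>\<close> times the partial derivative by
  \<open>m\<close>. If \<open>\<mu>\<^sup>a G\<close> is in \<open>Q + F\<^sub>t\<close>, applying \<open>v m\<close> and multiplying by \<open>\<mu>\<close> shows that \<open>\<mu>\<^bsup>a+2\<^esup> \<partial>\<^sub>m G\<close> is in
  \<open>Q + F\<^sub>t\<^sub>'\<close>, where \<open>t'\<close> is smaller than \<open>t\<close> by a constant. After at most \<open>N\<close> steps a nonzero constant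
  is left of \<open>G\<close>.
\<close>

lemma tangent_iteration:
  assumes Q: "idl n Q" and M: "M \<subseteq> {..<n}" and \<mu>: "\<mu> \<in> cps n"
    and v: "\<And>m i. m \<in> M \<Longrightarrow> i < n \<Longrightarrow> v m i \<in> cps n"
    and tang: "\<And>m f. m \<in> M \<Longrightarrow> f \<in> Q \<Longrightarrow> deriv n (v m) f \<in> Q"
    and diag: "\<And>m m'. m \<in> M \<Longrightarrow> m' \<in> M \<Longrightarrow> v m m' = (if m = m' then \<mu> else 0)"
    and G: "G \<in> cps n" "G \<noteq> 0" "\<And>m. coef G m \<noteq> 0 \<Longrightarrow> vars m \<subseteq> M \<and> monom_deg m \<le> N"
    and near: "near Q (\<mu> ^ a * G) t"
  shows "near Q (\<mu> ^ (a + 2 * N)) (t - real N * ln (real (nth_prime n)))"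
  using G near
proof (induction N arbitrary: G a t)
  case 0
  have m0: "m = 0" if "coef G m \<noteq> 0" for m
  proof -
    have "monom_deg m = 0" using 0(3)[OF that] by simp
    then show ?thesis by (auto simp: monom_deg_def in_keys_iff intro!: poly_mapping_eqI)
  qed
  have "coef G 0 \<noteq> 0" using ex_lead[OF 0(2)] m0 by (metis is_lead_def)
  then have "scale_mpser (1 / coef G 0) G = 1"
    using m0 by (intro mpser_eqI) (auto simp: coef_simps)
  moreover have "near Q (scale_mpser (1 / coef G 0) 1 * (\<mu> ^ a * G)) t"
    by (rule near_mult[OF Q 0(4)]) simp
  moreover have "scale_mpser (1 / coef G 0) 1 * (\<mu> ^ a * G) = \<mu> ^ a * scale_mpser (1 / coef G 0) G"
    by (subst (2) scale_eq_mult) (simp add: mult_ac)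
  ultimately show ?case by simp
next
  case (Suc N)
  have Qm: "near Q (\<mu> ^ a * f) t'" if "near Q f t'" for f t' a using near_mult[OF Q that] \<mu> by simp
  have lp: "0 \<le> ln (real (nth_prime n))" using nth_prime_ge_2[of n] by simp
  show ?case
  proof (cases "\<exists>m. coef G m \<noteq> 0 \<and> m \<noteq> 0")
    case True
    then obtain m where m: "coef G m \<noteq> 0" "m \<noteq> 0" by blast
    then have "vars m \<noteq> {}" by simp
    then obtain i where i: "i \<in> vars m" by blast
    then have iM: "i \<in> M" using Suc.prems(3)[OF m(1)] by blast
    let ?e = "Poly_Mapping.single i (1 :: nat)"
    let ?D = "deriv n (v i)"
    have DG: "?D G = \<mu> * pd i G"
    proof -
      have "v i j * pd j G = (if j = i then \<mu> * pd i G else 0)" if "j < n" for j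
      proof (cases "j \<in> M")
        case True then show ?thesis using diag[OF iM True] by auto
      next
        case False
        have "coef (pd j G) m' = 0" for m'
          using Suc.prems(3)[of "m' + Poly_Mapping.single j 1"] False by (auto simp: coef_pd keys_add_nat)
        then have "pd j G = 0" by (intro mpser_eqI) (simp add: coef_simps)
        then show ?thesis using False iM by auto
      qed
      then have "?D G = (\<Sum>j<n. if j = i then \<mu> * pd i G else 0)" unfolding deriv_def by (intro sum.cong) auto
      then show ?thesis using iM M by auto
    qed
    have "near Q (?D (\<mu> ^ a * G)) (t - ln (real (nth_prime n)))"
      by (rule near_deriv[OF tang[OF iM] Suc.prems(4)])
    then have 1: "near Q (\<mu> * ?D (\<mu> ^ a * G)) (t - ln (real (nth_prime n)))"
      using near_mult[OF Q _ \<mu>] by blast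
    have "near Q (\<mu> ^ a * G) (t - ln (real (nth_prime n)))" using near_mono[OF Suc.prems(4)] lp by simp
    moreover have "of_nat k \<in> cps n" for k by (induction k) auto
    ultimately have 2: "near Q ((of_nat a * ?D \<mu>) * (\<mu> ^ a * G)) (t - ln (real (nth_prime n)))"
      using \<mu> v[OF iM] by (intro near_mult[OF Q, of "\<mu> ^ a * G"] cps_mult deriv_cps) auto
    have "\<mu> * ?D (\<mu> ^ a * G) = \<mu> ^ (a + 2) * pd i G + (?D (\<mu> ^ a) * \<mu>) * G"
      by (simp add: deriv_mult DG power2_eq_square power_add algebra_simps)
    also have "\<dots> = \<mu> ^ (a + 2) * pd i G + (of_nat a * ?D \<mu>) * (\<mu> ^ a * G)"
      unfolding deriv_power by (simp add: mult_ac)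
    finally have "\<mu> ^ (a + 2) * pd i G = \<mu> * ?D (\<mu> ^ a * G) - (of_nat a * ?D \<mu>) * (\<mu> ^ a * G)" by simp
    then have n3: "near Q (\<mu> ^ (a + 2) * pd i G) (t - ln (real (nth_prime n)))" using near_diff[OF Q 1 2] by simp
    have "coef (pd i G) (m - ?e) \<noteq> 0"
    proof -
      have "m - ?e + ?e = m"
        by (rule poly_mapping_eqI) (use i in \<open>auto simp: lookup_add lookup_minus lookup_single when_def in_keys_iff\<close>)
      then show ?thesis using m by (simp add: coef_pd del: of_nat_add of_nat_Suc)
    qed
    then have ne: "pd i G \<noteq> 0" by (auto simp: coef_simps)
    have supp: "vars m' \<subseteq> M \<and> monom_deg m' \<le> N" if "coef (pd i G) m' \<noteq> 0" for m'
    proof -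
      have "coef G (m' + ?e) \<noteq> 0" using that by (auto simp: coef_pd)
      then have *: "vars (m' + ?e) \<subseteq> M" "monom_deg (m' + ?e) \<le> Suc N" using Suc.prems(3) by blast+
      have "monom_deg (m' + ?e) = Suc (monom_deg m')"
      proof -
        let ?S = "insert i (vars m')"
        have "monom_deg (m' + ?e) = (\<Sum>j\<in>?S. expo m' j + expo ?e j)"
          unfolding monom_deg_def by (rule sum.mono_neutral_cong_left) (auto simp: keys_add_nat lookup_add in_keys_iff)
        also have "\<dots> = (\<Sum>j\<in>?S. expo m' j) + (\<Sum>j\<in>?S. expo ?e j)" by (rule sum.distrib)
        also have "(\<Sum>j\<in>?S. expo m' j) = monom_deg m'"
          unfolding monom_deg_def by (rule sum.mono_neutral_right) (auto simp: in_keys_iff)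
        also have "(\<Sum>j\<in>?S. expo ?e j) = (\<Sum>j\<in>{i}. 1)"
          by (rule sum.mono_neutral_cong_right) (auto simp: lookup_single when_def)
        finally show ?thesis by simp
      qed
      then show ?thesis using * by (auto simp: keys_add_nat)
    qed
    have "near Q (\<mu> ^ (a + 2 + 2 * N)) (t - ln (real (nth_prime n)) - real N * ln (real (nth_prime n)))"
      by (rule Suc.IH[OF cps_pd[OF Suc.prems(1)] ne supp n3])
    then show ?thesis by (simp add: algebra_simps)
  next
    case False
    then have supp: "vars m \<subseteq> M \<and> monom_deg m \<le> N" if "coef G m \<noteq> 0" for m
      using that by (auto simp: monom_deg_def)
    have "near Q (\<mu> ^ (a + 2 * N)) (t - real N * ln (real (nth_prime n)))"
      by (rule Suc.IH[OF Suc.prems(1,2) supp Suc.prems(4)])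
    then have "near Q (\<mu> ^ 2 * \<mu> ^ (a + 2 * N)) (t - real N * ln (real (nth_prime n)))" by (rule Qm)
    then have "near Q (\<mu> ^ (a + 2 * Suc N)) (t - real N * ln (real (nth_prime n)))" by (simp add: power2_eq_square mult_ac)
    then show ?thesis by (rule near_mono) (use lp in \<open>simp add: algebra_simps\<close>)
  qed
qed

text \<open>
  Bounding the dimension of \<open>A / Q\<close> from below by counting. There are \<open>(u + 1)\<^bsup>card M\<^esup>\<close> monomials in the
  variables of \<open>M\<close> with exponents up to \<open>u\<close>. If this exceeds the Hilbert function at \<open>t\<close>, some nonzero
  combination \<open>G\<close> of them lies in \<open>Q + F\<^sub>t\<close>, and then so does a power of \<open>\<mu>\<close> with exponent linear in \<open>u\<close>,
  up to a loss in \<open>t\<close> linear in \<open>u\<close>. By the Artin--Rees property for \<open>\<mu>\<close>, this forces \<open>t\<close> to be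
  bounded by a multiple of \<open>u\<close>. So the Hilbert function just above that multiple of \<open>u\<close> is at least
  \<open>(u + 1)\<^bsup>card M\<^esup>\<close>.
\<close>

lemma tangent_dimension:
  assumes Q: "prime_idl n Q" and M: "M \<subseteq> {..<n}" and \<mu>: "\<mu> \<in> cps n" "\<mu> \<notin> Q"
    and v: "\<And>m i. m \<in> M \<Longrightarrow> i < n \<Longrightarrow> v m i \<in> cps n"
    and tang: "\<And>m f. m \<in> M \<Longrightarrow> f \<in> Q \<Longrightarrow> deriv n (v m) f \<in> Q"
    and diag: "\<And>m m'. m \<in> M \<Longrightarrow> m' \<in> M \<Longrightarrow> v m m' = (if m = m' then \<mu> else 0)"
    and u: "growth_le n Q d"
  shows "card M \<le> d"
proof (rule ccontr)
  assume neg: "\<not> card M \<le> d"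
  have Qi: "idl n Q" by (rule prime_idl_is_idl[OF Q])
  have one: "1 \<notin> Q" using Q by (simp add: prime_idl_def)
  have fM: "finite M" using M finite_subset by blast
  have "nonzerodivisor_mod n Q \<mu>" unfolding nonzerodivisor_mod_def using \<mu> prime_idlD[OF Q] by blast
  then obtain c where c: "0 \<le> c" "\<And>z t. z \<in> cps n \<Longrightarrow> near Q (\<mu> * z) t \<Longrightarrow> near Q z (t - c)"
    using artin_rees_colon[OF Qi] by blast
  have pow: "t \<le> real k * c" if "near Q (\<mu> ^ k) t" for k t
    using that
  proof (induction k arbitrary: t)
    case 0 then show ?case using not_near_1[OF Qi one] by simp
  next
    case (Suc k)
    then have "near Q (\<mu> ^ k) (t - c)" using c(2)[of "\<mu> ^ k" t] \<mu> by simp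
    then have "t - c \<le> real k * c" by (rule Suc.IH)
    then show ?case by (simp add: algebra_simps)
  qed
  define p where "p = ln (real (nth_prime n))"
  have p: "0 \<le> p" using nth_prime_ge_2[of n] by (simp add: p_def)
  have bound: "t \<le> real N * (p + 2 * c)"
    if "G \<in> cps n" "G \<noteq> 0" "\<And>m. coef G m \<noteq> 0 \<Longrightarrow> vars m \<subseteq> M \<and> monom_deg m \<le> N" "near Q G t" for G N t
  proof -
    have "near Q (\<mu> ^ (0 + 2 * N)) (t - real N * p)" unfolding p_def
      by (rule tangent_iteration[OF Qi M \<mu>(1) v tang diag that(1-3)]) (use that(4) in auto)
    from pow[OF this] show ?thesis by (simp add: algebra_simps)
  qed
  obtain C where C: "\<And>t. t \<ge> 0 \<Longrightarrow> real (hilbert n Q t) \<le> C * (t + 1) ^ d" using u by (auto simp: growth_le_def)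
  have C0: "0 \<le> C" using C[of 0] by simp
  \<comment> \<open>chosen so that the value of \<open>t\<close> below satisfies \<open>t + 1 \<le> \<Lambda> (u + 1)\<close>\<close>
  define \<Lambda> where "\<Lambda> = real (card M) * (p + 2 * c) + 2"
  have \<Lambda>: "2 \<le> \<Lambda>" using p c by (simp add: \<Lambda>_def)
  have key: "real (Suc u) ^ card M \<le> C * (\<Lambda> * real (Suc u)) ^ d" for u :: nat
  proof -
    define N where "N = card M * u"
    \<comment> \<open>just above the bound, so that no nonzero \<open>G\<close> of degree \<open>N\<close> is in \<open>Q + F\<^sub>t\<close>\<close>
    define t where "t = real N * (p + 2 * c) + 1"
    have t0: "t \<ge> 0" using p c by (simp add: t_def)
    let ?P = "PiE M (\<lambda>_. {..u})"
    define mk where "mk h = Abs_poly_mapping (\<lambda>i. if i \<in> M then h i else 0)" for h :: "nat \<Rightarrow> nat"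
    have lk: "expo (mk h) i = (if i \<in> M then h i else 0)" for h i
      unfolding mk_def by (subst lookup_Abs_poly_mapping) (auto intro: finite_subset[OF _ fM])
    have inj: "inj_on mk ?P"
    proof (rule inj_onI)
      fix h h' assume h: "h \<in> ?P" "h' \<in> ?P" "mk h = mk h'"
      show "h = h'"
      proof (rule PiE_ext[OF h(1,2)])
        fix i assume "i \<in> M" then show "h i = h' i" using lk[of h i] lk[of h' i] h(3) by simp
      qed
    qed
    let ?B = "mk ` ?P"
    have cB: "card ?B = Suc u ^ card M" using inj fM by (simp add: card_image card_PiE)
    have fB: "finite ?B" by (intro finite_imageI finite_PiE fM) auto
    have B: "vars m \<subseteq> M \<and> monom_deg m \<le> N" if mB: "m \<in> ?B" for m
    proof -
      obtain h where h: "h \<in> ?P" "m = mk h" using mB by (rule imageE)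
      have k: "vars m \<subseteq> M" by (auto simp: in_keys_iff lk h split: if_splits)
      have "monom_deg m \<le> of_nat (card (vars m)) * u" unfolding monom_deg_def
        by (rule sum_bounded_above) (use h in \<open>auto simp: lk PiE_iff\<close>)
      also have "\<dots> \<le> N" unfolding N_def using card_mono[OF fM k] by simp
      finally show ?thesis using k by simp
    qed
    let ?E = "standard_monomials n Q t"
    have "card ?B \<le> card ?E"
    proof (rule ccontr)
      assume "\<not> ?thesis"
      then obtain l where l: "\<exists>b\<in>?B. l b \<noteq> 0" "\<And>e. e \<in> ?E \<Longrightarrow> (\<Sum>b\<in>?B. coef (normal_form n Q (monomial b)) e * l b) = 0"
        using underdetermined[OF finite_standard_monomials fB, of n Q t "\<lambda>e b. coef (normal_form n Q (monomial b)) e"] by auto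
      define G where "G = (\<Sum>b\<in>?B. scale_mpser (l b) (monomial b))"
      have bc: "monomial b \<in> cps n" if "b \<in> ?B" for b using B[OF that] M by (intro cps_monomial) auto
      have Gc: "G \<in> cps n" unfolding G_def using bc by (intro cps_sum) auto
      have coefG: "coef G m = (if m \<in> ?B then l m else 0)" for m
        using fB by (simp add: G_def coef_sum coef_monomial if_distrib[of "(*) _"] sum.delta' cong: if_cong)
      have "G \<noteq> 0" using l(1) coefG by (metis coef_simps(1))
      have nfG: "normal_form n Q G = (\<Sum>b\<in>?B. scale_mpser (l b) (normal_form n Q (monomial b)))"
        unfolding G_def using bc by (simp add: normal_form_sum[OF Qi] normal_form_scale[OF Qi])
      have "ord_ge (normal_form n Q G) t" unfolding ord_ge_def
      proof (intro allI impI, rule ccontr)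
        fix m assume m: "coef (normal_form n Q G) m \<noteq> 0" "\<not> t \<le> lweight m"
        then have "m \<in> ?E" using normal_form_leads[OF Qi Gc, of m] cps_keys[OF normal_form_cps[OF Qi Gc], of m] by (auto simp: standard_monomials_def)
        then have "coef (normal_form n Q G) m = 0" using l(2)[of m] unfolding nfG by (simp add: coef_sum mult.commute)
        then show False using m by simp
      qed
      then have "near Q G t" using near_iff_normal_form[OF Qi Gc] by simp
      then have "t \<le> real N * (p + 2 * c)"
        by (intro bound[OF Gc \<open>G \<noteq> 0\<close>]) (use coefG B in \<open>auto split: if_splits\<close>)
      then show False by (simp add: t_def)
    qed
    then have "real (Suc u ^ card M) \<le> real (hilbert n Q t)" by (simp add: cB hilbert_def del: of_nat_power of_nat_Suc power_Suc)
    also have "\<dots> \<le> C * (t + 1) ^ d" by (rule C[OF t0])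
    also have "\<dots> \<le> C * (\<Lambda> * real (Suc u)) ^ d"
      using C0 t0 p c by (intro mult_left_mono power_mono) (auto simp: t_def N_def \<Lambda>_def algebra_simps)
    finally show ?thesis by simp
  qed
  obtain u :: nat where u: "real u > C * \<Lambda> ^ d" using reals_Archimedean2 by blast
  have "real (Suc u) * real (Suc u) ^ d \<le> real (Suc u) ^ card M"
    using neg by (subst power_Suc[symmetric], intro power_increasing) auto
  also have "\<dots> \<le> (C * \<Lambda> ^ d) * real (Suc u) ^ d" using key[of u] by (simp add: power_mult_distrib)
  finally have "real (Suc u) \<le> C * \<Lambda> ^ d"
    by (simp add: mult_le_cancel_right del: of_nat_Suc)
  then show False using u by simp
qed

section \<open>Exterior algebra\<close>

lemma finite_inversions: "finite J \<Longrightarrow> finite L \<Longrightarrow> finite {(j, l). j \<in> J \<and> l \<in> L \<and> l < (j :: nat)}"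
  by (rule finite_subset[of _ "J \<times> L"]) auto

lemma shuffle_sign_Un_left:
  assumes "finite J" "finite J'" "finite L" "J \<inter> J' = {}"
  shows "shuffle_sign (J \<union> J') L = shuffle_sign J L * shuffle_sign J' L"
proof -
  have "{(j, l). j \<in> J \<union> J' \<and> l \<in> L \<and> l < j} = {(j, l). j \<in> J \<and> l \<in> L \<and> l < j} \<union> {(j, l). j \<in> J' \<and> l \<in> L \<and> l < j}"
    by auto
  then have "card {(j, l). j \<in> J \<union> J' \<and> l \<in> L \<and> l < j} = card {(j, l). j \<in> J \<and> l \<in> L \<and> l < j} + card {(j, l). j \<in> J' \<and> l \<in> L \<and> l < j}"
    using assms finite_inversions by (simp, subst card_Un_disjoint) auto
  then show ?thesis by (simp add: shuffle_sign_def power_add)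
qed

lemma shuffle_sign_Un_right:
  assumes "finite J" "finite L" "finite L'" "L \<inter> L' = {}"
  shows "shuffle_sign J (L \<union> L') = shuffle_sign J L * shuffle_sign J L'"
proof -
  have "{(j, l). j \<in> J \<and> l \<in> L \<union> L' \<and> l < j} = {(j, l). j \<in> J \<and> l \<in> L \<and> l < j} \<union> {(j, l). j \<in> J \<and> l \<in> L' \<and> l < j}"
    by auto
  then have "card {(j, l). j \<in> J \<and> l \<in> L \<union> L' \<and> l < j} = card {(j, l). j \<in> J \<and> l \<in> L \<and> l < j} + card {(j, l). j \<in> J \<and> l \<in> L' \<and> l < j}"
    using assms finite_inversions by (simp, subst card_Un_disjoint) auto
  then show ?thesis by (simp add: shuffle_sign_def power_add)
qed

lemma shuffle_sign_empty [simp]: "shuffle_sign {} L = 1" "shuffle_sign J {} = 1"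
  by (auto simp: shuffle_sign_def)

lemma shuffle_sign_square [simp]: "shuffle_sign J L * shuffle_sign J L = 1"
  by (simp add: shuffle_sign_def flip: power_mult_distrib)

lemma shuffle_sign_square' [simp]: "shuffle_sign J L * (shuffle_sign J L * f) = f"
  by (simp flip: mult.assoc)

lemma shuffle_sign_pm1: "shuffle_sign J L = 1 \<or> shuffle_sign J L = - 1"
  by (simp add: shuffle_sign_def minus_one_power_iff)

lemma shuffle_sign_cps [simp]: "shuffle_sign J L \<in> cps n"
  by (simp add: shuffle_sign_def)

lemma shuffle_sign_swap:
  assumes "finite J" "finite L" "J \<inter> L = {}"
  shows "shuffle_sign J L * shuffle_sign L J = (- 1) ^ (card J * card L)"
proof -
  let ?P = "{(j, l). j \<in> J \<and> l \<in> L \<and> l < j}" and ?R = "{(l, j). l \<in> L \<and> j \<in> J \<and> j < l}"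
  have "J \<times> L = ?P \<union> prod.swap ` ?R"
  proof (intro equalityI subsetI)
    fix x assume x: "x \<in> J \<times> L"
    then obtain j l where jl: "x = (j, l)" "j \<in> J" "l \<in> L" by auto
    then have "j \<noteq> l" using assms by auto
    then consider "l < j" | "j < l" by linarith
    then show "x \<in> ?P \<union> prod.swap ` ?R" by cases (use jl in \<open>force+\<close>)
  qed auto
  then have "card (J \<times> L) = card ?P + card (prod.swap ` ?R)"
    using assms by (simp only:, intro card_Un_disjoint) (auto intro: finite_inversions)
  also have "card (prod.swap ` ?R) = card ?R" by (rule card_image) auto
  finally show ?thesis by (simp add: shuffle_sign_def power_add card_cartesian_product)
qed

lemma wedge_infinite: "infinite K \<Longrightarrow> wedge \<alpha> \<beta> K = 0"
  by (simp add: wedge_def)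

text \<open>
  Both sides are sums over the ways to split \<open>K\<close> into three parts; the signs agree because the number
  of inversions is additive in each argument.
\<close>

lemma wedge_assoc: "wedge (wedge \<alpha> \<beta>) \<gamma> = wedge \<alpha> (wedge \<beta> \<gamma>)"
proof
  fix K show "wedge (wedge \<alpha> \<beta>) \<gamma> K = wedge \<alpha> (wedge \<beta> \<gamma>) K"
  proof (cases "finite K")
    case K: True
    have fin: "finite J" if "J \<subseteq> K" for J using that K finite_subset by blast
    have "wedge (wedge \<alpha> \<beta>) \<gamma> K = (\<Sum>M\<in>Pow K. \<Sum>J\<in>Pow M. shuffle_sign M (K - M) * shuffle_sign J (M - J) * \<alpha> J * \<beta> (M - J) * \<gamma> (K - M))"
      by (simp add: wedge_def sum_distrib_left sum_distrib_right mult_ac)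
    also have "\<dots> = (\<Sum>(M, J)\<in>Sigma (Pow K) Pow. shuffle_sign M (K - M) * shuffle_sign J (M - J) * \<alpha> J * \<beta> (M - J) * \<gamma> (K - M))"
      by (rule sum.Sigma) (use K fin in auto)
    also have "\<dots> = (\<Sum>(J, L)\<in>Sigma (Pow K) (\<lambda>J. Pow (K - J)). shuffle_sign J (K - J) * shuffle_sign L (K - J - L) * \<alpha> J * \<beta> L * \<gamma> (K - J - L))"
    proof (rule sum.reindex_bij_witness[where i = "\<lambda>(J, L). (J \<union> L, J)" and j = "\<lambda>(M, J). (J, M - J)"])
      fix p assume "p \<in> Sigma (Pow K) Pow"
      then obtain M J where p: "p = (M, J)" "M \<subseteq> K" "J \<subseteq> M" by auto
      define L N where "L = M - J" and "N = K - M"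
      have eq: "M = J \<union> L" "K - J = L \<union> N" "J \<inter> L = {}" "L \<inter> N = {}" "K - J - L = N"
        using p by (auto simp: L_def N_def)
      have f: "finite J" "finite L" "finite N" using p by (auto simp: L_def N_def intro!: fin)
      have "shuffle_sign M N * shuffle_sign J L = shuffle_sign J (K - J) * shuffle_sign L N"
        unfolding eq(1,2) using f eq by (simp add: shuffle_sign_Un_left shuffle_sign_Un_right mult_ac)
      then show "(case (case p of (M, J) \<Rightarrow> (J, M - J)) of (J, L) \<Rightarrow> shuffle_sign J (K - J) * shuffle_sign L (K - J - L) * \<alpha> J * \<beta> L * \<gamma> (K - J - L))
         = (case p of (M, J) \<Rightarrow> shuffle_sign M (K - M) * shuffle_sign J (M - J) * \<alpha> J * \<beta> (M - J) * \<gamma> (K - M))"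
        unfolding p(1) split L_def[symmetric] N_def[symmetric] eq(5) by simp
    qed auto
    also have "\<dots> = (\<Sum>J\<in>Pow K. \<Sum>L\<in>Pow (K - J). shuffle_sign J (K - J) * shuffle_sign L (K - J - L) * \<alpha> J * \<beta> L * \<gamma> (K - J - L))"
      by (rule sum.Sigma[symmetric]) (use K in auto)
    also have "\<dots> = wedge \<alpha> (wedge \<beta> \<gamma>) K"
      by (simp add: wedge_def sum_distrib_left sum_distrib_right mult_ac)
    finally show ?thesis .
  qed (simp add: wedge_infinite)
qed

lemma wedge_cong: "(\<And>J. J \<subseteq> K \<Longrightarrow> \<alpha> J = \<alpha>' J) \<Longrightarrow> (\<And>J. J \<subseteq> K \<Longrightarrow> \<beta> J = \<beta>' J) \<Longrightarrow> wedge \<alpha> \<beta> K = wedge \<alpha>' \<beta>' K"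
  unfolding wedge_def by (intro sum.cong) auto

lemma wedge_add_left: "wedge (\<lambda>J. \<alpha> J + \<alpha>' J) \<beta> K = wedge \<alpha> \<beta> K + wedge \<alpha>' \<beta> K"
  by (simp add: wedge_def distrib_left distrib_right sum.distrib)

lemma wedge_add_right: "wedge \<alpha> (\<lambda>J. \<beta> J + \<beta>' J) K = wedge \<alpha> \<beta> K + wedge \<alpha> \<beta>' K"
  by (simp add: wedge_def distrib_left distrib_right sum.distrib)

lemma wedge_diff_left: "wedge (\<lambda>J. \<alpha> J - \<alpha>' J) \<beta> K = wedge \<alpha> \<beta> K - wedge \<alpha>' \<beta> K"
  by (simp add: wedge_def left_diff_distrib right_diff_distrib sum_subtractf)

lemma wedge_diff_right: "wedge \<alpha> (\<lambda>J. \<beta> J - \<beta>' J) K = wedge \<alpha> \<beta> K - wedge \<alpha> \<beta>' K"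
  by (simp add: wedge_def left_diff_distrib right_diff_distrib sum_subtractf)

lemma wedge_scale_left: "wedge (\<lambda>J. f * \<alpha> J) \<beta> K = f * wedge \<alpha> \<beta> K"
  by (simp add: wedge_def sum_distrib_left mult_ac)

lemma wedge_scale_right: "wedge \<alpha> (\<lambda>J. f * \<beta> J) K = f * wedge \<alpha> \<beta> K"
  by (simp add: wedge_def sum_distrib_left mult_ac)

lemma wedge_uminus_left: "wedge (\<lambda>J. - \<alpha> J) \<beta> K = - wedge \<alpha> \<beta> K"
  using wedge_scale_left[of "- 1" \<alpha> \<beta> K] by simp

lemma wedge_sum_left: "wedge (\<lambda>J. \<Sum>i\<in>S. \<alpha> i J) \<beta> K = (\<Sum>i\<in>S. wedge (\<alpha> i) \<beta> K)"
  unfolding wedge_def sum_distrib_left sum_distrib_right by (rule sum.swap)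

lemma wedge_sum_right: "wedge \<alpha> (\<lambda>J. \<Sum>i\<in>S. \<beta> i J) K = (\<Sum>i\<in>S. wedge \<alpha> (\<beta> i) K)"
  unfolding wedge_def sum_distrib_left sum_distrib_right by (rule sum.swap)

lemma wedge_degree_0:
  assumes "finite K"
  shows "wedge (\<lambda>J. if J = {} then f else 0) \<beta> K = f * \<beta> K"
proof -
  have "wedge (\<lambda>J. if J = {} then f else 0) \<beta> K = (\<Sum>J\<in>{{} :: nat set}. f * \<beta> K)"
    unfolding wedge_def by (rule sum.mono_neutral_cong_right) (use assms in auto)
  then show ?thesis by simp
qed

definition homog :: "nat \<Rightarrow> nat \<Rightarrow> form \<Rightarrow> bool" where
  "homog n k \<omega> \<longleftrightarrow> (\<forall>J. \<omega> J \<in> cps n) \<and> (\<forall>J. \<omega> J \<noteq> 0 \<longrightarrow> J \<subseteq> {..<n} \<and> card J = k)"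

lemma homogD:
  assumes "homog n k \<omega>"
  shows homog_cps: "\<omega> J \<in> cps n" and homog_sub: "\<omega> J \<noteq> 0 \<Longrightarrow> J \<subseteq> {..<n}"
    and homog_card: "\<omega> J \<noteq> 0 \<Longrightarrow> card J = k"
  using assms by (auto simp: homog_def)

lemma wedge_cps: "(\<And>J. \<alpha> J \<in> cps n) \<Longrightarrow> (\<And>J. \<beta> J \<in> cps n) \<Longrightarrow> wedge \<alpha> \<beta> K \<in> cps n"
  unfolding wedge_def by (intro cps_sum cps_mult) auto

lemma homog_wedge:
  assumes "homog n k \<alpha>" "homog n l \<beta>"
  shows "homog n (k + l) (wedge \<alpha> \<beta>)"
  unfolding homog_def
proof (intro conjI allI impI)
  show "wedge \<alpha> \<beta> J \<in> cps n" for J using assms by (intro wedge_cps homog_cps)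
  fix K assume nz: "wedge \<alpha> \<beta> K \<noteq> 0"
  then have K: "finite K" using wedge_infinite by blast
  obtain J where J: "J \<subseteq> K" "\<alpha> J \<noteq> 0" "\<beta> (K - J) \<noteq> 0"
    using nz unfolding wedge_def by (metis (no_types, lifting) PowD mult_not_zero sum.neutral)
  then have "J \<subseteq> {..<n}" "K - J \<subseteq> {..<n}" "card J = k" "card (K - J) = l"
    using assms homog_sub homog_card by blast+
  then show "K \<subseteq> {..<n}" "card K = k + l"
    using J(1) K card_Diff_subset[of J K] card_mono[OF K J(1)] finite_subset[OF J(1) K] by auto
qed

lemma differential_single [simp]: "differential g {i} = pd i g"
  by (simp add: differential_def)

lemma pd_outside: "f \<in> cps n \<Longrightarrow> \<not> i < n \<Longrightarrow> pd i f = 0"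
proof (rule mpser_eqI)
  fix m assume "f \<in> cps n" "\<not> i < n"
  then have "coef f (m + Poly_Mapping.single i 1) = 0"
    using cps_keys[of f n "m + Poly_Mapping.single i 1"] by (auto simp: keys_add_nat)
  then show "coef (pd i f) m = coef 0 m" by (simp add: coef_pd coef_simps)
qed

lemma homog_differential: "f \<in> cps n \<Longrightarrow> homog n 1 (differential f)"
  using pd_outside[of f n] unfolding homog_def differential_def by (auto split: if_splits) blast

lemma homog_unit: "homog n 0 unit_form"
  by (auto simp: homog_def unit_form_def)

lemma wedge_differentials_Nil [simp]: "wedge_differentials [] = unit_form"
  by (simp add: wedge_differentials_def)

lemma wedge_differentials_Cons [simp]: "wedge_differentials (h # hs) = wedge (differential h) (wedge_differentials hs)"
  by (simp add: wedge_differentials_def)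

lemma homog_wedge_differentials: "set hs \<subseteq> cps n \<Longrightarrow> homog n (length hs) (wedge_differentials hs)"
  by (induction hs) (auto intro: homog_unit homog_wedge[OF homog_differential, simplified])

lemma wedge_differential:
  assumes "finite K"
  shows "wedge (differential g) \<beta> K = (\<Sum>j\<in>K. shuffle_sign {j} (K - {j}) * pd j g * \<beta> (K - {j}))"
proof -
  have "wedge (differential g) \<beta> K = (\<Sum>J\<in>(\<lambda>j. {j}) ` K. shuffle_sign J (K - J) * differential g J * \<beta> (K - J))"
    unfolding wedge_def by (rule sum.mono_neutral_right) (use assms in \<open>auto simp: differential_def\<close>)
  also have "\<dots> = (\<Sum>j\<in>K. shuffle_sign {j} (K - {j}) * pd j g * \<beta> (K - {j}))"
    by (subst sum.reindex) auto
  finally show ?thesis .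
qed

lemma differential_anticommute:
  "wedge (differential g) (differential h) K = - wedge (differential h) (differential g) K"
proof (cases "finite K")
  case K: True
  have "wedge (differential g) (differential h) K = (\<Sum>J\<in>Pow K. shuffle_sign (K - J) J * differential g (K - J) * differential h J)"
    unfolding wedge_def
    by (rule sum.reindex_bij_witness[where i = "\<lambda>J. K - J" and j = "\<lambda>J. K - J"]) (auto simp: double_diff)
  also have "\<dots> = (\<Sum>J\<in>Pow K. - (shuffle_sign J (K - J) * differential h J * differential g (K - J)))"
  proof (rule sum.cong)
    fix J assume J: "J \<in> Pow K"
    show "shuffle_sign (K - J) J * differential g (K - J) * differential h J = - (shuffle_sign J (K - J) * differential h J * differential g (K - J))"
    proof (cases "(\<exists>i. J = {i}) \<and> (\<exists>j. K - J = {j})")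
      case True
      have "finite J" using J K finite_subset by auto
      then have "shuffle_sign (K - J) J * shuffle_sign J (K - J) = (- 1) ^ (card (K - J) * card J)"
        using K by (intro shuffle_sign_swap) auto
      also have "card (K - J) * card J = 1" using True by (metis One_nat_def card_1_singleton_iff mult.right_neutral)
      finally have "shuffle_sign (K - J) J * shuffle_sign J (K - J) = - 1" by simp
      then have "(shuffle_sign (K - J) J * shuffle_sign J (K - J)) * shuffle_sign J (K - J) = - shuffle_sign J (K - J)"
        by (simp only: mult_minus1)
      then have "shuffle_sign (K - J) J = - shuffle_sign J (K - J)" by (simp add: mult.assoc)
      then show ?thesis by (simp only: mult_minus_left mult_minus_right mult_ac)
    qed (auto simp: differential_def)
  qed simp
  finally show ?thesis by (simp add: wedge_def sum_negf)
qed (simp add: wedge_infinite)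

lemma differential_swap:
  "wedge (differential g) (wedge (differential h) \<omega>) K = - wedge (differential h) (wedge (differential g) \<omega>) K"
proof -
  have "wedge (differential g) (wedge (differential h) \<omega>) K = wedge (\<lambda>K. - wedge (differential h) (differential g) K) \<omega> K"
    unfolding wedge_assoc[symmetric] by (rule wedge_cong) (simp_all add: differential_anticommute[of g h])
  then show ?thesis by (simp add: wedge_uminus_left wedge_assoc)
qed

lemma differential_twice: "wedge (differential g) (wedge (differential g) \<omega>) K = 0"
  by (rule double_eq_0) (use differential_swap[of g g \<omega> K] in simp)

lemma wedge_differentials_move:
  "\<exists>s. (s = 1 \<or> s = - 1) \<and> (\<forall>K. wedge_differentials (xs @ a # ys) K = s * wedge_differentials (a # xs @ ys) K)"
proof (induction xs)
  case (Cons x xs)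
  then obtain s where s: "s = 1 \<or> s = - 1"
    "\<And>K. wedge_differentials (xs @ a # ys) K = s * wedge_differentials (a # xs @ ys) K" by blast
  have "wedge_differentials ((x # xs) @ a # ys) K = (- s) * wedge_differentials (a # (x # xs) @ ys) K" for K
  proof -
    have "wedge_differentials ((x # xs) @ a # ys) K = wedge (differential x) (\<lambda>K. s * wedge_differentials (a # xs @ ys) K) K"
      by (simp, rule wedge_cong) (simp_all add: s(2))
    also have "\<dots> = s * wedge (differential x) (wedge (differential a) (wedge_differentials (xs @ ys))) K"
      by (simp add: wedge_scale_right)
    also have "\<dots> = (- s) * wedge_differentials (a # (x # xs) @ ys) K"
      by (simp add: differential_swap[of x a])
    finally show ?thesis .
  qed
  then show ?case using s(1) by (intro exI[of _ "- s"]) auto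
qed (auto intro: exI[of _ 1])

lemma wedge_differentials_perm:
  "mset xs = mset ys \<Longrightarrow> \<exists>s. (s = 1 \<or> s = - 1) \<and> (\<forall>K. wedge_differentials xs K = s * wedge_differentials ys K)"
proof (induction xs arbitrary: ys)
  case (Cons a xs)
  then have "a \<in> set ys" by (metis list.set_intros(1) set_mset_mset)
  then obtain us vs where ys: "ys = us @ a # vs" by (auto dest: split_list)
  then have "mset xs = mset (us @ vs)" using Cons.prems by simp
  then obtain s where s: "s = 1 \<or> s = - 1" "\<And>K. wedge_differentials xs K = s * wedge_differentials (us @ vs) K"
    using Cons.IH by blast
  obtain t where t: "t = 1 \<or> t = - 1" "\<And>K. wedge_differentials ys K = t * wedge_differentials (a # us @ vs) K"
    unfolding ys using wedge_differentials_move by blast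
  have "wedge_differentials (a # xs) K = s * wedge_differentials (a # us @ vs) K" for K
    by (simp add: wedge_scale_right[symmetric], rule wedge_cong) (simp_all add: s(2))
  also have "s * wedge_differentials (a # us @ vs) K = (s * t) * wedge_differentials ys K" for K
    using t by (auto simp: t(2))
  finally show ?case using s(1) t(1) by (intro exI[of _ "s * t"]) auto
qed (auto intro: exI[of _ 1])

text \<open>
  In characteristic \<open>0\<close> this follows from anticommutativity, after moving the two equal factors next to
  each other.
\<close>

lemma wedge_differentials_repeated:
  assumes "\<not> distinct gs" shows "wedge_differentials gs K = 0"
proof -
  obtain us a vs ws where gs: "gs = us @ [a] @ vs @ [a] @ ws" using not_distinct_decomp[OF assms] by blast
  then have "mset gs = mset (a # a # us @ vs @ ws)" by simp
  then obtain s where "wedge_differentials gs K = s * wedge_differentials (a # a # us @ vs @ ws) K"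
    using wedge_differentials_perm by blast
  then show ?thesis by (simp add: differential_twice)
qed

section \<open>Interior products\<close>

definition partial_iprod :: "nat \<Rightarrow> form \<Rightarrow> form" where
  "partial_iprod i \<omega> J = (if i \<in> J then 0 else shuffle_sign {i} J * \<omega> (insert i J))"

definition iprod :: "nat \<Rightarrow> (nat \<Rightarrow> mpser) \<Rightarrow> form \<Rightarrow> form" where
  "iprod n v \<omega> J = (\<Sum>i<n. v i * partial_iprod i \<omega> J)"

definition twist :: "form \<Rightarrow> form" where
  "twist \<omega> J = (- 1) ^ card J * \<omega> J"

text \<open>
  For \<open>i \<notin> J\<close> the two summands correspond to the parts of \<open>insert i J\<close> that contain \<open>i\<close> and those that
  do not. For \<open>i \<in> J\<close> the left side is zero, and on the right the terms in which both factors would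
  contain \<open>i\<close> cancel in pairs.
\<close>

lemma partial_iprod_wedge:
  assumes J: "finite J"
  shows "partial_iprod i (wedge \<alpha> \<beta>) J = wedge (partial_iprod i \<alpha>) \<beta> J + wedge (twist \<alpha>) (partial_iprod i \<beta>) J"
proof (cases "i \<in> J")
  case True
  define J' where "J' = J - {i}"
  have J': "J = insert i J'" "i \<notin> J'" "finite J'" using True J by (auto simp: J'_def)
  have disj: "Pow J' \<inter> insert i ` Pow J' = {}" using J'(2) by auto
  have inj: "inj_on (insert i) (Pow J')"
    using J'(2) by (intro inj_onI) (metis PowD insert_ident subsetD)
  have fP: "finite P" if "P \<subseteq> J'" for P using that J'(3) finite_subset by blast
  let ?f = "\<lambda>P. shuffle_sign P (J - P) * partial_iprod i \<alpha> P * \<beta> (J - P)"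
  let ?g = "\<lambda>P. shuffle_sign P (J - P) * twist \<alpha> P * partial_iprod i \<beta> (J - P)"
  have "wedge (partial_iprod i \<alpha>) \<beta> J + wedge (twist \<alpha>) (partial_iprod i \<beta>) J
      = (\<Sum>P\<in>Pow J'. ?f P) + (\<Sum>P\<in>Pow J'. ?f (insert i P)) + ((\<Sum>P\<in>Pow J'. ?g P) + (\<Sum>P\<in>Pow J'. ?g (insert i P)))"
    unfolding wedge_def J'(1) Pow_insert
    by (simp add: sum.union_disjoint[OF _ _ disj] J'(3) sum.reindex[OF inj])
  also have "\<dots> = (\<Sum>P\<in>Pow J'. ?f P + ?f (insert i P) + (?g P + ?g (insert i P)))"
    by (simp add: sum.distrib)
  also have "\<dots> = 0"
  proof (rule sum.neutral, rule ballI)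
    fix P assume P: "P \<in> Pow J'"
    define L where "L = J' - P"
    have L: "finite P" "finite L" "i \<notin> P" "i \<notin> L" "P \<inter> L = {}" "J - P = insert i L" "J - insert i P = L"
      using P J' fP by (auto simp: L_def)
    have 1: "?f (insert i P) = 0" by (simp add: partial_iprod_def)
    have 2: "?g P = 0" using L by (simp add: partial_iprod_def)
    have "shuffle_sign P {i} * shuffle_sign {i} P = (- 1) ^ card P"
      using shuffle_sign_swap[of P "{i}"] L by simp
    then have 3: "?f P = (- 1) ^ card P * shuffle_sign P L * \<alpha> (insert i P) * \<beta> (insert i L)"
      using L shuffle_sign_Un_right[of P "{i}" L] by (simp add: partial_iprod_def algebra_simps)
    have 4: "?g (insert i P) = - ((- 1) ^ card P * shuffle_sign P L * \<alpha> (insert i P) * \<beta> (insert i L))"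
      using L shuffle_sign_Un_left[of "{i}" P L] by (simp add: partial_iprod_def twist_def algebra_simps)
    show "?f P + ?f (insert i P) + (?g P + ?g (insert i P)) = 0" unfolding 1 2 3 4 by simp
  qed
  finally show ?thesis using True by (simp add: partial_iprod_def)
next
  case False
  have disj: "Pow J \<inter> insert i ` Pow J = {}" using False by auto
  have inj: "inj_on (insert i) (Pow J)"
    using False by (intro inj_onI) (metis PowD insert_ident subsetD)
  let ?h = "\<lambda>P. shuffle_sign P (insert i J - P) * \<alpha> P * \<beta> (insert i J - P)"
  have "partial_iprod i (wedge \<alpha> \<beta>) J = shuffle_sign {i} J * ((\<Sum>P\<in>Pow J. ?h P) + (\<Sum>P\<in>Pow J. ?h (insert i P)))"
    unfolding partial_iprod_def wedge_def Pow_insert using False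
    by (simp add: sum.union_disjoint[OF _ _ disj] J sum.reindex[OF inj])
  also have "\<dots> = (\<Sum>P\<in>Pow J. shuffle_sign {i} J * ?h (insert i P)) + (\<Sum>P\<in>Pow J. shuffle_sign {i} J * ?h P)"
    by (simp add: distrib_left sum_distrib_left add.commute)
  also have "(\<Sum>P\<in>Pow J. shuffle_sign {i} J * ?h (insert i P)) = wedge (partial_iprod i \<alpha>) \<beta> J"
    unfolding wedge_def
  proof (rule sum.cong)
    fix P assume P: "P \<in> Pow J"
    define L where "L = J - P"
    have L: "finite P" "finite L" "i \<notin> P" "i \<notin> L" "P \<inter> L = {}" "J = P \<union> L" "insert i J - insert i P = L"
      using P False J finite_subset[of P J] by (auto simp: L_def)
    have "shuffle_sign {i} J = shuffle_sign {i} P * shuffle_sign {i} L"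
      unfolding L(6) using L by (intro shuffle_sign_Un_right) auto
    moreover have "shuffle_sign (insert i P) L = shuffle_sign {i} L * shuffle_sign P L"
      using L shuffle_sign_Un_left[of "{i}" P L] by simp
    ultimately show "shuffle_sign {i} J * ?h (insert i P) = shuffle_sign P (J - P) * partial_iprod i \<alpha> P * \<beta> (J - P)"
      unfolding L(7) L_def[symmetric] using L by (simp add: partial_iprod_def algebra_simps)
  qed simp
  also have "(\<Sum>P\<in>Pow J. shuffle_sign {i} J * ?h P) = wedge (twist \<alpha>) (partial_iprod i \<beta>) J"
    unfolding wedge_def
  proof (rule sum.cong)
    fix P assume P: "P \<in> Pow J"
    define L where "L = J - P"
    have L: "finite P" "finite L" "i \<notin> P" "i \<notin> L" "P \<inter> L = {}" "J = P \<union> L" "insert i J - P = insert i L"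
      using P False J finite_subset[of P J] by (auto simp: L_def)
    have 1: "shuffle_sign {i} J = shuffle_sign {i} P * shuffle_sign {i} L"
      unfolding L(6) using L by (intro shuffle_sign_Un_right) auto
    have 2: "shuffle_sign P (insert i L) = shuffle_sign P {i} * shuffle_sign P L"
      using L shuffle_sign_Un_right[of P "{i}" L] by simp
    have 3: "shuffle_sign {i} P * shuffle_sign P {i} = (- 1) ^ card P"
      using shuffle_sign_swap[of P "{i}"] L by (simp add: mult.commute)
    have "shuffle_sign {i} J * shuffle_sign P (insert i L) = (shuffle_sign {i} P * shuffle_sign P {i}) * (shuffle_sign {i} L * shuffle_sign P L)"
      unfolding 1 2 by (simp add: mult_ac)
    then have "shuffle_sign {i} J * shuffle_sign P (insert i L) = (- 1) ^ card P * (shuffle_sign {i} L * shuffle_sign P L)" unfolding 3 .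
    then have "shuffle_sign {i} J * (shuffle_sign P (insert i L) * \<alpha> P * \<beta> (insert i L))
        = (- 1) ^ card P * (shuffle_sign {i} L * shuffle_sign P L) * \<alpha> P * \<beta> (insert i L)"
      by (simp flip: mult.assoc)
    then show "shuffle_sign {i} J * ?h P = shuffle_sign P (J - P) * twist \<alpha> P * partial_iprod i \<beta> (J - P)"
      unfolding L(7) L_def[symmetric] using L by (simp add: partial_iprod_def twist_def mult_ac)
  qed simp
  finally show ?thesis .
qed

lemma iprod_wedge:
  assumes J: "finite J"
  shows "iprod n v (wedge \<alpha> \<beta>) J = wedge (iprod n v \<alpha>) \<beta> J + wedge (twist \<alpha>) (iprod n v \<beta>) J"
proof -
  have 1: "wedge (iprod n v \<alpha>) \<beta> J = (\<Sum>i<n. v i * wedge (partial_iprod i \<alpha>) \<beta> J)"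
    by (simp add: iprod_def[abs_def] wedge_sum_left wedge_scale_left)
  have 2: "wedge (twist \<alpha>) (iprod n v \<beta>) J = (\<Sum>i<n. v i * wedge (twist \<alpha>) (partial_iprod i \<beta>) J)"
    by (simp add: iprod_def[abs_def] wedge_sum_right wedge_scale_right)
  show ?thesis unfolding 1 2 iprod_def[of n v "wedge \<alpha> \<beta>"]
    by (simp add: partial_iprod_wedge[OF J] distrib_left sum.distrib)
qed

lemma iprod_add: "iprod n v (\<lambda>J. \<omega> J + \<omega>' J) J = iprod n v \<omega> J + iprod n v \<omega>' J"
  by (simp add: iprod_def partial_iprod_def distrib_left flip: sum.distrib)
     (auto intro!: sum.cong simp: distrib_left)

lemma iprod_scale: "iprod n v (\<lambda>J. f * \<omega> J) J = f * iprod n v \<omega> J"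
  unfolding iprod_def sum_distrib_left by (rule sum.cong) (auto simp: partial_iprod_def mult_ac)

lemma iprod_diff: "iprod n v (\<lambda>J. \<omega> J - \<omega>' J) J = iprod n v \<omega> J - iprod n v \<omega>' J"
  using iprod_add[of n v \<omega> "\<lambda>J. (- 1) * \<omega>' J" J] iprod_scale[of n v "- 1" \<omega>' J] by simp

lemma iprod_cps: "(\<And>i. i < n \<Longrightarrow> v i \<in> cps n) \<Longrightarrow> (\<And>J. \<omega> J \<in> cps n) \<Longrightarrow> iprod n v \<omega> J \<in> cps n"
  unfolding iprod_def partial_iprod_def by (intro cps_sum cps_mult) auto

lemma homog_iprod:
  assumes v: "\<And>i. i < n \<Longrightarrow> v i \<in> cps n" and \<omega>: "homog n (Suc k) \<omega>"
  shows "homog n k (iprod n v \<omega>)"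
  unfolding homog_def
proof (intro conjI allI impI)
  show "iprod n v \<omega> J \<in> cps n" for J by (intro iprod_cps v homog_cps[OF \<omega>])
  fix J assume "iprod n v \<omega> J \<noteq> 0"
  then obtain i where i: "i < n" "partial_iprod i \<omega> J \<noteq> 0"
    unfolding iprod_def by (metis (no_types, lifting) lessThan_iff mult_zero_right sum.neutral)
  then have "i \<notin> J" "\<omega> (insert i J) \<noteq> 0" by (auto simp: partial_iprod_def split: if_splits)
  then have "insert i J \<subseteq> {..<n}" "card (insert i J) = Suc k" using homog_sub[OF \<omega>] homog_card[OF \<omega>] by blast+
  then show "J \<subseteq> {..<n}" "card J = k" using \<open>i \<notin> J\<close> finite_subset[of J "{..<n}"] by auto
qed

lemma iprod_differential:
  "iprod n v (differential g) J = (if J = {} then deriv n v g else 0)"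
proof (cases "J = {}")
  case True then show ?thesis by (simp add: iprod_def deriv_def partial_iprod_def)
next
  case False
  then have "partial_iprod i (differential g) J = 0" for i
    by (auto simp: partial_iprod_def differential_def)
  then show ?thesis using False by (simp add: iprod_def)
qed

lemma twist_differential: "twist (differential g) J = - differential g J"
  by (auto simp: twist_def differential_def)

lemma iprod_differential_wedge:
  assumes K: "finite K"
  shows "iprod n v (wedge (differential g) \<omega>) K = deriv n v g * \<omega> K - wedge (differential g) (iprod n v \<omega>) K"
proof -
  have "wedge (iprod n v (differential g)) \<omega> K = deriv n v g * \<omega> K"
    unfolding wedge_degree_0[OF K, symmetric] by (rule wedge_cong) (simp_all add: iprod_differential)
  moreover have "wedge (twist (differential g)) (iprod n v \<omega>) K = - wedge (differential g) (iprod n v \<omega>) K"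
    unfolding wedge_uminus_left[symmetric] by (rule wedge_cong) (simp_all add: twist_differential)
  ultimately show ?thesis by (simp add: iprod_wedge[OF K])
qed

section \<open>Forms modulo an ideal\<close>

text \<open>
  Forms have finite index sets.
\<close>

definition vanishes :: "mpser set \<Rightarrow> form \<Rightarrow> bool" where
  "vanishes Q \<omega> \<longleftrightarrow> (\<forall>K. finite K \<longrightarrow> \<omega> K \<in> Q)"

lemma vanishes_wedge_left:
  assumes Q: "idl n Q" and "vanishes Q \<alpha>" "\<And>J. \<beta> J \<in> cps n"
  shows "vanishes Q (wedge \<alpha> \<beta>)"
  unfolding vanishes_def
proof (intro allI impI)
  fix K :: "nat set" assume K: "finite K"
  have "shuffle_sign J (K - J) * \<alpha> J * \<beta> (K - J) \<in> Q" if "J \<in> Pow K" for J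
  proof -
    have "\<alpha> J \<in> Q" using assms(2) that K finite_subset[of J K] by (auto simp: vanishes_def)
    then show ?thesis by (intro idl_mult2[OF Q _ idl_mult[OF Q]] assms(3)) auto
  qed
  then show "wedge \<alpha> \<beta> K \<in> Q" unfolding wedge_def by (rule idl_sum[OF Q])
qed

lemma vanishes_wedge_right:
  assumes Q: "idl n Q" and "vanishes Q \<beta>" "\<And>J. \<alpha> J \<in> cps n"
  shows "vanishes Q (wedge \<alpha> \<beta>)"
  unfolding vanishes_def
proof (intro allI impI)
  fix K :: "nat set" assume K: "finite K"
  have "shuffle_sign J (K - J) * \<alpha> J * \<beta> (K - J) \<in> Q" if "J \<in> Pow K" for J
    using assms(2) K by (intro idl_mult[OF Q] cps_mult assms(3)) (auto simp: vanishes_def)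
  then show "wedge \<alpha> \<beta> K \<in> Q" unfolding wedge_def by (rule idl_sum[OF Q])
qed

lemma vanishes_iprod:
  assumes Q: "idl n Q" and "vanishes Q \<omega>" "\<And>i. i < n \<Longrightarrow> v i \<in> cps n"
  shows "vanishes Q (iprod n v \<omega>)"
  unfolding vanishes_def iprod_def partial_iprod_def
  using assms(2,3) by (auto simp: vanishes_def idl_0[OF Q] intro!: idl_sum[OF Q] idl_mult[OF Q])

definition tangent :: "nat \<Rightarrow> mpser set \<Rightarrow> (nat \<Rightarrow> mpser) \<Rightarrow> bool" where
  "tangent n Q v \<longleftrightarrow> (\<forall>i<n. v i \<in> cps n) \<and> (\<forall>f\<in>Q. deriv n v f \<in> Q)"

lemma iprod_wedge_differentials_vanishes:
  assumes Q: "idl n Q" and v: "\<And>i. i < n \<Longrightarrow> v i \<in> cps n"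
    and "\<And>h. h \<in> set hs \<Longrightarrow> h \<in> cps n \<and> deriv n v h \<in> Q"
  shows "vanishes Q (iprod n v (wedge_differentials hs))"
  using assms(3)
proof (induction hs)
  case Nil
  have "iprod n v unit_form K = 0" for K
    by (auto simp: iprod_def partial_iprod_def unit_form_def intro!: sum.neutral)
  then show ?case by (simp add: vanishes_def idl_0[OF Q])
next
  case (Cons h hs)
  have hc: "homog n (length hs) (wedge_differentials hs)"
    using Cons.prems by (intro homog_wedge_differentials) auto
  have "vanishes Q (wedge (differential h) (iprod n v (wedge_differentials hs)))"
    by (rule vanishes_wedge_right[OF Q]) (use Cons homog_cps[OF homog_differential] in auto)
  then show ?case using Cons.prems[of h] homog_cps[OF hc] unfolding vanishes_def
    by (auto simp: iprod_differential_wedge intro!: idl_minus[OF Q] idl_mult2[OF Q])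
qed

lemma iprods_wedge:
  assumes Q: "idl n Q" and \<eta>: "\<And>J. \<eta> J \<in> cps n" and \<alpha>: "\<And>J. \<alpha> J \<in> cps n"
    and vs: "\<And>v. v \<in> set vs \<Longrightarrow> (\<forall>i<n. v i \<in> cps n) \<and> vanishes Q (iprod n v \<alpha>)"
  shows "(\<forall>J. foldr (iprod n) vs \<eta> J \<in> cps n) \<and>
    vanishes Q (\<lambda>K. foldr (iprod n) vs (wedge \<eta> \<alpha>) K - wedge (foldr (iprod n) vs \<eta>) \<alpha> K)"
  using vs
proof (induction vs)
  case Nil
  then show ?case using \<eta> by (simp add: vanishes_def idl_0[OF Q])
next
  case (Cons v vs)
  have v: "\<And>i. i < n \<Longrightarrow> v i \<in> cps n" "vanishes Q (iprod n v \<alpha>)" using Cons.prems[of v] by auto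
  let ?E = "foldr (iprod n) vs \<eta>" and ?T = "foldr (iprod n) vs (wedge \<eta> \<alpha>)"
  have IH: "\<And>J. ?E J \<in> cps n" "vanishes Q (\<lambda>K. ?T K - wedge ?E \<alpha> K)" using Cons by auto
  have "vanishes Q (iprod n v (\<lambda>K. ?T K - wedge ?E \<alpha> K))" by (rule vanishes_iprod[OF Q IH(2) v(1)])
  moreover have "vanishes Q (wedge (twist ?E) (iprod n v \<alpha>))"
    by (rule vanishes_wedge_right[OF Q v(2)]) (use IH(1) in \<open>auto simp: twist_def\<close>)
  moreover have "iprod n v ?T K - wedge (iprod n v ?E) \<alpha> K
     = iprod n v (\<lambda>K. ?T K - wedge ?E \<alpha> K) K + wedge (twist ?E) (iprod n v \<alpha>) K" if "finite K" for K
    by (simp add: iprod_diff iprod_wedge[OF that])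
  ultimately have "vanishes Q (\<lambda>K. iprod n v ?T K - wedge (iprod n v ?E) \<alpha> K)"
    unfolding vanishes_def using idl_add[OF Q] by simp
  then show ?case using v(1) IH(1) by (auto intro: iprod_cps)
qed

lemma homog_iprods:
  assumes "homog n (length vs + k) \<eta>" "\<And>v i. v \<in> set vs \<Longrightarrow> i < n \<Longrightarrow> v i \<in> cps n"
  shows "homog n k (foldr (iprod n) vs \<eta>)"
  using assms
proof (induction vs arbitrary: k)
  case (Cons v vs)
  have "homog n (Suc k) (foldr (iprod n) vs \<eta>)" by (rule Cons.IH) (use Cons.prems in auto)
  then show ?case using Cons.prems by (auto intro: homog_iprod)
qed simp

lemma homog_0_wedge:
  assumes "homog n 0 \<eta>" "finite K"
  shows "wedge \<eta> \<alpha> K = \<eta> {} * \<alpha> K"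
proof -
  have "wedge \<eta> \<alpha> K = wedge (\<lambda>J. if J = {} then \<eta> {} else 0) \<alpha> K"
  proof (rule wedge_cong)
    fix J assume "J \<subseteq> K"
    then have "finite J" using assms finite_subset by blast
    then show "\<eta> J = (if J = {} then \<eta> {} else 0)" using homog_card[OF assms(1), of J] by auto
  qed simp
  then show ?thesis using wedge_degree_0[OF assms(2)] by simp
qed

text \<open>
  If each field annihilates \<open>\<alpha>\<close> modulo \<open>Q\<close>, the interior products only act on the factor \<open>\<eta>\<close>. Their
  number is the degree of \<open>\<eta>\<close>, so they turn it into a function.
\<close>

lemma iprods_wedge_eval:
  assumes Q: "idl n Q" and \<eta>: "homog n (length vs) \<eta>" and \<alpha>: "\<And>J. \<alpha> J \<in> cps n"
    and vs: "\<And>v. v \<in> set vs \<Longrightarrow> (\<forall>i<n. v i \<in> cps n) \<and> vanishes Q (iprod n v \<alpha>)" and L: "finite L"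
  shows "foldr (iprod n) vs (wedge \<eta> \<alpha>) L - foldr (iprod n) vs \<eta> {} * \<alpha> L \<in> Q"
proof -
  have "homog n 0 (foldr (iprod n) vs \<eta>)" by (rule homog_iprods) (use \<eta> vs in auto)
  then have eq: "wedge (foldr (iprod n) vs \<eta>) \<alpha> L = foldr (iprod n) vs \<eta> {} * \<alpha> L"
    using L by (rule homog_0_wedge)
  have "vanishes Q (\<lambda>K. foldr (iprod n) vs (wedge \<eta> \<alpha>) K - wedge (foldr (iprod n) vs \<eta>) \<alpha> K)"
    by (rule conjunct2[OF iprods_wedge[OF Q homog_cps[OF \<eta>] \<alpha> vs]])
  then show ?thesis using L unfolding vanishes_def eq[symmetric] by blast
qed

section \<open>Vector fields from decomposable forms\<close>

text \<open>
  The contraction of \<open>\<beta>\<close> with the coordinate multivector of \<open>K\<close>: a field that sends \<open>g\<close> to the coefficient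
  of \<open>dg \<and> \<beta>\<close> at \<open>K\<close>. If \<open>\<beta>\<close> is a product of differentials, its coefficients are minors of a Jacobian
  matrix.
\<close>

definition minor_field :: "form \<Rightarrow> nat set \<Rightarrow> nat \<Rightarrow> mpser" where
  "minor_field \<beta> K j = (if j \<in> K then shuffle_sign {j} (K - {j}) * \<beta> (K - {j}) else 0)"

lemma deriv_minor_field:
  assumes "finite K" "g \<in> cps n"
  shows "deriv n (minor_field \<beta> K) g = wedge (differential g) \<beta> K"
proof -
  have "deriv n (minor_field \<beta> K) g = (\<Sum>j\<in>{..<n} \<inter> K. shuffle_sign {j} (K - {j}) * pd j g * \<beta> (K - {j}))"
    unfolding deriv_def by (rule sum.mono_neutral_cong_right) (auto simp: minor_field_def mult_ac)
  also have "\<dots> = (\<Sum>j\<in>K. shuffle_sign {j} (K - {j}) * pd j g * \<beta> (K - {j}))"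
  proof (rule sum.mono_neutral_left)
    show "\<forall>j\<in>K - {..<n} \<inter> K. shuffle_sign {j} (K - {j}) * pd j g * \<beta> (K - {j}) = 0"
    proof
      fix j assume "j \<in> K - {..<n} \<inter> K"
      then have "pd j g = 0" by (intro pd_outside[OF assms(2)]) auto
      then show "shuffle_sign {j} (K - {j}) * pd j g * \<beta> (K - {j}) = 0" by simp
    qed
  qed (use assms in auto)
  finally show ?thesis by (simp add: wedge_differential[OF assms(1)])
qed

lemma minor_field_cps: "(\<And>J. \<beta> J \<in> cps n) \<Longrightarrow> minor_field \<beta> K j \<in> cps n"
  by (simp add: minor_field_def)

lemma minor_field_tangent:
  assumes "\<And>J. \<beta> J \<in> cps n" "idl n Q" "\<And>g. g \<in> Q \<Longrightarrow> vanishes Q (wedge (differential g) \<beta>)" "finite K"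
  shows "tangent n Q (minor_field \<beta> K)"
  unfolding tangent_def using assms minor_field_cps[of \<beta> n K] idl_sub[OF assms(2)]
  by (auto simp: deriv_minor_field vanishes_def)

lemma iprod_minor_field:
  assumes L: "L \<subseteq> U" "finite U" and U: "U \<subseteq> {..<n}" "m \<notin> U" "m < n"
  shows "iprod n (minor_field \<beta> (insert m L)) \<omega> U = shuffle_sign {m} L * shuffle_sign {m} U * \<beta> L * \<omega> (insert m U)"
proof -
  have m: "m \<notin> L" "insert m L - {m} = L" using L U by auto
  have "iprod n (minor_field \<beta> (insert m L)) \<omega> U = (\<Sum>i\<in>{m}. minor_field \<beta> (insert m L) i * partial_iprod i \<omega> U)"
    unfolding iprod_def by (rule sum.mono_neutral_right) (use U L in \<open>auto simp: minor_field_def partial_iprod_def\<close>)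
  then show ?thesis using U m by (simp add: minor_field_def partial_iprod_def mult_ac)
qed

text \<open>
  Among the coordinates outside \<open>L\<close>, the field of \<open>insert m L\<close> only involves that of \<open>m\<close>, with coefficient
  \<open>\<plusminus> \<beta> L\<close>. So on index sets that contain \<open>L\<close> these fields act like multiples of coordinate fields.
\<close>

lemma iprods_minor_fields:
  assumes L: "L \<subseteq> {..<n}" and ms: "distinct ms" "set ms \<subseteq> {..<n}" "set ms \<inter> U = {}" and U: "L \<subseteq> U" "U \<subseteq> {..<n}"
  shows "\<exists>s. (s = 1 \<or> s = - 1) \<and>
    foldr (iprod n) (map (\<lambda>m. minor_field \<beta> (insert m L)) ms) \<omega> U = s * \<beta> L ^ length ms * \<omega> (U \<union> set ms)"
  using ms U
proof (induction ms arbitrary: U)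
  case (Cons m ms)
  have fU: "finite U" using Cons.prems finite_subset by blast
  obtain s where s: "s = 1 \<or> s = - 1"
    "foldr (iprod n) (map (\<lambda>m. minor_field \<beta> (insert m L)) ms) \<omega> (insert m U) = s * \<beta> L ^ length ms * \<omega> (insert m U \<union> set ms)"
    using Cons.IH[of "insert m U"] Cons.prems by auto
  have "foldr (iprod n) (map (\<lambda>m. minor_field \<beta> (insert m L)) (m # ms)) \<omega> U
    = (shuffle_sign {m} L * shuffle_sign {m} U * s) * \<beta> L ^ length (m # ms) * \<omega> (U \<union> set (m # ms))"
    using Cons.prems fU s(2) by (simp add: iprod_minor_field mult_ac)
  moreover have "shuffle_sign {m} L * shuffle_sign {m} U * s = 1 \<or> shuffle_sign {m} L * shuffle_sign {m} U * s = - 1"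
    using s(1) shuffle_sign_pm1[of "{m}" L] shuffle_sign_pm1[of "{m}" U] by auto
  ultimately show ?case by blast
qed (auto intro: exI[of _ 1])

lemma differential_add: "differential (f + g) J = differential f J + differential g J"
  by (auto simp: differential_def pd_add)

lemma differential_mult: "differential (f * g) J = f * differential g J + g * differential f J"
  by (auto simp: differential_def pd_mult mult_ac)

lemma differential_0: "differential 0 J = 0"
  by (simp add: differential_def)

lemma wedge_differential_add: "wedge (differential (f + g)) \<beta> K = wedge (differential f) \<beta> K + wedge (differential g) \<beta> K"
  unfolding wedge_add_left[symmetric] by (rule wedge_cong) (simp_all add: differential_add)

lemma wedge_differential_mult: "wedge (differential (f * g)) \<beta> K = f * wedge (differential g) \<beta> K + g * wedge (differential f) \<beta> K"
  unfolding wedge_scale_left[symmetric] wedge_add_left[symmetric] by (rule wedge_cong) (simp_all add: differential_mult)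

section \<open>The Jacobian ideal of a complete intersection along an associated prime\<close>

text \<open>
  The bounds on the growth of \<open>I\<close> and \<open>Q\<close> say that \<open>Q\<close> defines a component of the complete
  intersection of \<open>hs\<close> of full dimension.
\<close>

locale ci_component =
  fixes n :: nat and hs :: "mpser list" and I Q :: "mpser set" and d :: nat
  assumes I: "idl n I" and hsI: "set hs \<subseteq> I" and I_min: "\<And>S. idl n S \<Longrightarrow> set hs \<subseteq> S \<Longrightarrow> I \<subseteq> S"
    and I_rad: "\<And>a. a \<in> cps n \<Longrightarrow> a * a \<in> I \<Longrightarrow> a \<in> I"
    and dim: "length hs + d = n" and I_growth_le: "growth_le n I d"
    and Q: "prime_idl n Q" and IQ: "I \<subseteq> Q" and lower: "\<And>e. growth_le n Q e \<Longrightarrow> d \<le> e"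
begin

lemma Qi: "idl n Q" by (rule prime_idl_is_idl[OF Q])

lemma hs_cps: "set hs \<subseteq> cps n" using hsI idl_sub[OF I] by blast

text \<open>
  By the Leibniz rule the \<open>f \<in> Q\<close> with \<open>df \<and> \<beta> = 0\<close> modulo \<open>Q\<close> form an ideal; it contains \<open>hs\<close> and hence \<open>I\<close>.
  Any \<open>g \<in> Q\<close> has a multiple \<open>s g \<in> I\<close> with \<open>s \<notin> Q\<close>, and \<open>s\<close> cancels.
\<close>

lemma differential_wedge_vanishes:
  assumes \<beta>: "\<And>J. \<beta> J \<in> cps n" and h: "\<And>h. h \<in> set hs \<Longrightarrow> vanishes Q (wedge (differential h) \<beta>)"
    and g: "g \<in> Q"
  shows "vanishes Q (wedge (differential g) \<beta>)"
proof -
  define S where "S = {f \<in> Q. vanishes Q (wedge (differential f) \<beta>)}"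
  have wc: "wedge (differential f) \<beta> K \<in> cps n" if "f \<in> cps n" for f K
    using homog_cps[OF homog_differential[OF that]] \<beta> by (rule wedge_cps)
  have "idl n S"
    unfolding idl_def
  proof (intro conjI ballI)
    show "S \<subseteq> cps n" using idl_sub[OF Qi] by (auto simp: S_def)
    have "wedge (differential 0) \<beta> K = 0" for K
      unfolding wedge_def by (simp add: differential_0)
    then show "0 \<in> S" by (simp add: S_def vanishes_def idl_0[OF Qi])
    show "a + b \<in> S" if "a \<in> S" "b \<in> S" for a b
      using that by (auto simp: S_def vanishes_def wedge_differential_add intro: idl_add[OF Qi])
    show "a * b \<in> S" if "a \<in> cps n" "b \<in> S" for a b
    proof -
      have b: "b \<in> Q" "\<And>K. finite K \<Longrightarrow> wedge (differential b) \<beta> K \<in> Q" using that by (auto simp: S_def vanishes_def)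
      have "a * wedge (differential b) \<beta> K + b * wedge (differential a) \<beta> K \<in> Q" if "finite K" for K
        by (rule idl_add[OF Qi idl_mult[OF Qi \<open>a \<in> cps n\<close> b(2)[OF that]] idl_mult2[OF Qi wc[OF \<open>a \<in> cps n\<close>] b(1)]])
      then show ?thesis using idl_mult[OF Qi that(1) b(1)] by (simp add: S_def vanishes_def wedge_differential_mult)
    qed
  qed
  moreover have "set hs \<subseteq> S" using hsI IQ h by (auto simp: S_def)
  ultimately have IS: "I \<subseteq> S" by (rule I_min)
  obtain s where s: "s \<in> cps n" "s \<notin> Q" "s * g \<in> I"
    using locally_equal[OF I I_rad I_growth_le Q IQ lower g] by blast
  have gc: "g \<in> cps n" using idl_sub[OF Qi g] .
  show ?thesis unfolding vanishes_def
  proof (intro allI impI)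
    fix K :: "nat set" assume K: "finite K"
    have "wedge (differential (s * g)) \<beta> K \<in> Q" using IS s K by (auto simp: S_def vanishes_def)
    moreover have "g * wedge (differential s) \<beta> K \<in> Q" using g wc[OF s(1)] by (rule idl_mult2[OF Qi, rotated])
    ultimately have "(s * wedge (differential g) \<beta> K + g * wedge (differential s) \<beta> K) - g * wedge (differential s) \<beta> K \<in> Q"
      unfolding wedge_differential_mult by (rule idl_minus[OF Qi])
    then have "s * wedge (differential g) \<beta> K \<in> Q" by simp
    then show "wedge (differential g) \<beta> K \<in> Q" using prime_idlD[OF Q s(1) wc[OF gc]] s(2) by blast
  qed
qed

lemma wedge_hs_vanishes:
  assumes "h \<in> set hs" shows "wedge (differential h) (wedge_differentials hs) K = 0"
proof -
  have "wedge_differentials (h # hs) K = 0" by (rule wedge_differentials_repeated) (use assms in auto)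
  then show ?thesis by simp
qed

lemma differential_wedge_hs_vanishes:
  assumes "g \<in> Q" shows "vanishes Q (wedge (differential g) (wedge_differentials hs))"
  by (rule differential_wedge_vanishes[OF homog_cps[OF homog_wedge_differentials[OF hs_cps]] _ assms])
     (simp add: vanishes_def wedge_hs_vanishes idl_0[OF Qi])

text \<open>
  The Jacobian criterion. Take a product \<open>\<beta>\<close> of as many differentials of members of \<open>hs\<close> as possible
  that is nonzero modulo \<open>Q\<close>, with \<open>\<beta> L \<notin> Q\<close>. By maximality \<open>dg \<and> \<beta>\<close> vanishes modulo \<open>Q\<close> for all \<open>g \<in> Q\<close>,
  so the minor fields of \<open>\<beta>\<close> are tangent to \<open>Q\<close>. Those belonging to the \<open>n - length gs\<close> coordinates
  outside \<open>L\<close> are independent, so \<open>n - length gs \<le> d\<close>, and all of \<open>hs\<close> occurs in \<open>\<beta>\<close>.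
\<close>

lemma not_vanishes_wedge_differentials: "\<not> vanishes Q (wedge_differentials hs)"
proof
  assume van: "vanishes Q (wedge_differentials hs)"
  let ?P = "\<lambda>gs. set gs \<subseteq> set hs \<and> \<not> vanishes Q (wedge_differentials gs)"
  have "unit_form {} \<notin> Q" using Q by (simp add: unit_form_def prime_idl_def)
  then have P0: "?P []" by (auto simp: vanishes_def)
  have dist: "distinct gs" if "?P gs" for gs
  proof (rule ccontr)
    assume "\<not> distinct gs"
    then have "vanishes Q (wedge_differentials gs)"
      by (simp add: vanishes_def wedge_differentials_repeated idl_0[OF Qi])
    then show False using that by blast
  qed
  have len: "length gs \<le> length hs" if "?P gs" for gs
    using dist[OF that] that by (metis card_length card_mono distinct_card finite_set order_trans)
  have "\<exists>gs. ?P gs \<and> (\<forall>gs'. ?P gs' \<longrightarrow> length gs' \<le> length gs)"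
  proof (rule ex_has_greatest_nat[of ?P "[]" length "Suc (length hs)", OF P0])
    show "\<forall>gs. ?P gs \<longrightarrow> length gs < Suc (length hs)" using len by (blast intro: le_imp_less_Suc)
  qed
  then obtain gs where gs: "?P gs" "\<And>gs'. ?P gs' \<Longrightarrow> length gs' \<le> length gs" by blast
  define \<beta> where "\<beta> = wedge_differentials gs"
  have \<beta>: "homog n (length gs) \<beta>" unfolding \<beta>_def
    using gs(1) hs_cps by (intro homog_wedge_differentials) auto
  obtain L where L: "finite L" "\<beta> L \<notin> Q" using gs(1) by (auto simp: vanishes_def \<beta>_def)
  have nz: "\<beta> L \<noteq> 0" using L idl_0[OF Qi] by metis
  then have Ln: "L \<subseteq> {..<n}" "card L = length gs" using homog_sub[OF \<beta>] homog_card[OF \<beta>] by blast+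
  have hv: "vanishes Q (wedge (differential h) \<beta>)" if "h \<in> set hs" for h
  proof (rule ccontr)
    assume "\<not> ?thesis"
    then have "?P (h # gs)" using that gs(1) by (simp add: \<beta>_def)
    then have "length (h # gs) \<le> length gs" by (rule gs(2))
    then show False by simp
  qed
  have tv: "vanishes Q (wedge (differential g) \<beta>)" if "g \<in> Q" for g
    by (rule differential_wedge_vanishes[OF homog_cps[OF \<beta>] hv that])
  let ?M = "{..<n} - L"
  \<comment> \<open>the sign makes the diagonal coefficients equal to \<open>\<beta> L\<close>\<close>
  define v where "v m j = shuffle_sign {m} L * minor_field \<beta> (insert m L) j" for m j
  have "card ?M \<le> d"
  proof (rule tangent_dimension[OF Q])
    show "?M \<subseteq> {..<n}" by blast
    show "\<beta> L \<in> cps n" "\<beta> L \<notin> Q" using homog_cps[OF \<beta>] L by auto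
    show "v m i \<in> cps n" for m i unfolding v_def using minor_field_cps[OF homog_cps[OF \<beta>]] by simp
    show "deriv n (v m) f \<in> Q" if "f \<in> Q" for m f
    proof -
      have "deriv n (v m) f = shuffle_sign {m} L * deriv n (minor_field \<beta> (insert m L)) f"
        by (simp add: v_def deriv_def sum_distrib_left mult_ac)
      moreover have "tangent n Q (minor_field \<beta> (insert m L))"
        by (rule minor_field_tangent[OF homog_cps[OF \<beta>] Qi tv]) (use L in auto)
      ultimately show ?thesis using that by (auto simp: tangent_def intro: idl_mult[OF Qi])
    qed
    show "v m m' = (if m = m' then \<beta> L else 0)" if "m \<in> ?M" "m' \<in> ?M" for m m'
    proof (cases "m = m'")
      case True
      have "insert m L - {m} = L" using that by auto
      then show ?thesis using True that by (simp add: v_def minor_field_def)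
    qed (use that in \<open>auto simp: v_def minor_field_def\<close>)
    show "growth_le n Q d" by (rule growth_le_antimono[OF I_growth_le IQ])
  qed
  moreover have "card ?M = n - length gs" using Ln by (simp add: card_Diff_subset finite_subset)
  ultimately have ge: "length gs \<ge> length hs" using dim by linarith
  have d: "distinct gs" using dist gs(1) by blast
  have c: "card (set gs) = length gs" using d by (rule distinct_card)
  have "card (set gs) \<le> card (set hs)" using gs(1) by (intro card_mono) auto
  then have chs: "card (set hs) = length hs" using card_length[of hs] c ge by linarith
  then have dh: "distinct hs" by (rule card_distinct)
  have "set gs = set hs" using gs(1) c chs ge by (intro card_seteq) auto
  then have "mset gs = mset hs" using d dh set_eq_iff_mset_eq_distinct by blast
  then obtain s where s: "\<And>K. wedge_differentials gs K = s * wedge_differentials hs K" "s = 1 \<or> s = - 1"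
    using wedge_differentials_perm by blast
  have "s \<in> cps n" using s(2) by auto
  then have "\<beta> L \<in> Q" unfolding \<beta>_def s(1) using van L(1) by (auto simp: vanishes_def intro: idl_mult[OF Qi])
  then show False using L by simp
qed

end

section \<open>Kernel of the contraction in terms of tangent vector fields\<close>

text \<open>
  The last condition is how the Cohen--Macaulay property enters: all associated primes of \<open>A / J\<close> have
  dimension \<open>d\<close> at least.
\<close>

locale embedded_germ =
  fixes n :: nat and hs :: "mpser list" and I J :: "mpser set" and d :: nat
  assumes I: "idl n I" and hsI: "set hs \<subseteq> I" and I_min: "\<And>S. idl n S \<Longrightarrow> set hs \<subseteq> S \<Longrightarrow> I \<subseteq> S"
    and I_rad: "\<And>a. a \<in> cps n \<Longrightarrow> a * a \<in> I \<Longrightarrow> a \<in> I"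
    and dim: "length hs + d = n" and I_growth_le: "growth_le n I d"
    and J: "idl n J" and IJ: "I \<subseteq> J" and J_rad: "\<And>a. a \<in> cps n \<Longrightarrow> a * a \<in> J \<Longrightarrow> a \<in> J"
    and lower: "\<And>Q e. associated_prime n J Q \<Longrightarrow> growth_le n Q e \<Longrightarrow> d \<le> e"
begin

abbreviation "dh \<equiv> wedge_differentials hs"

lemma associated_prime_sub: "associated_prime n J Q \<Longrightarrow> J \<subseteq> Q"
  unfolding associated_prime_def using colon_sub[OF J] by blast

lemma associated_prime_component:
  assumes Q: "associated_prime n J Q" shows "ci_component n hs I Q d"
proof (rule ci_component.intro)
  show "prime_idl n Q" using Q by (simp add: associated_prime_def)
  show "I \<subseteq> Q" using IJ associated_prime_sub[OF Q] by blast
  show "d \<le> e" if "growth_le n Q e" for e by (rule lower[OF Q that])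
qed (fact I hsI dim I_growth_le | erule (1) I_min I_rad)+

lemma hs_cps: "set hs \<subseteq> cps n" using hsI idl_sub[OF I] by blast

lemma dh: "homog n (length hs) dh" by (rule homog_wedge_differentials[OF hs_cps])

lemma mem_J_if_associated_prime: "c \<in> cps n \<Longrightarrow> (\<And>Q. associated_prime n J Q \<Longrightarrow> c \<in> Q) \<Longrightarrow> c \<in> J"
  using associated_prime_avoiding[OF J J_rad, of c] by blast

lemma differential_wedge_dh: assumes "g \<in> J" shows "vanishes J (wedge (differential g) dh)"
  unfolding vanishes_def
proof (intro allI impI)
  fix K :: "nat set" assume K: "finite K"
  show "wedge (differential g) dh K \<in> J"
  proof (rule mem_J_if_associated_prime)
    show "wedge (differential g) dh K \<in> cps n"
      using homog_cps[OF homog_differential[OF idl_sub[OF J assms]]] homog_cps[OF dh] by (rule wedge_cps)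
    fix Q assume gQ: "associated_prime n J Q"
    then interpret ci_component n hs I Q d by (rule associated_prime_component)
    show "wedge (differential g) dh K \<in> Q"
      using differential_wedge_hs_vanishes[of g] associated_prime_sub[OF gQ] assms K by (auto simp: vanishes_def)
  qed
qed

lemma dh_faithful:
  assumes r: "r \<in> cps n" and "\<And>L. finite L \<Longrightarrow> r * dh L \<in> J"
  shows "r \<in> J"
proof (rule mem_J_if_associated_prime[OF r])
  fix Q assume gQ: "associated_prime n J Q"
  then interpret ci_component n hs I Q d by (rule associated_prime_component)
  obtain L where L: "finite L" "dh L \<notin> Q" using not_vanishes_wedge_differentials by (auto simp: vanishes_def)
  moreover have "r * dh L \<in> Q" using assms(2) L associated_prime_sub[OF gQ] by blast
  moreover have "prime_idl n Q" using gQ by (simp add: associated_prime_def)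
  ultimately show "r \<in> Q" using prime_idlD[of n Q r "dh L"] r homog_cps[OF dh] by blast
qed

text \<open>
  A tangent field annihilates \<open>dh\<close> modulo \<open>J\<close>, so contracting \<open>\<eta> \<and> dh\<close> with \<open>p\<close> tangent fields gives the
  value of \<open>\<eta>\<close> on them times \<open>dh\<close>; this proves one direction, as \<open>dh\<close> cancels. Conversely, suppose that
  the coefficient of \<open>\<eta> \<and> dh\<close> at \<open>K\<close> is not in some associated prime \<open>Q\<close>. Then \<open>dh L \<notin> Q\<close> for some
  \<open>L \<subseteq> K\<close>, and contracting with the minor fields of the elements of \<open>K - L\<close> yields a power of \<open>dh L\<close>
  times that coefficient on the one hand, and an element of \<open>Q\<close> on the other.
\<close>

lemma contraction_kernel:
  assumes \<eta>: "homog n p \<eta>"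
  shows "vanishes J (wedge \<eta> dh) \<longleftrightarrow>
    (\<forall>vs. length vs = p \<and> (\<forall>v\<in>set vs. tangent n J v) \<longrightarrow> foldr (iprod n) vs \<eta> {} \<in> J)"
proof (intro iffI allI impI)
  fix vs assume van: "vanishes J (wedge \<eta> dh)" and vs: "length vs = p \<and> (\<forall>v\<in>set vs. tangent n J v)"
  have v: "(\<forall>i<n. v i \<in> cps n) \<and> vanishes J (iprod n v dh)" if "v \<in> set vs" for v
  proof
    show vc: "\<forall>i<n. v i \<in> cps n" using that vs by (auto simp: tangent_def)
    show "vanishes J (iprod n v dh)"
      by (rule iprod_wedge_differentials_vanishes[OF J])
         (use vc that vs hs_cps hsI IJ in \<open>auto simp: tangent_def\<close>)
  qed
  have hp: "homog n (length vs) \<eta>" using \<eta> vs by simp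
  have "vanishes J (foldr (iprod n) vs (wedge \<eta> dh))"
    using v by (induction vs) (auto intro: van vanishes_iprod[OF J])
  then have 1: "foldr (iprod n) vs (wedge \<eta> dh) L \<in> J" if "finite L" for L using that by (auto simp: vanishes_def)
  show "foldr (iprod n) vs \<eta> {} \<in> J"
  proof (rule dh_faithful)
    have "homog n 0 (foldr (iprod n) vs \<eta>)" by (rule homog_iprods) (use hp v in auto)
    then show "foldr (iprod n) vs \<eta> {} \<in> cps n" by (rule homog_cps)
    fix L :: "nat set" assume L: "finite L"
    have "foldr (iprod n) vs (wedge \<eta> dh) L - foldr (iprod n) vs \<eta> {} * dh L \<in> J"
      by (rule iprods_wedge_eval[OF J hp homog_cps[OF dh] v L])
    then have "foldr (iprod n) vs (wedge \<eta> dh) L - (foldr (iprod n) vs (wedge \<eta> dh) L - foldr (iprod n) vs \<eta> {} * dh L) \<in> J"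
      using 1[OF L] idl_minus[OF J] by blast
    then show "foldr (iprod n) vs \<eta> {} * dh L \<in> J" by simp
  qed
next
  assume all: "\<forall>vs. length vs = p \<and> (\<forall>v\<in>set vs. tangent n J v) \<longrightarrow> foldr (iprod n) vs \<eta> {} \<in> J"
  show "vanishes J (wedge \<eta> dh)" unfolding vanishes_def
  proof (intro allI impI)
    fix K :: "nat set" assume K: "finite K"
    let ?\<tau> = "wedge \<eta> dh"
    have \<tau>: "homog n (p + length hs) ?\<tau>" by (rule homog_wedge[OF \<eta> dh])
    show "?\<tau> K \<in> J"
    proof (rule mem_J_if_associated_prime[OF homog_cps[OF \<tau>]])
      fix Q assume Q: "associated_prime n J Q"
      then have Qp: "prime_idl n Q" by (simp add: associated_prime_def)
      have Qi: "idl n Q" by (rule prime_idl_is_idl[OF Qp])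
      show "?\<tau> K \<in> Q"
      proof (rule ccontr)
        assume nQ: "?\<tau> K \<notin> Q"
        then have "?\<tau> K \<noteq> 0" using idl_0[OF Qi] by metis
        then have Kn: "K \<subseteq> {..<n}" "card K = p + length hs" using homog_sub[OF \<tau>] homog_card[OF \<tau>] by blast+
        have "\<exists>P\<in>Pow K. shuffle_sign P (K - P) * \<eta> P * dh (K - P) \<notin> Q"
        proof (rule ccontr)
          assume "\<not> ?thesis"
          then have "?\<tau> K \<in> Q" unfolding wedge_def by (intro idl_sum[OF Qi]) blast
          then show False using nQ by simp
        qed
        then obtain P where P: "P \<subseteq> K" "shuffle_sign P (K - P) * \<eta> P * dh (K - P) \<notin> Q" by blast
        define L where "L = K - P"
        have L: "dh L \<notin> Q" using P(2) idl_mult[OF Qi, of "shuffle_sign P (K - P) * \<eta> P" "dh L"] homog_cps[OF \<eta>] by (auto simp: L_def)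
        then have "dh L \<noteq> 0" using idl_0[OF Qi] by metis
        then have cL: "card L = length hs" using homog_card[OF dh] by blast
        have Ln: "L \<subseteq> {..<n}" "L \<subseteq> K" "finite L" using Kn K by (auto simp: L_def)
        define ms where "ms = sorted_list_of_set (K - L)"
        have ms: "distinct ms" "set ms = K - L" "length ms = p"
          using K Kn cL Ln by (auto simp: ms_def card_Diff_subset)
        define vs where "vs = map (\<lambda>m. minor_field dh (insert m L)) ms"
        have tan: "tangent n J v" if "v \<in> set vs" for v
          using that Ln K by (auto simp: vs_def intro!: minor_field_tangent[OF homog_cps[OF dh] J differential_wedge_dh])
        have len: "length vs = p" using ms by (simp add: vs_def)
        have "foldr (iprod n) vs \<eta> {} \<in> J" using all tan len by blast
        then have val: "foldr (iprod n) vs \<eta> {} \<in> Q" using associated_prime_sub[OF Q] by blast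
        have v: "(\<forall>i<n. v i \<in> cps n) \<and> vanishes Q (iprod n v dh)" if "v \<in> set vs" for v
        proof
          show vc: "\<forall>i<n. v i \<in> cps n" using tan[OF that] by (auto simp: tangent_def)
          show "vanishes Q (iprod n v dh)"
            by (rule iprod_wedge_differentials_vanishes[OF Qi])
               (use vc tan[OF that] hs_cps hsI IJ associated_prime_sub[OF Q] in \<open>unfold tangent_def, blast+\<close>)
        qed
        have "foldr (iprod n) vs ?\<tau> L - foldr (iprod n) vs \<eta> {} * dh L \<in> Q"
          by (rule iprods_wedge_eval[OF Qi _ homog_cps[OF dh] v]) (use \<eta> len Ln in auto)
        moreover have "foldr (iprod n) vs \<eta> {} * dh L \<in> Q" using idl_mult2[OF Qi _ val] homog_cps[OF dh] by blast
        ultimately have "(foldr (iprod n) vs ?\<tau> L - foldr (iprod n) vs \<eta> {} * dh L) + foldr (iprod n) vs \<eta> {} * dh L \<in> Q"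
          by (rule idl_add[OF Qi])
        then have inQ: "foldr (iprod n) vs ?\<tau> L \<in> Q" by simp
        have "\<exists>s. (s = 1 \<or> s = - 1) \<and> foldr (iprod n) vs ?\<tau> L = s * dh L ^ length ms * ?\<tau> (L \<union> set ms)"
          unfolding vs_def by (rule iprods_minor_fields) (use ms Ln Kn in auto)
        then obtain s where s: "s = 1 \<or> s = - 1" "foldr (iprod n) vs ?\<tau> L = s * dh L ^ length ms * ?\<tau> (L \<union> set ms)" by blast
        have "L \<union> set ms = K" using ms Ln by auto
        then have "s * (dh L ^ length ms * ?\<tau> K) \<in> Q" using inQ s(2) by (simp add: mult.assoc)
        moreover have "s \<in> cps n" using s(1) by auto
        ultimately have "s * (s * (dh L ^ length ms * ?\<tau> K)) \<in> Q" by (rule idl_mult[OF Qi, rotated])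
        then have dQ: "dh L ^ length ms * ?\<tau> K \<in> Q" using s(1) by auto
        have "dh L ^ j * ?\<tau> K \<notin> Q" for j
        proof (induction j)
          case (Suc j)
          have "dh L \<in> cps n" "dh L ^ j * ?\<tau> K \<in> cps n" using homog_cps[OF dh] homog_cps[OF \<tau>] by auto
          then show ?case using prime_idlD[OF Qp, of "dh L" "dh L ^ j * ?\<tau> K"] L Suc by (auto simp: mult.assoc)
        qed (use nQ in simp)
        then show False using dQ by blast
      qed
    qed
  qed
qed

end

section \<open>Ideals and quotients of the ring of convergent power series\<close>

lemma conv_simps [simp]:
  "monoid.mult (conv_ring n) = (*)" "monoid.one (conv_ring n) = 1" "ring.zero (conv_ring n) = 0"
  "ring.add (conv_ring n) = (+)" "module.smult (conv_ring n) = scale_mpser"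
  by (simp_all add: conv_ring_def)

lemma cring_conv: "cring (conv_ring n)"
proof (rule cringI)
  show "abelian_group (conv_ring n)"
  proof (rule abelian_groupI)
    show "\<exists>y\<in>cps n. y \<oplus>\<^bsub>conv_ring n\<^esub> x = \<zero>\<^bsub>conv_ring n\<^esub>" if "x \<in> cps n" for x
      using that by (intro bexI[of _ "- x"]) auto
  qed (auto simp: add_ac)
  show "comm_monoid (conv_ring n)" by (rule comm_monoidI) (auto simp: mult_ac)
qed (auto simp: distrib_right)

interpretation conv: cring "conv_ring n" for n
  by (rule cring_conv)

lemma conv_a_inv [simp]: "x \<in> cps n \<Longrightarrow> a_inv (conv_ring n) x = - x"
  by (rule conv.minus_equality) auto

lemma conv_minus: "x \<in> cps n \<Longrightarrow> y \<in> cps n \<Longrightarrow> x \<ominus>\<^bsub>conv_ring n\<^esub> y = x - y"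
  by (simp add: a_minus_def)

lemma idl_iff_ideal: "idl n K \<longleftrightarrow> ideal K (conv_ring n)"
proof
  assume K: "idl n K"
  show "ideal K (conv_ring n)"
  proof (rule idealI)
    show "ring (conv_ring n)" by (rule conv.ring_axioms)
    show "subgroup K (add_monoid (conv_ring n))"
    proof (rule subgroup.intro)
      show "inv\<^bsub>add_monoid (conv_ring n)\<^esub> x \<in> K" if "x \<in> K" for x
        using conv_a_inv[OF idl_sub[OF K that]] idl_uminus[OF K that] by (simp only: a_inv_def)
    qed (use idl_sub[OF K] idl_0[OF K] idl_add[OF K] in auto)
  qed (use idl_mult[OF K] idl_mult2[OF K] in auto)
next
  assume "ideal K (conv_ring n)"
  then interpret ideal K "conv_ring n" .
  show "idl n K"
    using Icarr additive_subgroup.zero_closed[OF is_additive_subgroup] a_closed I_l_closed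
    by (auto simp: idl_def)
qed

lemma adjoin_list_idl: "idl n K \<Longrightarrow> set xs \<subseteq> cps n \<Longrightarrow> idl n (adjoin_list n K xs)"
  by (induction xs arbitrary: K) (auto simp: idl_adjoin)

lemma adjoin_list_mem: "idl n K \<Longrightarrow> set xs \<subseteq> cps n \<Longrightarrow> set xs \<subseteq> adjoin_list n K xs"
proof (induction xs arbitrary: K)
  case (Cons x xs)
  have "x \<in> adjoin_list n (adjoin n K x) xs" using adjoin_list_sub adjoin_mem[OF Cons.prems(1)] by blast
  then show ?case using Cons.IH[OF idl_adjoin[OF Cons.prems(1)]] Cons.prems by auto
qed simp

lemma adjoin_list_minimal: "idl n L \<Longrightarrow> K \<subseteq> L \<Longrightarrow> set xs \<subseteq> L \<Longrightarrow> adjoin_list n K xs \<subseteq> L"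
  by (induction xs arbitrary: K) (auto simp: adjoin_minimal)

lemma regular_mod_iff: "regular_mod n K xs \<longleftrightarrow> (\<forall>i<length xs. nonzerodivisor_mod n (adjoin_list n K (take i xs)) (xs ! i))"
proof (induction xs arbitrary: K)
  case (Cons x xs)
  then show ?case by (simp add: All_less_Suc2)
qed simp

lemma coset_eq_ideal_iff:
  assumes "ideal I R" "w \<in> carrier R"
  shows "I +>\<^bsub>R\<^esub> w = I \<longleftrightarrow> w \<in> I"
proof -
  interpret ideal I R by fact
  show ?thesis using a_rcos_const a_rcos_self assms(2) by metis
qed

lemma coset_eq_iff:
  assumes "ideal I (conv_ring n)" "a \<in> cps n" "b \<in> cps n"
  shows "I +>\<^bsub>conv_ring n\<^esub> a = I +>\<^bsub>conv_ring n\<^esub> b \<longleftrightarrow> a - b \<in> I"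
  using conv.quotient_eq_iff_same_a_r_cos[OF assms] assms by (simp add: conv_minus)

lemma coset_in_Quot: "a \<in> carrier R \<Longrightarrow> I +>\<^bsub>R\<^esub> a \<in> carrier (R Quot I)"
  by (auto simp: FactRing_def A_RCOSETS_def')

lemma Quot_mult:
  assumes "ideal I R" "a \<in> carrier R" "b \<in> carrier R"
  shows "(I +>\<^bsub>R\<^esub> a) \<otimes>\<^bsub>R Quot I\<^esub> (I +>\<^bsub>R\<^esub> b) = I +>\<^bsub>R\<^esub> (a \<otimes>\<^bsub>R\<^esub> b)"
  using ideal.rcoset_mult_add[OF assms] by (simp add: FactRing_def)

lemma Quot_zero: "\<zero>\<^bsub>R Quot I\<^esub> = I"
  by (simp add: FactRing_def)

lemma Quot_nonzerodivisor:
  assumes I: "ideal I R" and y: "y \<in> carrier R" "I +>\<^bsub>R\<^esub> y \<in> nonzerodivisors (R Quot I)"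
    and z: "z \<in> carrier R" "y \<otimes>\<^bsub>R\<^esub> z \<in> I"
  shows "z \<in> I"
proof -
  interpret ideal I R by fact
  have "(I +>\<^bsub>R\<^esub> y) \<otimes>\<^bsub>R Quot I\<^esub> (I +>\<^bsub>R\<^esub> z) = \<zero>\<^bsub>R Quot I\<^esub>"
    using coset_eq_ideal_iff[OF I, of "y \<otimes>\<^bsub>R\<^esub> z"] y z by (simp add: Quot_mult[OF I] Quot_zero)
  then have "I +>\<^bsub>R\<^esub> z = I" using y(2) coset_in_Quot[OF z(1), of I] by (auto simp: nonzerodivisors_def Quot_zero)
  then show ?thesis using coset_eq_ideal_iff[OF I z(1)] by simp
qed

lemma Quot_reduced:
  assumes I: "ideal I R" and red: "reduced_ring (R Quot I)" and a: "a \<in> carrier R" "a \<otimes>\<^bsub>R\<^esub> a \<in> I"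
  shows "a \<in> I"
proof -
  interpret ideal I R by fact
  let ?x = "I +>\<^bsub>R\<^esub> a"
  interpret Q: ring "R Quot I" by (rule quotient_is_ring)
  have x: "?x \<in> carrier (R Quot I)" using a by (intro coset_in_Quot)
  have "?x [^]\<^bsub>R Quot I\<^esub> (2 :: nat) = ?x \<otimes>\<^bsub>R Quot I\<^esub> ?x"
    using x by (simp add: numeral_2_eq_2)
  also have "\<dots> = \<zero>\<^bsub>R Quot I\<^esub>"
    using coset_eq_ideal_iff[OF I, of "a \<otimes>\<^bsub>R\<^esub> a"] a by (simp add: Quot_mult[OF I] Quot_zero)
  finally have "?x = \<zero>\<^bsub>R Quot I\<^esub>" using red x by (auto simp: reduced_ring_def)
  then show ?thesis using coset_eq_ideal_iff[OF I a(1)] by (simp add: Quot_zero)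
qed

section \<open>Presentations of an analytic algebra\<close>

locale presentation =
  fixes R :: "(complex, 'r) module" and n :: nat and \<pi> :: "mpser \<Rightarrow> 'r"
  assumes R: "cring R" and emb: "embedding n R \<pi>"
begin

sublocale R: cring R by (rule R)

sublocale hom: ring_hom_cring "conv_ring n" R \<pi>
  by (intro ring_hom_cring.intro ring_hom_cring_axioms.intro cring_conv R)
     (use emb in \<open>simp add: embedding_def\<close>)

abbreviation J :: "mpser set" where "J \<equiv> a_kernel (conv_ring n) R \<pi>"

lemma J_iff: "a \<in> J \<longleftrightarrow> a \<in> cps n \<and> \<pi> a = \<zero>\<^bsub>R\<^esub>"
  unfolding a_kernel_def' by blast

lemma pi_closed [simp]: "a \<in> cps n \<Longrightarrow> \<pi> a \<in> carrier R"
  using hom.hom_closed .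

lemma pi_add [simp]: "a \<in> cps n \<Longrightarrow> b \<in> cps n \<Longrightarrow> \<pi> (a + b) = \<pi> a \<oplus>\<^bsub>R\<^esub> \<pi> b"
  using hom.hom_add[of a b] by simp

lemma pi_mult [simp]: "a \<in> cps n \<Longrightarrow> b \<in> cps n \<Longrightarrow> \<pi> (a * b) = \<pi> a \<otimes>\<^bsub>R\<^esub> \<pi> b"
  using hom.hom_mult[of a b] by simp

lemma pi_0 [simp]: "\<pi> 0 = \<zero>\<^bsub>R\<^esub>"
  using hom.hom_zero by simp

lemma pi_1 [simp]: "\<pi> 1 = \<one>\<^bsub>R\<^esub>"
  using hom.hom_one by simp

lemma pi_uminus: "a \<in> cps n \<Longrightarrow> \<pi> (- a) = \<ominus>\<^bsub>R\<^esub> \<pi> a"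
  using hom.hom_a_inv[of a] by simp

lemma pi_scale: "a \<in> cps n \<Longrightarrow> \<pi> (scale_mpser c a) = c \<odot>\<^bsub>R\<^esub> \<pi> a"
  using emb by (simp add: embedding_def)

lemma pi_surj: assumes "r \<in> carrier R" obtains a where "a \<in> cps n" "\<pi> a = r"
proof -
  have "r \<in> \<pi> ` cps n" using assms emb by (simp add: embedding_def)
  then show thesis using that by blast
qed

lemma pi_eq_iff: "a \<in> cps n \<Longrightarrow> b \<in> cps n \<Longrightarrow> \<pi> a = \<pi> b \<longleftrightarrow> a - b \<in> J"
proof -
  assume a: "a \<in> cps n" and b: "b \<in> cps n"
  have "\<pi> (a + - b) = \<pi> a \<ominus>\<^bsub>R\<^esub> \<pi> b" using a b by (simp add: pi_uminus a_minus_def del: add_uminus_conv_diff)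
  then show ?thesis using a b by (simp add: J_iff)
qed

lemma J: "idl n J"
  unfolding idl_def by (auto simp: J_iff)

lemma vimage_idl: assumes "ideal L R" shows "idl n {a \<in> cps n. \<pi> a \<in> L}"
proof -
  interpret ideal L R by fact
  show ?thesis unfolding idl_def using I_l_closed a_closed by (auto simp: additive_subgroup.zero_closed[OF is_additive_subgroup])
qed

lemma image_ideal: assumes K: "idl n K" shows "ideal (\<pi> ` K) R"
proof (rule idealI)
  have Kc: "a \<in> cps n" if "a \<in> K" for a using idl_sub[OF K that] .
  show "ring R" by (rule R.ring_axioms)
  show "subgroup (\<pi> ` K) (add_monoid R)"
  proof (rule subgroup.intro)
    show "\<pi> ` K \<subseteq> carrier (add_monoid R)" using Kc by auto
    show "x \<otimes>\<^bsub>add_monoid R\<^esub> y \<in> \<pi> ` K" if "x \<in> \<pi> ` K" "y \<in> \<pi> ` K" for x y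
      using that Kc idl_add[OF K] by (auto simp flip: pi_add)
    show "\<one>\<^bsub>add_monoid R\<^esub> \<in> \<pi> ` K" using idl_0[OF K] by (auto simp flip: pi_0)
    show "inv\<^bsub>add_monoid R\<^esub> x \<in> \<pi> ` K" if "x \<in> \<pi> ` K" for x
      using that Kc idl_uminus[OF K] by (auto simp: a_inv_def[symmetric] simp flip: pi_uminus)
  qed
  show "x \<otimes>\<^bsub>R\<^esub> a \<in> \<pi> ` K" "a \<otimes>\<^bsub>R\<^esub> x \<in> \<pi> ` K" if ax: "a \<in> \<pi> ` K" "x \<in> carrier R" for a x
  proof -
    obtain b where b: "b \<in> cps n" "x = \<pi> b" using pi_surj[OF ax(2)] by metis
    obtain k where k: "k \<in> K" "a = \<pi> k" using ax by blast
    have "x \<otimes>\<^bsub>R\<^esub> a = \<pi> (b * k)" "a \<otimes>\<^bsub>R\<^esub> x = \<pi> (k * b)" using b k Kc by auto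
    then show "x \<otimes>\<^bsub>R\<^esub> a \<in> \<pi> ` K" "a \<otimes>\<^bsub>R\<^esub> x \<in> \<pi> ` K" using b k idl_mult[OF K] idl_mult2[OF K] by auto
  qed
qed

lemma adjoin_list_J_eq:
  assumes xs: "set xs \<subseteq> cps n"
  shows "adjoin_list n J xs = {a \<in> cps n. \<pi> a \<in> genideal R (\<pi> ` set xs)}"
proof
  have sub: "\<pi> ` set xs \<subseteq> carrier R" using xs by auto
  have G: "ideal (genideal R (\<pi> ` set xs)) R" by (rule R.genideal_ideal[OF sub])
  have "\<pi> ` set xs \<subseteq> genideal R (\<pi> ` set xs)" by (rule R.genideal_self[OF sub])
  moreover have "\<zero>\<^bsub>R\<^esub> \<in> genideal R (\<pi> ` set xs)"
    using additive_subgroup.zero_closed[OF ideal.axioms(1)[OF G]] .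
  ultimately show "adjoin_list n J xs \<subseteq> {a \<in> cps n. \<pi> a \<in> genideal R (\<pi> ` set xs)}"
    using xs by (intro adjoin_list_minimal vimage_idl[OF G]) (auto simp: J_iff)
  have ai: "idl n (adjoin_list n J xs)" by (rule adjoin_list_idl[OF J xs])
  have "genideal R (\<pi> ` set xs) \<subseteq> \<pi> ` adjoin_list n J xs"
    by (rule R.genideal_minimal[OF image_ideal[OF ai]]) (use adjoin_list_mem[OF J xs] in auto)
  then show "{a \<in> cps n. \<pi> a \<in> genideal R (\<pi> ` set xs)} \<subseteq> adjoin_list n J xs"
  proof (intro subsetI)
    fix a assume sub: "genideal R (\<pi> ` set xs) \<subseteq> \<pi> ` adjoin_list n J xs" and a: "a \<in> {a \<in> cps n. \<pi> a \<in> genideal R (\<pi> ` set xs)}"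
    then obtain b where b: "b \<in> adjoin_list n J xs" "\<pi> a = \<pi> b" by blast
    then have "a - b \<in> J" using pi_eq_iff[of a b] a idl_sub[OF ai] by auto
    then have "(a - b) + b \<in> adjoin_list n J xs" using adjoin_list_sub[of J n xs] b idl_add[OF ai] by blast
    then show "a \<in> adjoin_list n J xs" by simp
  qed
qed

text \<open>
  Regular sequences in \<open>R\<close>, expressed by ideals of power series that contain \<open>J\<close>. With the identity
  as presentation this also covers regular sequences of power series.
\<close>

lemma regular_sequence_lift:
  assumes xs: "set xs \<subseteq> cps n" and reg: "regular_sequence R (map \<pi> xs)"
  shows "regular_mod n J xs" "1 \<notin> adjoin_list n J xs"
proof -
  show "regular_mod n J xs"
    unfolding regular_mod_iff
  proof (intro allI impI)
    fix i assume i: "i < length xs"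
    let ?ys = "take i xs"
    have ys: "set ?ys \<subseteq> cps n" using xs set_take_subset by fast
    then have sub: "\<pi> ` set ?ys \<subseteq> carrier R" by auto
    let ?G = "genideal R (\<pi> ` set ?ys)"
    have G: "ideal ?G R" by (rule R.genideal_ideal[OF sub])
    have xi: "xs ! i \<in> cps n" using xs i by auto
    have "?G +>\<^bsub>R\<^esub> \<pi> (xs ! i) \<in> nonzerodivisors (R Quot ?G)"
      using reg i by (auto simp: regular_sequence_def take_map Let_def)
    then show "nonzerodivisor_mod n (adjoin_list n J ?ys) (xs ! i)"
      unfolding nonzerodivisor_mod_def adjoin_list_J_eq[OF ys] using Quot_nonzerodivisor[OF G pi_closed[OF xi]] xi by auto
  qed
  have sub: "\<pi> ` set xs \<subseteq> carrier R" using xs by auto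
  have "\<one>\<^bsub>R\<^esub> \<notin> genideal R (\<pi> ` set xs)"
    using reg ideal.one_imp_carrier[OF R.genideal_ideal[OF sub]] by (auto simp: regular_sequence_def)
  then show "1 \<notin> adjoin_list n J xs" unfolding adjoin_list_J_eq[OF xs] by simp
qed

end

lemma presentation_conv: "presentation (conv_ring n) n id"
  by unfold_locales (auto simp: embedding_def ring_hom_def intro!: conv.cring_axioms[unfolded cring_def])

section \<open>Fundamental forms are congruent to wedge products of differentials\<close>

lemma set_add_coset:
  assumes I: "ideal I R" and J: "ideal J R" and sub: "I \<subseteq> J" and a: "a \<in> carrier R"
  shows "J <+>\<^bsub>R\<^esub> (I +>\<^bsub>R\<^esub> a) = J +>\<^bsub>R\<^esub> a"
proof -
  interpret I: ideal I R by fact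
  interpret J: ideal J R by fact
  show ?thesis
  proof
    show "J <+>\<^bsub>R\<^esub> (I +>\<^bsub>R\<^esub> a) \<subseteq> J +>\<^bsub>R\<^esub> a"
    proof
      fix x assume "x \<in> J <+>\<^bsub>R\<^esub> (I +>\<^bsub>R\<^esub> a)"
      then obtain j i where ji: "j \<in> J" "i \<in> I" "x = j \<oplus>\<^bsub>R\<^esub> (i \<oplus>\<^bsub>R\<^esub> a)"
        by (auto simp: set_add_def' a_r_coset_def')
      then have "x = (j \<oplus>\<^bsub>R\<^esub> i) \<oplus>\<^bsub>R\<^esub> a" using a J.Icarr I.Icarr by (simp add: I.a_assoc)
      moreover have "j \<oplus>\<^bsub>R\<^esub> i \<in> J" using ji sub J.a_closed by blast
      ultimately show "x \<in> J +>\<^bsub>R\<^esub> a" unfolding a_r_coset_def' by blast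
    qed
    show "J +>\<^bsub>R\<^esub> a \<subseteq> J <+>\<^bsub>R\<^esub> (I +>\<^bsub>R\<^esub> a)"
    proof
      fix x assume "x \<in> J +>\<^bsub>R\<^esub> a"
      then obtain j where "j \<in> J" "x = j \<oplus>\<^bsub>R\<^esub> a" by (auto simp: a_r_coset_def')
      moreover have "a \<in> I +>\<^bsub>R\<^esub> a" using a by (rule I.a_rcos_self)
      ultimately show "x \<in> J <+>\<^bsub>R\<^esub> (I +>\<^bsub>R\<^esub> a)" by (auto simp: set_add_def')
    qed
  qed
qed

text \<open>
  The indicator is \<open>a / s\<close> with \<open>a\<close> and \<open>s\<close> congruent modulo \<open>J\<close>, since it restricts to \<open>1\<close> on the germ. The
  defining equation \<open>s \<alpha> = a dh\<close> modulo \<open>I\<close> gives \<open>s (\<alpha> - dh) = 0\<close> modulo \<open>J\<close>, and \<open>s\<close> is a nonzerodivisor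
  there.
\<close>

lemma fundamental_form_congruent:
  assumes ff: "fundamental_form n hs J \<alpha>" and hs: "set hs \<subseteq> cps n"
    and J: "idl n J" and sub: "genideal (conv_ring n) (set hs) \<subseteq> J"
    and L: "L \<subseteq> {..<n}" "card L = length hs"
  shows "\<alpha> L - wedge_differentials hs L \<in> J"
proof -
  let ?A = "conv_ring n"
  define I where "I = genideal ?A (set hs)"
  let ?S = "?A Quot I" and ?T = "?A Quot J"
  have Ii: "ideal I ?A" unfolding I_def by (rule conv.genideal_ideal) (use hs in auto)
  have Ji: "ideal J ?A" using J idl_iff_ideal by simp
  have IJ: "I \<subseteq> J" using sub by (simp add: I_def)
  interpret S: cring ?S by (rule ideal.quotient_is_cring[OF Ii conv.cring_axioms])
  interpret T: cring ?T by (rule ideal.quotient_is_cring[OF Ji conv.cring_axioms])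
  have oneS: "\<one>\<^bsub>?S\<^esub> \<in> nonzerodivisors ?S" and oneT: "\<one>\<^bsub>?T\<^esub> \<in> nonzerodivisors ?T"
    by (auto simp: nonzerodivisors_def)
  define f where "f = \<alpha> L"
  define g where "g = wedge_differentials hs L"
  have fc: "f \<in> cps n" using ff by (auto simp: f_def fundamental_form_def Omega_def Let_def)
  have gc: "g \<in> cps n" unfolding g_def using homog_cps[OF homog_wedge_differentials[OF hs]] .
  obtain e where ind: "is_indicator ?A I J e"
    and e: "fraction ?S (I +>\<^bsub>?A\<^esub> f) \<one>\<^bsub>?S\<^esub> = e \<otimes>\<^bsub>total_frac_ring ?S\<^esub> fraction ?S (I +>\<^bsub>?A\<^esub> g) \<one>\<^bsub>?S\<^esub>"
    using ff L unfolding fundamental_form_def Let_def I_def f_def g_def by blast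
  let ?\<phi> = "\<lambda>K. J <+>\<^bsub>?A\<^esub> K"
  obtain a s where as: "a \<in> carrier ?S" "s \<in> nonzerodivisors ?S" "?\<phi> s \<in> nonzerodivisors ?T"
    "e = fraction ?S a s" "\<one>\<^bsub>total_frac_ring ?T\<^esub> = fraction ?T (?\<phi> a) (?\<phi> s)"
    using ind unfolding is_indicator_def Let_def frac_map_def by blast
  have sc: "s \<in> carrier ?S" using as(2) by (simp add: nonzerodivisors_def)
  obtain a0 where a0: "a0 \<in> cps n" "a = I +>\<^bsub>?A\<^esub> a0" using as(1) by (auto simp: FactRing_def A_RCOSETS_def')
  obtain s0 where s0: "s0 \<in> cps n" "s = I +>\<^bsub>?A\<^esub> s0" using sc by (auto simp: FactRing_def A_RCOSETS_def')
  have fS: "I +>\<^bsub>?A\<^esub> f \<in> carrier ?S" and gS: "I +>\<^bsub>?A\<^esub> g \<in> carrier ?S"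
    using fc gc by (auto intro: coset_in_Quot)
  have m1: "(a, s) \<in> e" using as by (auto simp: fraction_def)
  have m2: "(I +>\<^bsub>?A\<^esub> g, \<one>\<^bsub>?S\<^esub>) \<in> fraction ?S (I +>\<^bsub>?A\<^esub> g) \<one>\<^bsub>?S\<^esub>"
    using gS oneS by (auto simp: fraction_def)
  have m3: "(a \<otimes>\<^bsub>?S\<^esub> (I +>\<^bsub>?A\<^esub> g), s) \<in> fraction ?S (a \<otimes>\<^bsub>?S\<^esub> (I +>\<^bsub>?A\<^esub> g)) (s \<otimes>\<^bsub>?S\<^esub> \<one>\<^bsub>?S\<^esub>)"
    using as gS sc by (simp add: fraction_def)
  have "(a \<otimes>\<^bsub>?S\<^esub> (I +>\<^bsub>?A\<^esub> g), s) \<in> e \<otimes>\<^bsub>total_frac_ring ?S\<^esub> fraction ?S (I +>\<^bsub>?A\<^esub> g) \<one>\<^bsub>?S\<^esub>"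
    unfolding total_frac_ring_def using m1 m2 m3 by force
  then have "(I +>\<^bsub>?A\<^esub> f) \<otimes>\<^bsub>?S\<^esub> s = a \<otimes>\<^bsub>?S\<^esub> (I +>\<^bsub>?A\<^esub> g) \<otimes>\<^bsub>?S\<^esub> \<one>\<^bsub>?S\<^esub>"
    unfolding e[symmetric] by (simp add: fraction_def)
  then have "(I +>\<^bsub>?A\<^esub> f) \<otimes>\<^bsub>?S\<^esub> s = a \<otimes>\<^bsub>?S\<^esub> (I +>\<^bsub>?A\<^esub> g)"
    using as(1) gS by simp
  then have "I +>\<^bsub>?A\<^esub> (f * s0) = I +>\<^bsub>?A\<^esub> (a0 * g)"
    unfolding a0(2) s0(2) using Quot_mult[OF Ii] a0 s0 fc gc by simp
  then have 1: "f * s0 - a0 * g \<in> J" using coset_eq_iff[OF Ii] a0 s0 fc gc IJ by auto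
  have \<phi>a: "?\<phi> a = J +>\<^bsub>?A\<^esub> a0" "?\<phi> s = J +>\<^bsub>?A\<^esub> s0"
    unfolding a0(2) s0(2) using set_add_coset[OF Ii Ji IJ] a0 s0 by auto
  have "(\<one>\<^bsub>?T\<^esub>, \<one>\<^bsub>?T\<^esub>) \<in> \<one>\<^bsub>total_frac_ring ?T\<^esub>"
    using oneT by (simp add: total_frac_ring_def fraction_def)
  then have "?\<phi> a \<otimes>\<^bsub>?T\<^esub> \<one>\<^bsub>?T\<^esub> = \<one>\<^bsub>?T\<^esub> \<otimes>\<^bsub>?T\<^esub> ?\<phi> s"
    unfolding as(5) by (simp add: fraction_def)
  then have "J +>\<^bsub>?A\<^esub> a0 = J +>\<^bsub>?A\<^esub> s0"
    using coset_in_Quot[of a0 ?A J] coset_in_Quot[of s0 ?A J] a0 s0 unfolding \<phi>a by simp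
  then have 2: "a0 - s0 \<in> J" using coset_eq_iff[OF Ji] a0 s0 by auto
  have "(f * s0 - a0 * g) + (a0 - s0) * g \<in> J"
    by (rule idl_add[OF J 1 idl_mult2[OF J gc 2]])
  then have "s0 * (f - g) \<in> J" by (simp add: algebra_simps)
  then have "f - g \<in> J"
    using Quot_nonzerodivisor[OF Ji, of s0 "f - g"] as(3)[unfolded \<phi>a] s0(1) fc gc by simp
  then show ?thesis by (simp add: f_def g_def)
qed

section \<open>Comparing two presentations\<close>

text \<open>
  A monomial is assigned to its first variable.
\<close>

lemma split_off_variables:
  assumes f: "f \<in> cps n"
  obtains g where "\<And>i. i < n \<Longrightarrow> g i \<in> cps n" "f = scale_mpser (coef f 0) 1 + (\<Sum>i<n. coord i * g i)"
proof -
  let ?e = "\<lambda>i. Poly_Mapping.single i (1 :: nat)"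
  define g where "g i = Mpser (\<lambda>m. if \<forall>j\<in>vars m. i \<le> j then coef f (?e i + m) else 0)" for i
  obtain \<rho> B where B: "coef_bound \<rho> f B" using f by (auto simp: cps_iff)
  have gc: "g i \<in> cps n" for i
  proof -
    have "coef_bound \<rho> (g i) (real (nth_prime i) ^ \<rho> * B)" unfolding coef_bound_def
    proof (intro allI impI)
      fix S :: "exponent set" assume S: "finite S"
      have "(\<Sum>m\<in>S. norm (coef (g i) m) / real (weight m) ^ \<rho>)
          \<le> (\<Sum>m\<in>S. real (nth_prime i) ^ \<rho> * (norm (coef f (?e i + m)) / real (weight (?e i + m)) ^ \<rho>))"
      proof (rule sum_mono)
        fix m
        have "nth_prime i \<noteq> 0" using nth_prime_ge_2[of i] by linarith
        then have "real (nth_prime i) ^ \<rho> * (norm (coef f (?e i + m)) / real (weight (?e i + m)) ^ \<rho>) = norm (coef f (?e i + m)) / real (weight m) ^ \<rho>"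
          by (simp add: weight_add weight_single power_mult_distrib)
        then show "norm (coef (g i) m) / real (weight m) ^ \<rho> \<le> real (nth_prime i) ^ \<rho> * (norm (coef f (?e i + m)) / real (weight (?e i + m)) ^ \<rho>)"
          by (simp add: g_def)
      qed
      also have "\<dots> = real (nth_prime i) ^ \<rho> * (\<Sum>m\<in>(+) (?e i) ` S. norm (coef f m) / real (weight m) ^ \<rho>)"
        by (subst sum.reindex) (auto simp: sum_distrib_left)
      also have "\<dots> \<le> real (nth_prime i) ^ \<rho> * B"
        by (rule mult_left_mono) (use B S in \<open>auto simp: coef_bound_def\<close>)
      finally show "(\<Sum>m\<in>S. norm (coef (g i) m) / real (weight m) ^ \<rho>) \<le> real (nth_prime i) ^ \<rho> * B" .
    qed
    moreover have "vars m \<subseteq> {..<n}" if "coef (g i) m \<noteq> 0" for m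
      using that cps_keys[OF f, of "?e i + m"] by (auto simp: g_def keys_add_nat split: if_splits)
    ultimately show ?thesis unfolding cps_iff by blast
  qed
  have coef_g: "coef (coord i * g i) m = (if i \<in> vars m \<and> (\<forall>j\<in>vars m. i \<le> j) then coef f m else 0)" for i m
  proof (cases "i \<in> vars m")
    case True
    define m' where "m' = m - ?e i"
    have m: "m = ?e i + m'"
      unfolding m'_def
      by (rule poly_mapping_eqI) (use True in \<open>auto simp: lookup_add lookup_minus lookup_single when_def in_keys_iff\<close>)
    have k: "vars m = insert i (vars m')" unfolding m keys_add_nat by simp
    have "coef (coord i * g i) m = coef (g i) m'" unfolding m coord_def by (rule coef_mult_monomial)
    also have "\<dots> = (if \<forall>j\<in>vars m. i \<le> j then coef f m else 0)" unfolding k g_def by (simp add: m)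
    finally show ?thesis using True by simp
  next
    case False
    then have "m \<noteq> ?e i + b" for b by (auto simp: keys_add_nat)
    then have "coef (coord i * g i) m = 0" unfolding coord_def by (rule coef_mult_monomial_0)
    then show ?thesis using False by simp
  qed
  have "f = scale_mpser (coef f 0) 1 + (\<Sum>i<n. coord i * g i)"
  proof (rule mpser_eqI)
    fix m
    show "coef f m = coef (scale_mpser (coef f 0) 1 + (\<Sum>i<n. coord i * g i)) m"
    proof (cases "m = 0 \<or> coef f m = 0")
      case True
      then have "(\<Sum>i<n. coef (coord i * g i) m) = 0" unfolding coef_g by (intro sum.neutral) auto
      then show ?thesis using True by (auto simp: coef_simps coef_sum)
    next
      case False
      define i0 where "i0 = Min (vars m)"
      have ne: "vars m \<noteq> {}" using False by simp
      have i0: "i0 \<in> vars m" "\<And>j. j \<in> vars m \<Longrightarrow> i0 \<le> j"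
        using ne by (auto simp: i0_def)
      have "i0 < n" using cps_keys[OF f, of m] False i0(1) by auto
      have "(\<Sum>i<n. coef (coord i * g i) m) = (\<Sum>i<n. if i = i0 then coef f m else 0)"
        unfolding coef_g by (rule sum.cong) (use i0 in \<open>auto intro: antisym\<close>)
      also have "\<dots> = coef f m" using \<open>i0 < n\<close> by simp
      finally show ?thesis using False by (simp add: coef_simps coef_sum)
    qed
  qed
  then show thesis using that gc by blast
qed

lemma pd_1 [simp]: "pd i 1 = 0"
  using pd_mult[of i 1 1] by simp

lemma deriv_1 [simp]: "deriv n v 1 = 0"
  by (simp add: deriv_def)

lemma deriv_0 [simp]: "deriv n v 0 = 0"
  by (simp add: deriv_def)

lemma deriv_sum: "deriv n v (sum f S) = (\<Sum>i\<in>S. deriv n v (f i))"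
  by (induction S rule: infinite_finite_induct) (auto simp: deriv_add)

lemma scale_0 [simp]: "scale_mpser c 0 = 0"
  by (rule mpser_eqI) (simp add: coef_simps)

definition same_image :: "nat \<Rightarrow> (mpser \<Rightarrow> 'r) \<Rightarrow> nat \<Rightarrow> (mpser \<Rightarrow> 'r) \<Rightarrow> mpser \<Rightarrow> mpser \<Rightarrow> bool" where
  "same_image n \<pi> n' \<pi>' a b \<longleftrightarrow> a \<in> cps n \<and> b \<in> cps n' \<and> \<pi> a = \<pi>' b"

lemma same_image_swap: "same_image n \<pi> n' \<pi>' a b \<longleftrightarrow> same_image n' \<pi>' n \<pi> b a"
  by (auto simp: same_image_def)

text \<open>
  The two vector fields preserve the kernels and induce the same derivation of the common image.
\<close>

definition same_derivation ::
  "nat \<Rightarrow> (mpser \<Rightarrow> 'r) \<Rightarrow> nat \<Rightarrow> (mpser \<Rightarrow> 'r) \<Rightarrow> (nat \<Rightarrow> mpser) \<Rightarrow> (nat \<Rightarrow> mpser) \<Rightarrow> bool" where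
  "same_derivation n \<pi> n' \<pi>' v v' \<longleftrightarrow>
     (\<forall>i<n. v i \<in> cps n) \<and> (\<forall>i<n'. v' i \<in> cps n') \<and>
     (\<forall>a b. same_image n \<pi> n' \<pi>' a b \<longrightarrow> same_image n \<pi> n' \<pi>' (deriv n v a) (deriv n' v' b))"

lemma same_derivation_swap: "same_derivation n \<pi> n' \<pi>' v v' \<longleftrightarrow> same_derivation n' \<pi>' n \<pi> v' v"
  unfolding same_derivation_def same_image_swap[of n' \<pi>' n \<pi>] by auto

lemma iprod_cong:
  assumes "finite K" "\<And>J. finite J \<Longrightarrow> \<omega> J = \<omega>' J"
  shows "iprod n v \<omega> K = iprod n v \<omega>' K"
  unfolding iprod_def partial_iprod_def using assms by (intro sum.cong) auto

lemma iprods_scale: "foldr (iprod n) us (\<lambda>J. f * \<omega> J) = (\<lambda>J. f * foldr (iprod n) us \<omega> J)"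
proof (induction us)
  case (Cons u us) then show ?case by (intro ext) (simp add: iprod_scale)
qed simp

lemma iprods_add: "foldr (iprod n) us (\<lambda>J. \<omega> J + \<omega>' J) = (\<lambda>J. foldr (iprod n) us \<omega> J + foldr (iprod n) us \<omega>' J)"
proof (induction us)
  case (Cons u us) then show ?case by (intro ext) (simp add: iprod_add)
qed simp

lemma iprods_diff: "foldr (iprod n) us (\<lambda>J. \<omega> J - \<omega>' J) = (\<lambda>J. foldr (iprod n) us \<omega> J - foldr (iprod n) us \<omega>' J)"
proof (induction us)
  case (Cons u us) then show ?case by (intro ext) (simp add: iprod_diff)
qed simp

lemma iprods_0 [simp]: "foldr (iprod n) us (\<lambda>J. 0) = (\<lambda>J. 0)"
  using iprods_scale[of n us 0 "\<lambda>J. 0"] by simp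

lemma iprods_sum: "foldr (iprod n) us (\<lambda>J. \<Sum>i\<in>S. \<omega> i J) K = (\<Sum>i\<in>S. foldr (iprod n) us (\<omega> i) K)"
  by (induction S rule: infinite_finite_induct) (simp_all add: iprods_add)

lemma iprods_unit: "foldr (iprod n) (u # us) unit_form = (\<lambda>J. 0)"
proof (induction us arbitrary: u)
  case Nil
  show ?case by (intro ext) (auto simp: iprod_def partial_iprod_def unit_form_def intro!: sum.neutral)
next
  case (Cons v us)
  have "iprod n u (\<lambda>J. 0) = (\<lambda>J. 0)" using iprods_0[of n "[u]"] by simp
  then show ?case using Cons[of v] by simp
qed

text \<open>
  The part of the contraction of \<open>dx \<and> \<omega>\<close> with the fields \<open>vs\<close> in which some field meets \<open>dx\<close>. This is the
  Laplace expansion of a determinant along the row of \<open>dx\<close>.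
\<close>

primrec laplace :: "nat \<Rightarrow> mpser \<Rightarrow> form \<Rightarrow> (nat \<Rightarrow> mpser) list \<Rightarrow> form" where
  "laplace n x \<omega> [] = (\<lambda>K. 0)"
| "laplace n x \<omega> (v # vs) =
     (\<lambda>K. iprod n v (laplace n x \<omega> vs) K + ((- 1) ^ length vs * deriv n v x) * foldr (iprod n) vs \<omega> K)"

lemma iprods_differential_wedge:
  "finite K \<Longrightarrow> foldr (iprod n) vs (wedge (differential x) \<omega>) K
     = laplace n x \<omega> vs K + (- 1) ^ length vs * wedge (differential x) (foldr (iprod n) vs \<omega>) K"
proof (induction vs arbitrary: K)
  case (Cons v vs)
  have "foldr (iprod n) (v # vs) (wedge (differential x) \<omega>) K
    = iprod n v (\<lambda>K. laplace n x \<omega> vs K + (- 1) ^ length vs * wedge (differential x) (foldr (iprod n) vs \<omega>) K) K"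
    unfolding foldr_Cons comp_def by (rule iprod_cong[OF Cons.prems Cons.IH])
  also have "\<dots> = iprod n v (laplace n x \<omega> vs) K + (- 1) ^ length vs * (deriv n v x * foldr (iprod n) vs \<omega> K
      - wedge (differential x) (iprod n v (foldr (iprod n) vs \<omega>)) K)"
    by (simp only: iprod_add iprod_scale iprod_differential_wedge[OF Cons.prems])
  finally show ?case by (simp add: algebra_simps)
qed simp

locale two_presentations =
  P: presentation R n \<pi> + P': presentation R n' \<pi>'
  for R :: "(complex, 'r) module" and n \<pi> n' \<pi>'
begin

abbreviation E where "E \<equiv> same_image n \<pi> n' \<pi>'"
abbreviation V where "V \<equiv> same_derivation n \<pi> n' \<pi>'"

lemma E_0 [simp]: "E 0 0" and E_1 [simp]: "E 1 1"
  by (auto simp: same_image_def)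

lemma E_add: "E a b \<Longrightarrow> E c d \<Longrightarrow> E (a + c) (b + d)"
  by (auto simp: same_image_def)

lemma E_mult: "E a b \<Longrightarrow> E c d \<Longrightarrow> E (a * c) (b * d)"
  by (auto simp: same_image_def)

lemma E_uminus: "E a b \<Longrightarrow> E (- a) (- b)"
  by (auto simp: same_image_def P.pi_uminus P'.pi_uminus)

lemma E_scale: "E a b \<Longrightarrow> E (scale_mpser c a) (scale_mpser c b)"
  by (auto simp: same_image_def P.pi_scale P'.pi_scale)

lemma E_sum: "(\<And>i. i \<in> S \<Longrightarrow> E (a i) (b i)) \<Longrightarrow> E (sum a S) (sum b S)"
  by (induction S rule: infinite_finite_induct) (auto intro: E_add)

lemma E_sign: "E ((- 1) ^ k) ((- 1) ^ k)"
  by (cases "even k") (auto intro: E_uminus[OF E_1])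

lemma E_right: assumes "a \<in> cps n" shows "\<exists>b. E a b"
  using P'.pi_surj[OF P.pi_closed[OF assms]] assms by (metis same_image_def)

lemma E_left: assumes "b \<in> cps n'" shows "\<exists>a. E a b"
  using P.pi_surj[OF P'.pi_closed[OF assms]] assms by (metis same_image_def)

text \<open>
  Choose \<open>v'\<close> with the right values on the coordinates. Splitting off variables shows, by induction on
  \<open>N\<close>, that both derivations agree on every series up to an error of order \<open>N ln 2\<close>. By Krull's
  intersection theorem they agree.
\<close>

lemma tangent_transfer:
  assumes v: "tangent n P.J v"
  obtains v' where "tangent n' P'.J v'" "V v v'"
proof -
  have vc: "\<And>i. i < n \<Longrightarrow> v i \<in> cps n" and vJ: "\<And>f. f \<in> P.J \<Longrightarrow> deriv n v f \<in> P.J"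
    using v by (auto simp: tangent_def)
  have dc: "deriv n v a \<in> cps n" if "a \<in> cps n" for a by (rule deriv_cps[OF vc that])
  have wd: "\<pi> (deriv n v a) = \<pi> (deriv n v a')" if "a \<in> cps n" "a' \<in> cps n" "\<pi> a = \<pi> a'" for a a'
  proof -
    have "a - a' \<in> P.J" using P.pi_eq_iff that by blast
    then have "deriv n v a - deriv n v a' \<in> P.J" using vJ by (simp flip: deriv_diff)
    then show ?thesis using P.pi_eq_iff dc that by blast
  qed
  have "\<exists>a. E a (coord i)" if "i < n'" for i by (rule E_left) (use that in simp)
  then obtain x where x: "\<And>i. i < n' \<Longrightarrow> E (x i) (coord i)" by metis
  have "\<exists>y. E (deriv n v (x i)) y" if "i < n'" for i
    using E_right[OF dc, of "x i"] x[OF that] by (auto simp: same_image_def)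
  then obtain v' where v': "\<And>i. i < n' \<Longrightarrow> E (deriv n v (x i)) (v' i)" by metis
  have v'c: "v' i \<in> cps n'" if "i < n'" for i using v'[OF that] by (simp add: same_image_def)
  have dc': "deriv n' v' b \<in> cps n'" if "b \<in> cps n'" for b by (rule deriv_cps[OF v'c that])
  have step: "\<exists>g. ord_ge g (real N * ln 2) \<and> E (deriv n v a) (deriv n' v' b + g)" if "E a b" for N a b
    using that
  proof (induction N arbitrary: a b)
    case 0
    then have ab: "a \<in> cps n" "b \<in> cps n'" by (auto simp: same_image_def)
    obtain y where "E (deriv n v a) y" using E_right[OF dc[OF ab(1)]] by blast
    then show ?case by (intro exI[of _ "y - deriv n' v' b"]) simp
  next
    case (Suc N)
    then have ab: "a \<in> cps n" "b \<in> cps n'" "\<pi> a = \<pi>' b" by (auto simp: same_image_def)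
    obtain bs where bs: "\<And>i. i < n' \<Longrightarrow> bs i \<in> cps n'" "b = scale_mpser (coef b 0) 1 + (\<Sum>i<n'. coord i * bs i)"
      using split_off_variables[OF ab(2)] by blast
    have "\<exists>a. E a (bs i)" if "i < n'" for i by (rule E_left[OF bs(1)[OF that]])
    then obtain as where as: "\<And>i. i < n' \<Longrightarrow> E (as i) (bs i)" by metis
    have "\<exists>g. ord_ge g (real N * ln 2) \<and> E (deriv n v (as i)) (deriv n' v' (bs i) + g)" if "i < n'" for i
      by (rule Suc.IH[OF as[OF that]])
    then obtain gs where gs: "\<And>i. i < n' \<Longrightarrow> ord_ge (gs i) (real N * ln 2)"
      "\<And>i. i < n' \<Longrightarrow> E (deriv n v (as i)) (deriv n' v' (bs i) + gs i)" by metis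
    define a' where "a' = scale_mpser (coef b 0) 1 + (\<Sum>i<n'. x i * as i)"
    have "E a' (scale_mpser (coef b 0) 1 + (\<Sum>i<n'. coord i * bs i))" unfolding a'_def
      using x as by (intro E_add E_scale E_1 E_sum E_mult) auto
    then have Ea': "E a' b" by (simp flip: bs(2))
    then have "\<pi> (deriv n v a) = \<pi> (deriv n v a')" using ab by (intro wd) (auto simp: same_image_def)
    moreover have "E (deriv n v a') (deriv n' v' b + (\<Sum>i<n'. coord i * gs i))"
    proof -
      have "E (\<Sum>i<n'. deriv n v (x i) * as i + x i * deriv n v (as i))
          (\<Sum>i<n'. v' i * bs i + coord i * (deriv n' v' (bs i) + gs i))"
        using v' as x gs(2) by (intro E_sum E_add E_mult) auto
      moreover have "deriv n v a' = (\<Sum>i<n'. deriv n v (x i) * as i + x i * deriv n v (as i))"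
        by (simp add: a'_def deriv_add deriv_scale deriv_sum deriv_mult)
      moreover have "deriv n' v' b + (\<Sum>i<n'. coord i * gs i) = (\<Sum>i<n'. v' i * bs i + coord i * (deriv n' v' (bs i) + gs i))"
      proof -
        have "deriv n' v' b = (\<Sum>i<n'. v' i * bs i + coord i * deriv n' v' (bs i))"
          by (subst bs(2)) (simp add: deriv_add deriv_scale deriv_sum deriv_mult deriv_coord)
        then show ?thesis by (simp add: sum.distrib distrib_left)
      qed
      ultimately show ?thesis by simp
    qed
    ultimately have "E (deriv n v a) (deriv n' v' b + (\<Sum>i<n'. coord i * gs i))"
      using dc[OF ab(1)] by (auto simp: same_image_def)
    moreover have "ord_ge (\<Sum>i<n'. coord i * gs i) (real (Suc N) * ln 2)"
    proof (rule ord_ge_sum)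
      fix i assume "i \<in> {..<n'}"
      have "ord_ge (coord i) (ln 2)" using nth_prime_ge_2[of i]
        by (auto simp: ord_ge_def coord_def coef_monomial lweight_def weight_single split: if_splits)
      then have "ord_ge (coord i * gs i) (ln 2 + real N * ln 2)" using gs(1)[of i] \<open>i \<in> _\<close> by (intro ord_ge_mult) auto
      then show "ord_ge (coord i * gs i) (real (Suc N) * ln 2)" by (simp add: algebra_simps)
    qed
    ultimately show ?case by blast
  qed
  have main: "E (deriv n v a) (deriv n' v' b)" if ab: "E a b" for a b
  proof -
    have abc: "a \<in> cps n" "b \<in> cps n'" using ab by (auto simp: same_image_def)
    obtain y where y: "E (deriv n v a) y" using E_right[OF dc[OF abc(1)]] by blast
    then have yc: "y \<in> cps n'" by (simp add: same_image_def)
    have "y - deriv n' v' b \<in> P'.J"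
    proof (rule mem_if_near[OF P'.J])
      show "y - deriv n' v' b \<in> cps n'" using yc dc'[OF abc(2)] by simp
      fix t
      obtain N where N: "real N * ln 2 > t" using ex_less_of_nat_mult[of "ln 2" t] by auto
      obtain g where g: "ord_ge g (real N * ln 2)" "E (deriv n v a) (deriv n' v' b + g)" using step[OF ab] by blast
      have "y - (deriv n' v' b + g) \<in> P'.J"
        using P'.pi_eq_iff[of y "deriv n' v' b + g"] y g(2) by (auto simp: same_image_def)
      then show "near P'.J (y - deriv n' v' b) t" unfolding near_def
        by (rule bexI[rotated]) (use g(1) N in \<open>auto intro: ord_ge_mono\<close>)
    qed
    then show ?thesis using P'.pi_eq_iff[OF yc dc'[OF abc(2)]] y dc'[OF abc(2)] by (auto simp: same_image_def)
  qed
  have "tangent n' P'.J v'" unfolding tangent_def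
  proof (intro conjI allI impI ballI v'c)
    fix f assume "f \<in> P'.J"
    then have "E 0 f" by (simp add: same_image_def P'.J_iff)
    from main[OF this] show "deriv n' v' f \<in> P'.J" by (simp add: same_image_def P'.J_iff)
  qed
  moreover have "V v v'" using vc v'c main by (auto simp: same_derivation_def)
  ultimately show thesis by (rule that)
qed

text \<open>
  The forms need not be related coefficientwise; only their values on derivations of \<open>R\<close> are compared.
\<close>

definition same_values :: "form \<Rightarrow> form \<Rightarrow> bool" where
  "same_values \<omega> \<omega>' \<longleftrightarrow> (\<forall>us us'. list_all2 V us us' \<longrightarrow>
     E (foldr (iprod n) us \<omega> {}) (foldr (iprod n') us' \<omega>' {}))"

lemma same_values_laplace:
  assumes vs: "list_all2 V vs vs'" and us: "list_all2 V us us'"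
    and \<omega>: "same_values \<omega> \<omega>'" and x: "E x x'"
  shows "E (foldr (iprod n) us (laplace n x \<omega> vs) {}) (foldr (iprod n') us' (laplace n' x' \<omega>' vs') {})"
  using vs us
proof (induction vs vs' arbitrary: us us' rule: list_all2_induct)
  case (Cons v vs v' vs')
  have "E (foldr (iprod n) (us @ [v]) (laplace n x \<omega> vs) {}) (foldr (iprod n') (us' @ [v']) (laplace n' x' \<omega>' vs') {})"
    using Cons by (intro Cons.IH) (simp add: list_all2_appendI)
  moreover have "E (foldr (iprod n) (us @ vs) \<omega> {}) (foldr (iprod n') (us' @ vs') \<omega>' {})"
    using \<omega> list_all2_appendI[OF Cons.prems Cons.hyps(2)] unfolding same_values_def by blast
  moreover have "E (deriv n v x) (deriv n' v' x')" using Cons.hyps(1) x by (auto simp: same_derivation_def)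
  moreover have "length vs = length vs'" using Cons.hyps(2) by (rule list_all2_lengthD)
  ultimately show ?case
    by (simp add: iprods_add iprods_scale) (intro E_add E_mult E_sign; assumption)
qed simp

lemma same_values_wedge_differential:
  assumes \<omega>: "same_values \<omega> \<omega>'" and x: "E x x'"
  shows "same_values (wedge (differential x) \<omega>) (wedge (differential x') \<omega>')"
  unfolding same_values_def
proof (intro allI impI)
  fix us us' assume us: "list_all2 V us us'"
  have 0: "wedge (differential y) \<eta> {} = 0" for y \<eta> by (simp add: wedge_differential)
  show "E (foldr (iprod n) us (wedge (differential x) \<omega>) {}) (foldr (iprod n') us' (wedge (differential x') \<omega>') {})"
    using same_values_laplace[OF us _ \<omega> x, of "[]" "[]"] by (simp add: iprods_differential_wedge 0)
qed

lemma same_values_unit: "same_values unit_form unit_form"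
  unfolding same_values_def
proof (intro allI impI)
  fix us us' assume "list_all2 V us us'"
  then show "E (foldr (iprod n) us unit_form {}) (foldr (iprod n') us' unit_form {})"
  proof (cases us us' rule: list.exhaust[case_product list.exhaust])
    case Nil_Nil then show ?thesis by (simp add: unit_form_def)
  next
    case (Cons_Cons v vs v' vs') then show ?thesis using iprods_unit[of n v vs] iprods_unit[of n' v' vs'] by simp
  qed simp_all
qed

lemma same_values_wedge_differentials:
  "list_all2 E xs xs' \<Longrightarrow> same_values (wedge_differentials xs) (wedge_differentials xs')"
  by (induction xs xs' rule: list_all2_induct) (auto intro: same_values_unit same_values_wedge_differential)

lemma same_values_sum:
  assumes "\<And>i. i \<in> S \<Longrightarrow> E (a i) (a' i)" "\<And>i. i \<in> S \<Longrightarrow> same_values (\<omega> i) (\<omega>' i)"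
  shows "same_values (\<lambda>J. \<Sum>i\<in>S. a i * \<omega> i J) (\<lambda>J. \<Sum>i\<in>S. a' i * \<omega>' i J)"
  using assms unfolding same_values_def by (auto simp: iprods_sum iprods_scale intro!: E_sum E_mult)

lemma same_values_add:
  "same_values \<omega> \<omega>' \<Longrightarrow> same_values \<eta> \<eta>' \<Longrightarrow> same_values (\<lambda>J. \<omega> J + \<eta> J) (\<lambda>J. \<omega>' J + \<eta>' J)"
  unfolding same_values_def by (auto simp: iprods_add intro: E_add)

lemma same_values_scale:
  "E a a' \<Longrightarrow> same_values \<omega> \<omega>' \<Longrightarrow> same_values (\<lambda>J. a * \<omega> J) (\<lambda>J. a' * \<omega>' J)"
  unfolding same_values_def by (auto simp: iprods_scale intro: E_mult)

end

lemma wedge_differentials_variables: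
  assumes "sorted_wrt (<) is"
  shows "wedge_differentials (map coord is) K = (if K = set is then 1 else 0)"
  using assms
proof (induction "is" arbitrary: K)
  case Nil then show ?case by (simp add: unit_form_def)
next
  case (Cons i "is")
  show ?case
  proof (cases "finite K")
    case False
    then show ?thesis by (auto simp: wedge_infinite)
  next
    case True
    have i: "i \<notin> set is" "\<And>j. j \<in> set is \<Longrightarrow> i < j" using Cons.prems by auto
    have "{(j, l). j \<in> {i} \<and> l \<in> set is \<and> l < j} = {}" using i(2) by (auto dest: less_asym)
    then have sg: "shuffle_sign {i} (set is) = 1" unfolding shuffle_sign_def by (simp only: card.empty power_0)
    have "wedge_differentials (map coord (i # is)) K = (\<Sum>j\<in>K. if j = i \<and> K - {i} = set is then 1 else 0)"
      using Cons sg by (simp add: wedge_differential[OF True]) (intro sum.cong, auto simp: pd_coord)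
    also have "\<dots> = (if K = set (i # is) then 1 else 0)"
      using True i(1) by (cases "K - {i} = set is") (auto simp: sum.delta)
    finally show ?thesis .
  qed
qed

text \<open>
  Replace each coordinate by a series of the other presentation with the same image in \<open>R\<close>, and likewise
  for the coefficients. Values on derivations only depend on these images.
\<close>

lemma (in two_presentations) pull_back:
  assumes \<eta>: "homog n p \<eta>"
  obtains \<eta>' where "homog n' p \<eta>'" "same_values \<eta> \<eta>'"
proof -
  let ?S = "{P. P \<subseteq> {..<n} \<and> card P = p}"
  have fS: "finite ?S" by (rule finite_subset[of _ "Pow {..<n}"]) auto
  have fP: "finite P" if "P \<in> ?S" for P using that finite_subset[of P "{..<n}"] by auto
  have "\<exists>b. E (coord i) b" if "i < n" for i by (rule E_right) (use that in simp)
  then obtain y where y: "\<And>i. i < n \<Longrightarrow> E (coord i) (y i)" by metis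
  have "\<forall>P. \<exists>b. E (\<eta> P) b" by (rule allI, rule E_right[OF homog_cps[OF \<eta>]])
  then have "\<exists>b. \<forall>P. E (\<eta> P) (b P)" by (rule choice)
  then obtain b where b: "\<And>P. E (\<eta> P) (b P)" by blast
  let ?l = "sorted_list_of_set :: nat set \<Rightarrow> nat list"
  define \<eta>' where "\<eta>' K = (\<Sum>P\<in>?S. b P * wedge_differentials (map y (?l P)) K)" for K
  have \<eta>_eq: "\<eta> = (\<lambda>K. \<Sum>P\<in>?S. \<eta> P * wedge_differentials (map coord (?l P)) K)"
  proof
    fix K
    have "(\<Sum>P\<in>?S. \<eta> P * wedge_differentials (map coord (?l P)) K) = (\<Sum>P\<in>?S. if P = K then \<eta> K else 0)"
    proof (rule sum.cong)
      fix P assume "P \<in> ?S"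
      then show "\<eta> P * wedge_differentials (map coord (?l P)) K = (if P = K then \<eta> K else 0)"
        using fP[of P] by (simp add: wedge_differentials_variables)
    qed simp
    also have "\<dots> = \<eta> K" using fS homog_sub[OF \<eta>, of K] homog_card[OF \<eta>, of K] by auto
    finally show "\<eta> K = (\<Sum>P\<in>?S. \<eta> P * wedge_differentials (map coord (?l P)) K)" by simp
  qed
  have "same_values \<eta> \<eta>'"
  proof (subst \<eta>_eq, unfold \<eta>'_def, rule same_values_sum[OF b])
    fix P assume P: "P \<in> ?S"
    then have "list_all2 E (map coord (?l P)) (map y (?l P))"
      using y fP[OF P] by (auto simp: list_all2_map1 list_all2_map2 intro!: list.rel_refl_strong)
    then show "same_values (wedge_differentials (map coord (?l P))) (wedge_differentials (map y (?l P)))"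
      by (rule same_values_wedge_differentials)
  qed
  moreover have "homog n' p \<eta>'"
  proof -
    have h: "homog n' p (wedge_differentials (map y (?l P)))" if P: "P \<in> ?S" for P
    proof -
      have "set (map y (?l P)) \<subseteq> cps n'" using y P fP[OF P] by (auto simp: same_image_def)
      then have "homog n' (length (map y (?l P))) (wedge_differentials (map y (?l P)))" by (rule homog_wedge_differentials)
      then show ?thesis using P by simp
    qed
    show ?thesis unfolding homog_def
    proof (intro conjI allI impI)
      show "\<eta>' K \<in> cps n'" for K unfolding \<eta>'_def
        using b by (intro cps_sum cps_mult homog_cps[OF h]) (auto simp: same_image_def)
      fix K assume nz: "\<eta>' K \<noteq> 0"
      have "\<exists>P\<in>?S. wedge_differentials (map y (?l P)) K \<noteq> 0"
      proof (rule ccontr)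
        assume "\<not> ?thesis"
        then have "\<eta>' K = 0" unfolding \<eta>'_def by (intro sum.neutral) simp
        then show False using nz by simp
      qed
      then obtain P where P: "P \<in> ?S" "wedge_differentials (map y (?l P)) K \<noteq> 0" by blast
      show "K \<subseteq> {..<n'}" by (rule homog_sub[OF h[OF P(1)] P(2)])
      show "card K = p" by (rule homog_card[OF h[OF P(1)] P(2)])
    qed
  qed
  ultimately show thesis using that by blast
qed

section \<open>Multivector fields and the Jacobian module\<close>

lemma Omega_iff: "\<omega> \<in> carrier (Omega n (int m)) \<longleftrightarrow> homog n m \<omega>"
  by (auto simp: Omega_def homog_def)

lemma Omega_simps [simp]:
  "ring.add (Omega n q) = (\<lambda>\<omega> \<eta> J. \<omega> J + \<eta> J)" "module.smult (Omega n q) = (\<lambda>f \<omega> J. f * \<omega> J)"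
  by (simp_all add: Omega_def)

lemma self_module_simps [simp]:
  "carrier (self_module S) = carrier S" "ring.add (self_module S) = ring.add S"
  "module.smult (self_module S) = monoid.mult S"
  by (simp_all add: self_module_def)

definition basis_form :: "nat set \<Rightarrow> form" where
  "basis_form L J = (if J = L then 1 else 0)"

lemma homog_basis_form: "L \<subseteq> {..<n} \<Longrightarrow> homog n (card L) (basis_form L)"
  by (auto simp: homog_def basis_form_def)

lemma homog_add: "homog n k \<omega> \<Longrightarrow> homog n k \<eta> \<Longrightarrow> homog n k (\<lambda>J. \<omega> J + \<eta> J)"
  unfolding homog_def by (metis (no_types, lifting) add_0 cps_add)

lemma homog_scale: "f \<in> cps n \<Longrightarrow> homog n k \<omega> \<Longrightarrow> homog n k (\<lambda>J. f * \<omega> J)"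
  unfolding homog_def by (metis (no_types, lifting) mult_zero_right cps_mult)

lemma homog_diff: "homog n k \<omega> \<Longrightarrow> homog n k \<eta> \<Longrightarrow> homog n k (\<lambda>J. \<omega> J - \<eta> J)"
  using homog_add[of n k \<omega> "\<lambda>J. (- 1) * \<eta> J"] homog_scale[of "- 1" n k \<eta>] by simp

lemma homog_0: "homog n k (\<lambda>J. 0)"
  by (simp add: homog_def)

lemma wedge_top:
  "wedge \<eta> \<omega> {..<n} = (\<Sum>L\<in>Pow {..<n}. shuffle_sign ({..<n} - L) L * \<eta> ({..<n} - L) * \<omega> L)"
  unfolding wedge_def
  by (rule sum.reindex_bij_witness[where i = "\<lambda>L. {..<n} - L" and j = "\<lambda>P. {..<n} - P"])
     (auto simp: double_diff)

text \<open>
  The top degree coefficient of \<open>\<eta> \<and> \<omega>\<close> is a perfect pairing between forms of complementary degrees. The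
  coefficient of \<open>\<eta>\<close> at \<open>P\<close> is the value of \<open>\<delta>\<close> on the basis form of the complement, up to the sign of
  the shuffle.
\<close>

lemma Theta_eq:
  assumes p: "p \<le> n"
  shows "Theta n (int n - int p) =
    (\<lambda>\<eta>. \<lambda>\<omega>\<in>carrier (Omega n (int n - int p)). wedge \<eta> \<omega> {..<n}) ` {\<eta>. homog n p \<eta>}"
proof -
  let ?N = "{..<n}" and ?\<Omega> = "carrier (Omega n (int n - int p))"
  have q: "int n - int p = int (n - p)" using p by simp
  have \<Omega>: "\<omega> \<in> ?\<Omega> \<longleftrightarrow> homog n (n - p) \<omega>" for \<omega> unfolding q by (rule Omega_iff)
  show ?thesis
  proof (intro equalityI subsetI)
    fix \<delta> assume "\<delta> \<in> Theta n (int n - int p)"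
    then have \<delta>: "\<delta> \<in> extensional ?\<Omega>" "\<And>\<omega>. homog n (n - p) \<omega> \<Longrightarrow> \<delta> \<omega> \<in> cps n"
      "\<And>\<omega> \<omega>'. homog n (n - p) \<omega> \<Longrightarrow> homog n (n - p) \<omega>' \<Longrightarrow> \<delta> (\<lambda>J. \<omega> J + \<omega>' J) = \<delta> \<omega> + \<delta> \<omega>'"
      "\<And>f \<omega>. f \<in> cps n \<Longrightarrow> homog n (n - p) \<omega> \<Longrightarrow> \<delta> (\<lambda>J. f * \<omega> J) = f * \<delta> \<omega>"
      by (auto simp: Theta_def mod_hom_def \<Omega> PiE_def Pi_def)
    have \<delta>0: "\<delta> (\<lambda>J. 0) = 0" using \<delta>(4)[of 0 "\<lambda>J. 0"] homog_0 by simp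
    let ?S = "{L. L \<subseteq> ?N \<and> card L = n - p}"
    have fS: "finite ?S" by (rule finite_subset[of _ "Pow ?N"]) auto
    have hb: "homog n (n - p) (basis_form L)" if "L \<in> ?S" for L using homog_basis_form[of L n] that by auto
    have lin: "homog n (n - p) (\<lambda>J. \<Sum>L\<in>T. \<omega> L * basis_form L J) \<and>
        \<delta> (\<lambda>J. \<Sum>L\<in>T. \<omega> L * basis_form L J) = (\<Sum>L\<in>T. \<omega> L * \<delta> (basis_form L))"
      if "T \<subseteq> ?S" "\<And>L. \<omega> L \<in> cps n" for T \<omega>
      using finite_subset[OF that(1) fS] that(1)
    proof (induction T rule: finite_induct)
      case empty then show ?case by (simp add: homog_0 \<delta>0)
    next
      case (insert L T)
      then have 1: "homog n (n - p) (\<lambda>J. \<omega> L * basis_form L J)" using that(2) hb by (intro homog_scale) auto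
      have 2: "homog n (n - p) (\<lambda>J. \<Sum>L\<in>T. \<omega> L * basis_form L J)" using insert by simp
      show ?case using insert homog_add[OF 1 2] \<delta>(3)[OF 1 2] \<delta>(4)[OF that(2) hb] by simp
    qed
    have expand: "\<delta> \<omega> = (\<Sum>L\<in>?S. \<omega> L * \<delta> (basis_form L))" if \<omega>: "homog n (n - p) \<omega>" for \<omega>
    proof -
      have "\<omega> = (\<lambda>J. \<Sum>L\<in>?S. \<omega> L * basis_form L J)"
      proof
        fix J
        have "(\<Sum>L\<in>?S. \<omega> L * basis_form L J) = (\<Sum>L\<in>?S. if L = J then \<omega> J else 0)"
          by (rule sum.cong) (auto simp: basis_form_def)
        also have "\<dots> = \<omega> J" using fS homog_sub[OF \<omega>, of J] homog_card[OF \<omega>, of J] by auto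
        finally show "\<omega> J = (\<Sum>L\<in>?S. \<omega> L * basis_form L J)" by simp
      qed
      then show ?thesis using lin[of ?S \<omega>] homog_cps[OF \<omega>] by simp
    qed
    define \<eta> where "\<eta> P = (if P \<subseteq> ?N \<and> card P = p then shuffle_sign P (?N - P) * \<delta> (basis_form (?N - P)) else 0)" for P
    have cN: "card (?N - P) = n - card P" if "P \<subseteq> ?N" for P using that by (simp add: card_Diff_subset finite_subset)
    have h\<eta>: "homog n p \<eta>" unfolding homog_def
    proof (intro conjI allI impI)
      show "\<eta> P \<in> cps n" for P unfolding \<eta>_def using \<delta>(2)[OF hb] cN by auto
    qed (auto simp: \<eta>_def split: if_splits)
    have "\<delta> = (\<lambda>\<omega>\<in>?\<Omega>. wedge \<eta> \<omega> ?N)"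
    proof (rule extensionalityI[OF \<delta>(1)])
      fix \<omega> assume "\<omega> \<in> ?\<Omega>"
      then have \<omega>: "homog n (n - p) \<omega>" using \<Omega> by simp
      have "wedge \<eta> \<omega> ?N = (\<Sum>L\<in>?S. \<omega> L * \<delta> (basis_form L))" unfolding wedge_top
      proof (rule sum.mono_neutral_cong_right)
        show "\<forall>L\<in>Pow ?N - ?S. shuffle_sign (?N - L) L * \<eta> (?N - L) * \<omega> L = 0"
        proof
          fix L assume "L \<in> Pow ?N - ?S"
          then have "\<omega> L = 0" using homog_card[OF \<omega>, of L] by blast
          then show "shuffle_sign (?N - L) L * \<eta> (?N - L) * \<omega> L = 0" by simp
        qed
        fix L assume L: "L \<in> ?S"
        then have "card (?N - L) = p" "?N - (?N - L) = L" using cN[of L] p by auto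
        then show "shuffle_sign (?N - L) L * \<eta> (?N - L) * \<omega> L = \<omega> L * \<delta> (basis_form L)"
          by (simp add: \<eta>_def mult_ac)
      qed auto
      then show "\<delta> \<omega> = (\<lambda>\<omega>\<in>?\<Omega>. wedge \<eta> \<omega> ?N) \<omega>" using expand[OF \<omega>] \<open>\<omega> \<in> ?\<Omega>\<close> by simp
    qed simp
    then show "\<delta> \<in> (\<lambda>\<eta>. \<lambda>\<omega>\<in>?\<Omega>. wedge \<eta> \<omega> ?N) ` {\<eta>. homog n p \<eta>}" using h\<eta> by blast
  next
    fix \<delta> assume "\<delta> \<in> (\<lambda>\<eta>. \<lambda>\<omega>\<in>?\<Omega>. wedge \<eta> \<omega> ?N) ` {\<eta>. homog n p \<eta>}"
    then obtain \<eta> where \<eta>: "homog n p \<eta>" "\<delta> = (\<lambda>\<omega>\<in>?\<Omega>. wedge \<eta> \<omega> ?N)" by blast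
    show "\<delta> \<in> Theta n (int n - int p)"
      unfolding Theta_def mod_hom_def \<eta>(2)
      using homog_add homog_scale wedge_cps[OF homog_cps[OF \<eta>(1)] homog_cps]
      by (auto simp: \<Omega> wedge_add_right wedge_scale_right)
  qed
qed

definition contracted :: "nat \<Rightarrow> (mpser \<Rightarrow> 'r) \<Rightarrow> nat \<Rightarrow> form \<Rightarrow> nat \<Rightarrow> form \<Rightarrow> form \<Rightarrow> 'r" where
  "contracted n \<pi> k \<alpha> p \<eta> = (\<lambda>\<omega>\<in>carrier (Omega n (int n - int p - int k)). \<pi> (wedge (wedge \<eta> \<alpha>) \<omega> {..<n}))"

lemma wedge_Omega:
  assumes \<alpha>: "homog n k \<alpha>" and \<omega>: "\<omega> \<in> carrier (Omega n (q - int k))"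
  shows "wedge \<alpha> \<omega> \<in> carrier (Omega n q)"
proof (cases "q - int k < 0")
  case True
  have "\<omega> J = 0" for J
  proof (rule ccontr)
    assume "\<omega> J \<noteq> 0"
    then have "int (card J) = q - int k" using \<omega> by (auto simp: Omega_def)
    then show False using True by simp
  qed
  then show ?thesis by (simp add: wedge_def Omega_def)
next
  case False
  then obtain m where m: "q - int k = int m" using nonneg_int_cases[of "q - int k"] by force
  then have "q = int (k + m)" by simp
  moreover have "homog n m \<omega>" using \<omega> unfolding m Omega_iff .
  ultimately show ?thesis using homog_wedge[OF \<alpha>] Omega_iff by blast
qed

lemma jacobian_module_carrier:
  assumes p: "p \<le> n" and \<alpha>: "homog n k \<alpha>"
  shows "carrier (jacobian_module R n \<pi> k \<alpha> p) = contracted n \<pi> k \<alpha> p ` {\<eta>. homog n p \<eta>}"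
proof -
  let ?\<Omega> = "carrier (Omega n (int n - int p - int k))"
  have "contraction n \<pi> (int k) \<alpha> (int n - int p) (\<lambda>\<omega>\<in>carrier (Omega n (int n - int p)). wedge \<eta> \<omega> {..<n})
      = contracted n \<pi> k \<alpha> p \<eta>" for \<eta>
    unfolding contraction_def contracted_def
    by (rule restrict_ext) (use wedge_Omega[OF \<alpha>] in \<open>simp add: wedge_assoc\<close>)
  then show ?thesis
    unfolding jacobian_module_def Let_def by (simp add: Theta_eq[OF p] image_image)
qed

locale jacobian_germ = presentation R n \<pi> + embedded_germ n hs I "a_kernel (conv_ring n) R \<pi>" d
  for R :: "(complex, 'r) module" and n \<pi> hs I d +
  fixes \<alpha> :: form
  assumes \<alpha>: "homog n (length hs) \<alpha>"
    and \<alpha>_dh: "\<And>L. finite L \<Longrightarrow> \<alpha> L - dh L \<in> a_kernel (conv_ring n) R \<pi>"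
begin

abbreviation ctr where "ctr \<equiv> contracted n \<pi> (length hs) \<alpha>"

text \<open>
  Pairing \<open>(\<eta> - \<zeta>) \<and> \<alpha>\<close> with basis forms recovers its coefficients up to sign, so equality of the maps
  means that this form vanishes modulo \<open>J\<close>. There \<open>\<alpha>\<close> may be replaced by \<open>dh\<close>.
\<close>

lemma contracted_eq_iff:
  assumes \<eta>: "homog n p \<eta>" and \<zeta>: "homog n p \<zeta>" and p: "p \<le> n"
  shows "ctr p \<eta> = ctr p \<zeta> \<longleftrightarrow>
    (\<forall>vs. length vs = p \<and> (\<forall>v\<in>set vs. tangent n J v) \<longrightarrow>
      \<pi> (foldr (iprod n) vs \<eta> {}) = \<pi> (foldr (iprod n) vs \<zeta> {}))"
proof -
  let ?N = "{..<n}" and ?\<Omega> = "carrier (Omega n (int n - int p - int (length hs)))"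
  define \<xi> where "\<xi> = (\<lambda>J. \<eta> J - \<zeta> J)"
  have \<xi>: "homog n p \<xi>" unfolding \<xi>_def by (rule homog_diff[OF \<eta> \<zeta>])
  have \<xi>\<alpha>: "homog n (p + length hs) (wedge \<xi> \<alpha>)" by (rule homog_wedge[OF \<xi> \<alpha>])
  have cps\<Omega>: "\<omega> J \<in> cps n" if "\<omega> \<in> ?\<Omega>" for \<omega> J using that by (auto simp: Omega_def)
  have diff: "wedge (wedge \<eta> \<alpha>) \<omega> ?N - wedge (wedge \<zeta> \<alpha>) \<omega> ?N = wedge (wedge \<xi> \<alpha>) \<omega> ?N" for \<omega>
    unfolding \<xi>_def wedge_diff_left[symmetric] by (rule wedge_cong) (simp_all add: wedge_diff_left)
  have wc: "wedge (wedge \<theta> \<alpha>) \<omega> ?N \<in> cps n" if "homog n p \<theta>" "\<omega> \<in> ?\<Omega>" for \<theta> \<omega>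
    by (rule wedge_cps) (rule homog_cps[OF homog_wedge[OF that(1) \<alpha>]], rule cps\<Omega>[OF that(2)])
  have "ctr p \<eta> = ctr p \<zeta> \<longleftrightarrow> (\<forall>\<omega>\<in>?\<Omega>. \<pi> (wedge (wedge \<eta> \<alpha>) \<omega> ?N) = \<pi> (wedge (wedge \<zeta> \<alpha>) \<omega> ?N))"
    unfolding contracted_def by (auto simp: fun_eq_iff restrict_def)
  also have "\<dots> \<longleftrightarrow> (\<forall>\<omega>\<in>?\<Omega>. wedge (wedge \<xi> \<alpha>) \<omega> ?N \<in> J)"
    using wc[OF \<eta>] wc[OF \<zeta>] by (simp add: pi_eq_iff diff)
  also have "\<dots> \<longleftrightarrow> vanishes J (wedge \<xi> \<alpha>)"
  proof
    assume van: "vanishes J (wedge \<xi> \<alpha>)"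
    show "\<forall>\<omega>\<in>?\<Omega>. wedge (wedge \<xi> \<alpha>) \<omega> ?N \<in> J"
    proof
      fix \<omega> assume "\<omega> \<in> ?\<Omega>"
      then have "vanishes J (wedge (wedge \<xi> \<alpha>) \<omega>)" by (intro vanishes_wedge_left[OF J van] cps\<Omega>)
      then show "wedge (wedge \<xi> \<alpha>) \<omega> ?N \<in> J" by (simp add: vanishes_def)
    qed
  next
    assume all: "\<forall>\<omega>\<in>?\<Omega>. wedge (wedge \<xi> \<alpha>) \<omega> ?N \<in> J"
    show "vanishes J (wedge \<xi> \<alpha>)" unfolding vanishes_def
    proof (intro allI impI)
      fix K :: "nat set" assume K: "finite K"
      show "wedge \<xi> \<alpha> K \<in> J"
      proof (cases "wedge \<xi> \<alpha> K = 0")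
        case True then show ?thesis using idl_0[OF J] by simp
      next
        case False
        then have Kn: "K \<subseteq> ?N" "card K = p + length hs" using homog_sub[OF \<xi>\<alpha>] homog_card[OF \<xi>\<alpha>] by blast+
        let ?U = "?N - K"
        have "card ?U = n - (p + length hs)" using Kn K by (simp add: card_Diff_subset)
        moreover have "p + length hs \<le> n" using card_mono[OF _ Kn(1)] Kn(2) by simp
        ultimately have "int n - int p - int (length hs) = int (card ?U)" by simp
        then have U: "basis_form ?U \<in> ?\<Omega>" using homog_basis_form[of ?U n] by (simp only: Omega_iff) auto
        have "wedge (wedge \<xi> \<alpha>) (basis_form ?U) ?N = (\<Sum>P\<in>{K}. shuffle_sign P (?N - P) * wedge \<xi> \<alpha> P)"
          unfolding wedge_def[of "wedge \<xi> \<alpha>"]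
        proof (rule sum.mono_neutral_cong_right)
          show "\<forall>P\<in>Pow ?N - {K}. shuffle_sign P (?N - P) * wedge \<xi> \<alpha> P * basis_form ?U (?N - P) = 0"
            using Kn(1) by (auto simp: basis_form_def)
        qed (use Kn in \<open>auto simp: basis_form_def\<close>)
        then have "shuffle_sign K ?U * wedge \<xi> \<alpha> K \<in> J" using all U by fastforce
        then have "shuffle_sign K ?U * (shuffle_sign K ?U * wedge \<xi> \<alpha> K) \<in> J" by (rule idl_mult[OF J shuffle_sign_cps])
        then show ?thesis by simp
      qed
    qed
  qed
  also have "\<dots> \<longleftrightarrow> vanishes J (wedge \<xi> dh)"
  proof -
    have "vanishes J (wedge \<xi> (\<lambda>J. \<alpha> J - dh J))"
      by (rule vanishes_wedge_right[OF J _ homog_cps[OF \<xi>]]) (use \<alpha>_dh in \<open>auto simp: vanishes_def\<close>)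
    then have d: "wedge \<xi> \<alpha> K - wedge \<xi> dh K \<in> J" if "finite K" for K
      using that by (simp add: vanishes_def wedge_diff_right)
    show ?thesis unfolding vanishes_def
    proof (intro iffI allI impI)
      fix K :: "nat set" assume "\<forall>K. finite K \<longrightarrow> wedge \<xi> \<alpha> K \<in> J" "finite K"
      then have "wedge \<xi> \<alpha> K - (wedge \<xi> \<alpha> K - wedge \<xi> dh K) \<in> J" using idl_minus[OF J] d by blast
      then show "wedge \<xi> dh K \<in> J" by simp
    next
      fix K :: "nat set" assume "\<forall>K. finite K \<longrightarrow> wedge \<xi> dh K \<in> J" "finite K"
      then have "(wedge \<xi> \<alpha> K - wedge \<xi> dh K) + wedge \<xi> dh K \<in> J" using idl_add[OF J] d by blast
      then show "wedge \<xi> \<alpha> K \<in> J" by simp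
    qed
  qed
  also have "\<dots> \<longleftrightarrow> (\<forall>vs. length vs = p \<and> (\<forall>v\<in>set vs. tangent n J v) \<longrightarrow> foldr (iprod n) vs \<xi> {} \<in> J)"
    by (rule contraction_kernel[OF \<xi>])
  also have "\<dots> \<longleftrightarrow> (\<forall>vs. length vs = p \<and> (\<forall>v\<in>set vs. tangent n J v) \<longrightarrow>
      \<pi> (foldr (iprod n) vs \<eta> {}) = \<pi> (foldr (iprod n) vs \<zeta> {}))"
  proof -
    have "foldr (iprod n) vs \<xi> {} \<in> J \<longleftrightarrow> \<pi> (foldr (iprod n) vs \<eta> {}) = \<pi> (foldr (iprod n) vs \<zeta> {})"
      if "length vs = p" "\<forall>v\<in>set vs. tangent n J v" for vs
    proof -
      have "homog n 0 (foldr (iprod n) vs \<theta>)" if "homog n p \<theta>" for \<theta>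
        by (rule homog_iprods) (use that \<open>length vs = p\<close> \<open>\<forall>v\<in>set vs. tangent n J v\<close> in \<open>auto simp: tangent_def\<close>)
      then have "foldr (iprod n) vs \<eta> {} \<in> cps n" "foldr (iprod n) vs \<zeta> {} \<in> cps n"
        using \<eta> \<zeta> homog_cps by blast+
      then show ?thesis using pi_eq_iff by (simp add: \<xi>_def iprods_diff)
    qed
    then show ?thesis by blast
  qed
  finally show ?thesis .
qed

lemma contracted_add:
  assumes \<eta>: "homog n p \<eta>" and \<zeta>: "homog n p \<zeta>"
  shows "ctr p (\<lambda>J. \<eta> J + \<zeta> J) = ctr p \<eta> \<oplus>\<^bsub>jacobian_module R n \<pi> (length hs) \<alpha> p\<^esub> ctr p \<zeta>"
proof -
  let ?\<Omega> = "carrier (Omega n (int n - int p - int (length hs)))"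
  have cps\<Omega>: "\<omega> J \<in> cps n" if "\<omega> \<in> ?\<Omega>" for \<omega> J using that by (auto simp: Omega_def)
  have wc: "wedge (wedge \<theta> \<alpha>) \<omega> {..<n} \<in> cps n" if "homog n p \<theta>" "\<omega> \<in> ?\<Omega>" for \<theta> \<omega>
    by (rule wedge_cps) (rule homog_cps[OF homog_wedge[OF that(1) \<alpha>]], rule cps\<Omega>[OF that(2)])
  have "wedge (wedge (\<lambda>J. \<eta> J + \<zeta> J) \<alpha>) \<omega> {..<n} = wedge (wedge \<eta> \<alpha>) \<omega> {..<n} + wedge (wedge \<zeta> \<alpha>) \<omega> {..<n}" for \<omega>
    unfolding wedge_add_left[symmetric] by (rule wedge_cong) (simp_all add: wedge_add_left)
  then show ?thesis using wc[OF \<eta>] wc[OF \<zeta>]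
    unfolding jacobian_module_def contracted_def Let_def by (auto simp: restrict_def fun_eq_iff)
qed

lemma contracted_scale:
  assumes \<eta>: "homog n p \<eta>" and f: "f \<in> cps n"
  shows "ctr p (\<lambda>J. f * \<eta> J) = \<pi> f \<odot>\<^bsub>jacobian_module R n \<pi> (length hs) \<alpha> p\<^esub> ctr p \<eta>"
proof -
  let ?\<Omega> = "carrier (Omega n (int n - int p - int (length hs)))"
  have cps\<Omega>: "\<omega> J \<in> cps n" if "\<omega> \<in> ?\<Omega>" for \<omega> J using that by (auto simp: Omega_def)
  have wc: "wedge (wedge \<eta> \<alpha>) \<omega> {..<n} \<in> cps n" if "\<omega> \<in> ?\<Omega>" for \<omega>
    by (rule wedge_cps) (rule homog_cps[OF homog_wedge[OF \<eta> \<alpha>]], rule cps\<Omega>[OF that])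
  have "wedge (wedge (\<lambda>J. f * \<eta> J) \<alpha>) \<omega> {..<n} = f * wedge (wedge \<eta> \<alpha>) \<omega> {..<n}" for \<omega>
    unfolding wedge_scale_left[symmetric] by (rule wedge_cong) (simp_all add: wedge_scale_left)
  then show ?thesis using wc f
    unfolding jacobian_module_def contracted_def Let_def by (auto simp: restrict_def fun_eq_iff)
qed

end

lemma enat_Sup_attained:
  assumes "Sup {enat (length xs) | xs. P xs} = enat (Suc d)"
  obtains xs where "P xs" "Suc d \<le> length xs"
proof -
  have "enat d < Sup {enat (length xs) | xs. P xs}" unfolding assms by simp
  then obtain xs where "P xs" "d < length xs" unfolding less_Sup_iff by auto
  then show thesis using that by simp
qed

text \<open>
  The identity presentation turns \<open>hs\<close> into a regular sequence on \<open>A\<close>, which bounds the growth of \<open>A / I\<close>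
  by \<open>d\<close>. A regular sequence in \<open>R\<close> of length \<open>d\<close> exists since the depth of \<open>R\<close> is its dimension, and it
  bounds the growth of all associated primes from below.
\<close>

lemma jacobian_data_germ:
  fixes R :: "(complex, 'r) module"
  assumes red: "reduced_ring R"
    and cm: "cohen_macaulay_local R" and data: "jacobian_data R n \<pi> hs \<alpha>"
  shows "\<exists>I d. jacobian_germ R n \<pi> hs I d \<alpha>"
proof -
  have R: "cring R" using red by (simp add: reduced_ring_def)
  have emb: "embedding n R \<pi>" and dimR: "krull_dim R + enat (length hs) = enat n"
    and rci: "reduced_complete_intersection n hs"
    and sub: "genideal (conv_ring n) (set hs) \<subseteq> a_kernel (conv_ring n) R \<pi>"
    and ff: "fundamental_form n hs (a_kernel (conv_ring n) R \<pi>) \<alpha>"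
    using data by (auto simp: jacobian_data_def)
  interpret presentation R n \<pi> by (rule presentation.intro[OF R emb])
  interpret A: presentation "conv_ring n" n id by (rule presentation_conv)
  define I where "I = genideal (conv_ring n) (set hs)"
  obtain d where d: "krull_dim R = enat d" "d + length hs = n"
    using dimR by (cases "krull_dim R") auto
  have reg: "regular_sequence (conv_ring n) hs" and redI: "reduced_ring (conv_ring n Quot I)"
    using rci by (auto simp: reduced_complete_intersection_def I_def)
  have hs: "set hs \<subseteq> cps n" using reg by (auto simp: regular_sequence_def)
  have Ii: "ideal I (conv_ring n)" unfolding I_def by (rule conv.genideal_ideal) (use hs in auto)
  have kA: "a_kernel (conv_ring n) (conv_ring n) id = {0}" by (auto simp: A.J_iff)
  have regA: "regular_mod n {0} hs" "1 \<notin> adjoin_list n {0} hs"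
    using A.regular_sequence_lift[OF hs] reg kA by simp_all
  have IA: "I = adjoin_list n {0} hs" using A.adjoin_list_J_eq[OF hs] kA ideal.Icarr[OF Ii] by (auto simp: I_def)
  have uI: "growth_le n I d"
    using growth_le_regular_mod[OF idl_zero regA growth_le_zero] d(2) by (auto simp: IA)
  obtain M where depth: "depth R M = krull_dim R" using cm by (auto simp: cohen_macaulay_local_def)
  have low: "d \<le> e" if Q: "associated_prime n J Q" "growth_le n Q e" for Q e
  proof (cases d)
    case (Suc d')
    obtain ys where ys: "regular_sequence R ys" "d \<le> length ys"
      by (rule enat_Sup_attained[of "\<lambda>xs. regular_sequence R xs \<and> set xs \<subseteq> M" d'])
         (use depth d Suc in \<open>auto simp: depth_def\<close>)
    have "\<exists>x. x \<in> cps n \<and> \<pi> x = y" if "y \<in> set ys" for y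
      using ys(1) that pi_surj[of y] by (auto simp: regular_sequence_def)
    then obtain l where l: "\<And>y. y \<in> set ys \<Longrightarrow> l y \<in> cps n \<and> \<pi> (l y) = y" by metis
    define xs where "xs = map l ys"
    have xs: "set xs \<subseteq> cps n" using l by (auto simp: xs_def)
    have "map \<pi> xs = ys" unfolding xs_def using l by (simp add: map_idI)
    then have rs: "regular_mod n J xs" "1 \<notin> adjoin_list n J xs" using regular_sequence_lift[OF xs] ys(1) by simp_all
    obtain r where r: "r \<in> cps n" "r \<notin> J" "Q = colon n J r" using Q(1) by (auto simp: associated_prime_def)
    have "length xs \<le> e" by (rule depth_bound[OF J rs r(1,2)]) (use Q(2) r(3) in simp)
    then show ?thesis using ys(2) by (simp add: xs_def)
  qed simp
  have Jrad: "a \<in> J" if "a \<in> cps n" "a * a \<in> J" for a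
  proof -
    have "\<pi> a [^]\<^bsub>R\<^esub> (2 :: nat) = \<zero>\<^bsub>R\<^esub>"
      using that by (simp add: J_iff numeral_2_eq_2)
    then have "\<pi> a = \<zero>\<^bsub>R\<^esub>" using red that by (auto simp: reduced_ring_def)
    then show ?thesis using that by (simp add: J_iff)
  qed
  have alpha: "homog n (length hs) \<alpha>"
    using ff by (auto simp: fundamental_form_def Let_def Omega_iff)
  have "jacobian_germ R n \<pi> hs I d \<alpha>"
  proof unfold_locales
    show "idl n I" using Ii idl_iff_ideal by blast
    show "set hs \<subseteq> I" unfolding I_def by (rule conv.genideal_self) (use hs in auto)
    show "I \<subseteq> S" if "idl n S" "set hs \<subseteq> S" for S
      unfolding I_def by (rule conv.genideal_minimal) (use that idl_iff_ideal in auto)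
    show "a \<in> I" if "a \<in> cps n" "a * a \<in> I" for a
      using Quot_reduced[OF Ii redI, of a] that by simp
    show "length hs + d = n" using d by simp
    show "I \<subseteq> J" using sub by (simp add: I_def)
    show "\<alpha> L - wedge_differentials hs L \<in> J" if "finite L" for L
    proof (cases "L \<subseteq> {..<n} \<and> card L = length hs")
      case True then show ?thesis using fundamental_form_congruent[OF ff hs J sub] by blast
    next
      case False
      then have "\<alpha> L = 0" "wedge_differentials hs L = 0"
        using homog_sub[OF alpha, of L] homog_card[OF alpha, of L]
          homog_sub[OF homog_wedge_differentials[OF hs], of L] homog_card[OF homog_wedge_differentials[OF hs], of L] by blast+
      then show ?thesis using idl_0[OF J] by simp
    qed
  qed (fact J uI low Jrad alpha)+
  then show ?thesis by blast
qed

text \<open>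
  Pairs of forms with the same values on derivations of \<open>R\<close> define a relation between the two modules.
  Equality in either module is equality of these values, so the relation is the graph of a bijection;
  it is total on both sides by pulling back in both directions, and it respects the operations.
\<close>

lemma jacobian_modules_isomorphic:
  fixes R :: "(complex, 'r) module"
  assumes G: "jacobian_germ R n \<pi> hs I d \<alpha>" and G': "jacobian_germ R n' \<pi>' hs' I' d' \<alpha>'"
    and p: "p \<le> n" "p \<le> n'"
  shows "mod_isomorphic R (jacobian_module R n \<pi> (length hs) \<alpha> p) (jacobian_module R n' \<pi>' (length hs') \<alpha>' p)"
proof -
  interpret G: jacobian_germ R n \<pi> hs I d \<alpha> by fact
  interpret G': jacobian_germ R n' \<pi>' hs' I' d' \<alpha>' by fact
  interpret T: two_presentations R n \<pi> n' \<pi>' by unfold_locales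
  interpret T': two_presentations R n' \<pi>' n \<pi> by unfold_locales
  let ?M = "jacobian_module R n \<pi> (length hs) \<alpha> p" and ?M' = "jacobian_module R n' \<pi>' (length hs') \<alpha>' p"
  have cM: "carrier ?M = G.ctr p ` {\<eta>. homog n p \<eta>}" by (rule jacobian_module_carrier[OF p(1) G.\<alpha>])
  have cM': "carrier ?M' = G'.ctr p ` {\<eta>. homog n' p \<eta>}" by (rule jacobian_module_carrier[OF p(2) G'.\<alpha>])
  define rel where "rel \<eta> \<eta>' \<longleftrightarrow> homog n p \<eta> \<and> homog n' p \<eta>' \<and> T.same_values \<eta> \<eta>'" for \<eta> \<eta>'
  have lv: "list_all2 T.V us us' \<longleftrightarrow> list_all2 T'.V us' us" for us us'
    by (auto simp: list_all2_conv_all_nth same_derivation_swap[of n \<pi> n' \<pi>'])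
  have sv_swap: "T.same_values \<eta> \<eta>' \<longleftrightarrow> T'.same_values \<eta>' \<eta>" for \<eta> \<eta>'
    unfolding T.same_values_def T'.same_values_def lv same_image_swap[of n \<pi> n' \<pi>'] by blast
  have tr: "\<exists>vs'. list_all2 T.V vs vs' \<and> (\<forall>v\<in>set vs'. tangent n' G'.J v)" if "\<forall>v\<in>set vs. tangent n G.J v" for vs
    using that
  proof (induction vs)
    case (Cons v vs)
    then obtain vs' where vs': "list_all2 T.V vs vs'" "\<forall>v\<in>set vs'. tangent n' G'.J v" by auto
    obtain v' where "tangent n' G'.J v'" "T.V v v'" using T.tangent_transfer[of v] Cons.prems by auto
    then show ?case using vs' by (intro exI[of _ "v' # vs'"]) auto
  qed simp
  have tr': "\<exists>vs. list_all2 T.V vs vs' \<and> (\<forall>v\<in>set vs. tangent n G.J v)" if "\<forall>v\<in>set vs'. tangent n' G'.J v" for vs'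
    using that
  proof (induction vs')
    case (Cons v' vs')
    then obtain vs where vs: "list_all2 T.V vs vs'" "\<forall>v\<in>set vs. tangent n G.J v" by auto
    obtain v where v: "tangent n G.J v" "T'.V v' v" using T'.tangent_transfer[of v'] Cons.prems by auto
    have "T.V v v'" by (rule iffD1[OF same_derivation_swap v(2)])
    then show ?case using vs v(1) by (intro exI[of _ "v # vs"]) auto
  qed simp
  have val: "\<pi> (foldr (iprod n) vs \<eta> {}) = \<pi>' (foldr (iprod n') vs' \<eta>' {})"
    if "rel \<eta> \<eta>'" "list_all2 T.V vs vs'" for \<eta> \<eta>' vs vs'
    using that by (auto simp: rel_def T.same_values_def same_image_def)
  have iff: "G.ctr p \<eta> = G.ctr p \<zeta> \<longleftrightarrow> G'.ctr p \<eta>' = G'.ctr p \<zeta>'" if r: "rel \<eta> \<eta>'" "rel \<zeta> \<zeta>'" for \<eta> \<eta>' \<zeta> \<zeta>'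
  proof -
    have h: "homog n p \<eta>" "homog n p \<zeta>" "homog n' p \<eta>'" "homog n' p \<zeta>'" using r by (auto simp: rel_def)
    show ?thesis unfolding G.contracted_eq_iff[OF h(1,2) p(1)] G'.contracted_eq_iff[OF h(3,4) p(2)]
    proof (intro iffI allI impI)
      fix vs' assume all: "\<forall>vs. length vs = p \<and> (\<forall>v\<in>set vs. tangent n G.J v) \<longrightarrow>
          \<pi> (foldr (iprod n) vs \<eta> {}) = \<pi> (foldr (iprod n) vs \<zeta> {})"
        and vs': "length vs' = p \<and> (\<forall>v\<in>set vs'. tangent n' G'.J v)"
      obtain vs where vs: "list_all2 T.V vs vs'" "\<forall>v\<in>set vs. tangent n G.J v" using tr' vs' by blast
      then have "length vs = p" using vs' list_all2_lengthD by metis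
      then have "\<pi> (foldr (iprod n) vs \<eta> {}) = \<pi> (foldr (iprod n) vs \<zeta> {})" using all vs(2) by blast
      then show "\<pi>' (foldr (iprod n') vs' \<eta>' {}) = \<pi>' (foldr (iprod n') vs' \<zeta>' {})"
        using val[OF r(1) vs(1)] val[OF r(2) vs(1)] by simp
    next
      fix vs assume all: "\<forall>vs'. length vs' = p \<and> (\<forall>v\<in>set vs'. tangent n' G'.J v) \<longrightarrow>
          \<pi>' (foldr (iprod n') vs' \<eta>' {}) = \<pi>' (foldr (iprod n') vs' \<zeta>' {})"
        and vs: "length vs = p \<and> (\<forall>v\<in>set vs. tangent n G.J v)"
      obtain vs' where vs': "list_all2 T.V vs vs'" "\<forall>v\<in>set vs'. tangent n' G'.J v" using tr vs by blast
      then have "length vs' = p" using vs list_all2_lengthD by metis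
      then have "\<pi>' (foldr (iprod n') vs' \<eta>' {}) = \<pi>' (foldr (iprod n') vs' \<zeta>' {})" using all vs'(2) by blast
      then show "\<pi> (foldr (iprod n) vs \<eta> {}) = \<pi> (foldr (iprod n) vs \<zeta> {})"
        using val[OF r(1) vs'(1)] val[OF r(2) vs'(1)] by simp
    qed
  qed
  have ex: "\<exists>\<eta>'. rel \<eta> \<eta>'" if h: "homog n p \<eta>" for \<eta>
  proof -
    obtain \<eta>' where "homog n' p \<eta>'" "T.same_values \<eta> \<eta>'" by (rule T.pull_back[OF h])
    then show ?thesis using h unfolding rel_def by blast
  qed
  have ex': "\<exists>\<eta>. rel \<eta> \<eta>'" if h: "homog n' p \<eta>'" for \<eta>'
  proof -
    obtain \<eta> where "homog n p \<eta>" "T'.same_values \<eta>' \<eta>" by (rule T'.pull_back[OF h])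
    then show ?thesis using h unfolding rel_def sv_swap by blast
  qed
  have "\<exists>y. \<forall>\<eta> \<eta>'. rel \<eta> \<eta>' \<longrightarrow> x = G.ctr p \<eta> \<longrightarrow> y = G'.ctr p \<eta>'" for x
  proof (cases "\<exists>\<eta> \<eta>'. rel \<eta> \<eta>' \<and> x = G.ctr p \<eta>")
    case True
    then obtain \<eta> \<eta>' where r: "rel \<eta> \<eta>'" "x = G.ctr p \<eta>" by blast
    then show ?thesis using iff[OF r(1)] by (intro exI[of _ "G'.ctr p \<eta>'"]) auto
  qed auto
  then obtain F where F: "\<And>\<eta> \<eta>'. rel \<eta> \<eta>' \<Longrightarrow> F (G.ctr p \<eta>) = G'.ctr p \<eta>'" by metis
  define \<Phi> where "\<Phi> = restrict F (carrier ?M)"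
  have \<Phi>: "\<Phi> (G.ctr p \<eta>) = G'.ctr p \<eta>'" if "rel \<eta> \<eta>'" for \<eta> \<eta>'
  proof -
    have "G.ctr p \<eta> \<in> carrier ?M" using that by (auto simp: cM rel_def)
    then show ?thesis using F[OF that] by (simp add: \<Phi>_def)
  qed
  have el: "\<exists>\<eta> \<eta>'. x = G.ctr p \<eta> \<and> rel \<eta> \<eta>'" if "x \<in> carrier ?M" for x
    using that ex unfolding cM by blast
  have el': "\<exists>\<eta> \<eta>'. x = G'.ctr p \<eta>' \<and> rel \<eta> \<eta>'" if "x \<in> carrier ?M'" for x
    using that ex' unfolding cM' by blast
  have mem': "G'.ctr p \<eta>' \<in> carrier ?M'" if "rel \<eta> \<eta>'" for \<eta> \<eta>' using that by (auto simp: cM' rel_def)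
  have "\<Phi> \<in> mod_hom R ?M ?M'"
    unfolding mod_hom_def
  proof (intro CollectI conjI ballI)
    show "\<Phi> \<in> carrier ?M \<rightarrow>\<^sub>E carrier ?M'"
    proof (rule PiE_I)
      fix x assume "x \<in> carrier ?M"
      then show "\<Phi> x \<in> carrier ?M'" using el \<Phi> mem' by metis
    qed (simp add: \<Phi>_def)
    fix x assume "x \<in> carrier ?M"
    then obtain \<eta> \<eta>' where x: "x = G.ctr p \<eta>" "rel \<eta> \<eta>'" using el by blast
    then have h: "homog n p \<eta>" "homog n' p \<eta>'" by (auto simp: rel_def)
    {
      fix y assume "y \<in> carrier ?M"
      then obtain \<zeta> \<zeta>' where y: "y = G.ctr p \<zeta>" "rel \<zeta> \<zeta>'" using el by blast
      then have h': "homog n p \<zeta>" "homog n' p \<zeta>'" by (auto simp: rel_def)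
      have "rel (\<lambda>J. \<eta> J + \<zeta> J) (\<lambda>J. \<eta>' J + \<zeta>' J)"
        using x y unfolding rel_def by (auto intro: homog_add T.same_values_add)
      then have "\<Phi> (G.ctr p (\<lambda>J. \<eta> J + \<zeta> J)) = G'.ctr p (\<lambda>J. \<eta>' J + \<zeta>' J)" by (rule \<Phi>)
      then show "\<Phi> (x \<oplus>\<^bsub>?M\<^esub> y) = \<Phi> x \<oplus>\<^bsub>?M'\<^esub> \<Phi> y"
        unfolding G.contracted_add[OF h(1) h'(1)] G'.contracted_add[OF h(2) h'(2)] x(1) y(1) \<Phi>[OF x(2)] \<Phi>[OF y(2)] .
    }
    {
      fix r assume "r \<in> carrier R"
      then obtain f where f: "f \<in> cps n" "\<pi> f = r" by (rule G.pi_surj)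
      then obtain f' where f': "T.E f f'" using T.E_right by blast
      then have fc': "f' \<in> cps n'" "\<pi>' f' = r" using f by (auto simp: same_image_def)
      have "rel (\<lambda>J. f * \<eta> J) (\<lambda>J. f' * \<eta>' J)"
        using x f(1) fc'(1) f' unfolding rel_def by (auto intro: homog_scale T.same_values_scale)
      then have "\<Phi> (G.ctr p (\<lambda>J. f * \<eta> J)) = G'.ctr p (\<lambda>J. f' * \<eta>' J)" by (rule \<Phi>)
      then show "\<Phi> (r \<odot>\<^bsub>?M\<^esub> x) = r \<odot>\<^bsub>?M'\<^esub> \<Phi> x"
        unfolding G.contracted_scale[OF h(1) f(1)] G'.contracted_scale[OF h(2) fc'(1)] f(2) fc'(2) x(1) \<Phi>[OF x(2)] .
    }
  qed
  moreover have "bij_betw \<Phi> (carrier ?M) (carrier ?M')"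
    unfolding bij_betw_def
  proof
    show "inj_on \<Phi> (carrier ?M)"
    proof (rule inj_onI)
      fix x y assume "x \<in> carrier ?M" "y \<in> carrier ?M" and eq: "\<Phi> x = \<Phi> y"
      then obtain \<eta> \<eta>' \<zeta> \<zeta>' where xy: "x = G.ctr p \<eta>" "rel \<eta> \<eta>'" "y = G.ctr p \<zeta>" "rel \<zeta> \<zeta>'" using el by metis
      then have "G'.ctr p \<eta>' = G'.ctr p \<zeta>'" using eq \<Phi> by simp
      then show "x = y" using iff[OF xy(2,4)] xy by simp
    qed
    show "\<Phi> ` carrier ?M = carrier ?M'"
    proof (intro equalityI subsetI)
      fix y assume "y \<in> \<Phi> ` carrier ?M"
      then obtain x where "x \<in> carrier ?M" "y = \<Phi> x" by blast
      then show "y \<in> carrier ?M'" using el \<Phi> mem' by metis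
    next
      fix y assume "y \<in> carrier ?M'"
      then obtain \<eta> \<eta>' where y: "y = G'.ctr p \<eta>'" "rel \<eta> \<eta>'" using el' by blast
      then have "y = \<Phi> (G.ctr p \<eta>)" using \<Phi> by simp
      moreover have "G.ctr p \<eta> \<in> carrier ?M" using y(2) by (auto simp: cM rel_def)
      ultimately show "y \<in> \<Phi> ` carrier ?M" by blast
    qed
  qed
  ultimately show ?thesis unfolding mod_isomorphic_def by blast
qed

theorem proposition3p28:
  fixes R :: "(complex, 'r) module"
    and n n' p :: nat
    and \<pi> \<pi>' :: "mpser \<Rightarrow> 'r"
    and hs hs' :: "mpser list"
    and \<alpha> \<alpha>' :: form
  assumes "algebra (ring_of_type_algebra :: complex ring) R"
    and "reduced_ring R"
    and "cohen_macaulay_local R"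
    and "jacobian_data R n \<pi> hs \<alpha>"
    and "jacobian_data R n' \<pi>' hs' \<alpha>'"
    and "p \<le> n" and "p \<le> n'"
  shows "mod_isomorphic R
           (jacobian_module R n \<pi> (length hs) \<alpha> p)
           (jacobian_module R n' \<pi>' (length hs') \<alpha>' p)"
proof -
  obtain I d where "jacobian_germ R n \<pi> hs I d \<alpha>"
    using jacobian_data_germ[OF assms(2,3,4)] by blast
  moreover obtain I' d' where "jacobian_germ R n' \<pi>' hs' I' d' \<alpha>'"
    using jacobian_data_germ[OF assms(2,3,5)] by blast
  ultimately show ?thesis using assms(6,7) by (rule jacobian_modules_isomorphic)
qed

end
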